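(* Let $G=(V,E)$ be the simplicial graph associated to a polyhedral tessellation $\mathcal{P}$ of $\mathbb{R}^d$, let $p=(p_e)_{e\in E}$ with $p_e\in[0,1]$, and let $q\ge1$. Let $\hat p_e=p_e/(p_e+q(1-p_e))$ and $$\hat g_e=2(1-\hat p_e)+3\sum_{e'\in\Delta_{\mathcal{P}}(\{e\})}(1-\hat p_{e'}).$$ Assume that $p_e>0$ for all $e\in E$ and that $\lim_{\Lambda\uparrow E}\sup_{e\notin\Lambda}\hat g_e<1$ (limit along finite subsets $\Lambda$ of $E$ increasing to $E$). Then the random cluster measure on $G$ with parameters $p,q$ is unique: the set $\mathcal{R}_{p,q}$ of DLR random cluster measures and the set $\mathcal{W}_{p,q}$ of limit random cluster measures coincide and consist of exactly one element.
   Context: **Tessellations.** A convex cell is a closed convex subset $A$ of some $\mathbb{R}^\ell$ that is an intersection of finitely many closed half-spaces; $A_i$ is its set of $i$-dimensional faces. If $A$ is a convex cell of dimension $m$ and $\varphi:A\to\mathbb{R}^d$ is an injective continuous piecewise affine map, then $\sigma=\varphi(A)$ is called a cell of $\mathbb{R}^d$ of dimension $m$; the collections $\sigma_i=\{\varphi(B):B\in A_i\}$, $i=0,\dots,m$, form a polyhedron. A polytope $\mathcal{P}$ in $\mathbb{R}^d$ is given by sets $P_0,\dots,P_m$ such that: (i) the elements of $P_i$ are $i$-dimensional cells of $\mathbb{R}^d$; (ii) every bounded region meets only finitely many elements of $P_i$; (iii) for $\sigma\in P_i$, setting $P_j(\sigma)=\{\tau\in P_j:\tau\subset\sigma\}$,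 the collection $P_0(\sigma),\dots,P_i(\sigma)$ is a polyhedron (the elements of $P_j(\sigma)$ are the $j$-faces of $\sigma$); (iv) for $\sigma\in P_i,\tau\in P_j$, $\sigma\cap\tau$ is either empty or a union of faces of $\sigma$ and $\tau$. The polytope is a polyhedral tessellation of $\mathbb{R}^d$ if the union of its cells is $\mathbb{R}^d$. The associated graph $G(\mathcal{P})$, called a simplicial graph, has vertex set $P_0$, edge set $P_1$, the end vertexes of $e\in P_1$ being the two vertexes contained in $e$. For $H\subset P_1$, $\Delta_{\mathcal{P}}(H)$ is the set of edges $e\in P_1\setminus H$ for which there exist $h\in H$ and $\sigma\in P_d$ with $e,h\subset\sigma$. **Random cluster measures.** $\Omega=\{0,1\}^E$, $\mathcal{F}$ is the $\sigma$-algebra generated by finite cylinders, and for $\omega\in\Omega$, $E(\omega)=\{e\in E:\omega_e=1\}$. For $e\in E$, $L_e=\{\omega:\omega_e=1\}$, $\mathcal{T}_e$ is the $\sigma$-algebra generated by the finite cylinders with base contained in $E\setminus\{e\}$, and $K_e$ is the set of $\omega$ such that there is a path of edges in $E(\omega)\setminus\{e\}$ joining the two end vertexes of $e$. A probability $\phi$ on $(\Omega,\mathcal{F})$ is a DLR random cluster measure (an element of $\mathcal{R}_{p,q}$) if for all $e\in E$, $\phi$-almost surely, $\phi(L_e|\mathcal{T}_e)(\omega)=p_e$ if $\omega\in K_e$ and $\phi(L_e|\mathcal{T}_e)(\omega)=\hat p_e$ if $\omega\notin K_e$. For $\xi\in\Omega$ and finite $F\subset E$ let $\Omega^\xi_F=\{\omega\in\Omega:\omega_e=\xi_e\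 \forall e\notin F\}$ and let $\phi^\xi_{F,p,q}$ be the probability on $\Omega$ with $$\phi^\xi_{F,p,q}(\omega)=\frac1{Z_{\xi,F}}\Big[\prod_{e\in F}p_e^{\omega_e}(1-p_e)^{1-\omega_e}\Big]q^{k(\omega,F)}\quad\text{if }\omega\in\Omega^\xi_F,$$ and $0$ otherwise, where $k(\omega,F)$ is the number of connected components of the graph $(V,E(\omega))$ that intersect $F$ and $Z_{\xi,F}$ is the normalizing constant. A probability $\phi$ on $(\Omega,\mathcal{F})$ is a limit random cluster measure (an element of $\mathcal{W}_{p,q}$) if there is a sequence $(\xi_n,F_n)$, with $\xi_n\in\Omega$ and $F_n$ finite subsets of $E$ increasing to $E$, such that $\phi$ is the weak limit of $\phi^{\xi_n}_{F_n,p,q}$. *)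

theory Defs
  imports "HOL-Analysis.Finite_Function_Topology" "HOL-Probability.Probability"
begin

section \<open>Polyhedral tessellations\<close>

text \<open>
  The ambient space \<open>\<real>\<^sup>l\<close> of a convex cell has an arbitrary dimension, so it is not a type here but
  the subspace of the finitely supported real sequences whose support lies in
  \<open>{..<l}\<close>. The norm of \<^typ>\<open>(nat, real) poly_mapping\<close> is the sum norm, which on this subspace induces the usual
  topology.
\<close>

type_synonym fin_seq = "(nat, real) poly_mapping"

definition coord_space :: "nat \<Rightarrow> fin_seq set" where
  "coord_space l = {x. Poly_Mapping.keys x \<subseteq> {..<l}}"

definition closed_halfspace :: "nat \<Rightarrow> fin_seq set \<Rightarrow> bool" where
  "closed_halfspace l H \<longleftrightarrow>
     (\<exists>(a :: nat \<Rightarrow> real) b. (\<exists>i<l. a i \<noteq> 0) \<and>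
        H = {x \<in> coord_space l. (\<Sum>i<l. a i * Poly_Mapping.lookup x i) \<le> b})"

definition convex_cell :: "fin_seq set \<Rightarrow> bool" where
  "convex_cell A \<longleftrightarrow>
     (\<exists>l \<H>. finite \<H> \<and> (\<forall>H\<in>\<H>. closed_halfspace l H) \<and> A = coord_space l \<inter> \<Inter>\<H>)"

text \<open>
  The library's \<^const>\<open>aff_dim\<close> is confined to the class \<open>euclidean_space\<close>; this is its defining
  property, for nonempty sets, in an arbitrary real vector space.
\<close>

definition has_dimension :: "'v::real_vector set \<Rightarrow> nat \<Rightarrow> bool" where
  "has_dimension S m \<longleftrightarrow>
     (\<exists>B. affine hull B = affine hull S \<and> \<not> affine_dependent B \<and> card B = m + 1)"

definition cell_faces :: "fin_seq set \<Rightarrow> nat \<Rightarrow> fin_seq set set" where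
  "cell_faces A i = {B. B face_of A \<and> has_dimension B i}"

definition piecewise_affine_on ::
    "fin_seq set \<Rightarrow> (fin_seq \<Rightarrow> 'b::real_vector) \<Rightarrow> bool" where
  "piecewise_affine_on A \<phi> \<longleftrightarrow>
     (\<exists>\<C>. finite \<C> \<and> (\<forall>C\<in>\<C>. convex_cell C) \<and> A = \<Union>\<C> \<and>
        (\<forall>C\<in>\<C>. \<exists>L c. linear L \<and> (\<forall>x\<in>C. \<phi> x = L x + c)))"

definition cell_chart ::
    "nat \<Rightarrow> fin_seq set \<Rightarrow> (fin_seq \<Rightarrow> real^'d) \<Rightarrow> bool" where
  "cell_chart m A \<phi> \<longleftrightarrow>
     convex_cell A \<and> has_dimension A m \<and>
     inj_on \<phi> A \<and> continuous_on A \<phi> \<and> piecewise_affine_on A \<phi>"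

definition is_cell :: "nat \<Rightarrow> (real^'d) set \<Rightarrow> bool" where
  "is_cell m \<sigma> \<longleftrightarrow> (\<exists>A \<phi>. cell_chart m A \<phi> \<and> \<sigma> = \<phi> ` A)"

text \<open>
  The collections \<open>Q 0, \<dots>, Q m\<close> form a polyhedron in the sense of piecewise affine cells (not to be
  confused with the library's \<^const>\<open>polyhedron\<close>). Note that \<open>Q m = {\<phi> ` A}\<close>.
\<close>

definition is_cell_polyhedron :: "nat \<Rightarrow> (nat \<Rightarrow> (real^'d) set set) \<Rightarrow> bool" where
  "is_cell_polyhedron m Q \<longleftrightarrow>
     (\<exists>A \<phi>. cell_chart m A \<phi> \<and> (\<forall>i\<le>m. Q i = (\<lambda>B. \<phi> ` B) ` cell_faces A i))"

definition faces_in :: "(nat \<Rightarrow> (real^'d) set set) \<Rightarrow> (real^'d) set \<Rightarrow> nat \<Rightarrow> (real^'d) set set" where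
  "faces_in P \<sigma> j = {\<tau> \<in> P j. \<tau> \<subseteq> \<sigma>}"

definition is_cell_polytope :: "nat \<Rightarrow> (nat \<Rightarrow> (real^'d) set set) \<Rightarrow> bool" where
  "is_cell_polytope m P \<longleftrightarrow>
     (\<forall>i\<le>m. \<forall>\<sigma>\<in>P i. is_cell i \<sigma>) \<and>
     (\<forall>i\<le>m. \<forall>B. bounded B \<longrightarrow> finite {\<sigma> \<in> P i. \<sigma> \<inter> B \<noteq> {}}) \<and>
     (\<forall>i\<le>m. \<forall>\<sigma>\<in>P i. is_cell_polyhedron i (faces_in P \<sigma>)) \<and>
     (\<forall>i\<le>m. \<forall>j\<le>m. \<forall>\<sigma>\<in>P i. \<forall>\<tau>\<in>P j.
        \<sigma> \<inter> \<tau> = {} \<or>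
        (\<exists>\<C>. \<C> \<subseteq> (\<Union>k\<le>i. faces_in P \<sigma> k) \<inter> (\<Union>k\<le>j. faces_in P \<tau> k) \<and> \<sigma> \<inter> \<tau> = \<Union>\<C>))"

definition polyhedral_tessellation :: "(nat \<Rightarrow> (real^'d) set set) \<Rightarrow> bool" where
  "polyhedral_tessellation P \<longleftrightarrow>
     (\<exists>m. is_cell_polytope m P \<and> (\<Union>i\<le>m. \<Union>(P i)) = UNIV)"

text \<open>
  The simplicial graph has vertex set \<open>P 0\<close> (whose elements are singletons) and edge set \<open>P 1\<close>.
  Distinct edges may have the same end vertexes, since cells need not be straight.
\<close>

definition end_vertexes :: "(nat \<Rightarrow> (real^'d) set set) \<Rightarrow> (real^'d) set \<Rightarrow> (real^'d) set set" where
  "end_vertexes P e = {v \<in> P 0. v \<subseteq> e}"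

definition edge_neighbours ::
    "(nat \<Rightarrow> (real^'d) set set) \<Rightarrow> (real^'d) set set \<Rightarrow> (real^'d) set set" where
  "edge_neighbours P H =
     {e \<in> P 1 - H. \<exists>h\<in>H. \<exists>\<sigma>\<in>P CARD('d). e \<subseteq> \<sigma> \<and> h \<subseteq> \<sigma>}"


section \<open>Random cluster measures\<close>

text \<open>
  A graph is given by its vertex set \<open>V\<close>, its edge set \<open>E\<close> and the map \<open>ends\<close> sending an edge to the
  set of its two end vertexes. A configuration is a Boolean function on \<open>E\<close>, \<open>True\<close> standing for 1.
\<close>

abbreviation config_space :: "'e set \<Rightarrow> ('e \<Rightarrow> bool) measure" where
  "config_space E \<equiv> PiM E (\<lambda>_. count_space UNIV)"

abbreviation configs :: "'e set \<Rightarrow> ('e \<Rightarrow> bool) set" where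
  "configs E \<equiv> PiE E (\<lambda>_. UNIV)"

definition open_edges :: "'e set \<Rightarrow> ('e \<Rightarrow> bool) \<Rightarrow> 'e set" where
  "open_edges E \<omega> = {e \<in> E. \<omega> e}"

definition joined_by :: "('e \<Rightarrow> 'v set) \<Rightarrow> 'e set \<Rightarrow> 'v \<Rightarrow> 'v \<Rightarrow> bool" where
  "joined_by ends S = (\<lambda>x y. \<exists>f\<in>S. ends f = {x, y})\<^sup>*\<^sup>*"

definition edge_open :: "'e set \<Rightarrow> 'e \<Rightarrow> ('e \<Rightarrow> bool) set" where
  "edge_open E e = {\<omega> \<in> configs E. \<omega> e}"

definition sigma_off :: "'e set \<Rightarrow> 'e \<Rightarrow> ('e \<Rightarrow> bool) measure" where
  "sigma_off E e =
     sigma (configs E)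
       {{\<omega> \<in> configs E. \<forall>f\<in>F. \<omega> f = \<eta> f} | F \<eta>. finite F \<and> F \<subseteq> E - {e}}"

definition ends_joined_off ::
    "'e set \<Rightarrow> ('e \<Rightarrow> 'v set) \<Rightarrow> 'e \<Rightarrow> ('e \<Rightarrow> bool) set" where
  "ends_joined_off E ends e =
     {\<omega> \<in> configs E. \<exists>u v. ends e = {u, v} \<and> joined_by ends (open_edges E \<omega> - {e}) u v}"

definition p_hat :: "('e \<Rightarrow> real) \<Rightarrow> real \<Rightarrow> 'e \<Rightarrow> real" where
  "p_hat p q e = p e / (p e + q * (1 - p e))"

definition DLR_random_cluster ::
    "'e set \<Rightarrow> ('e \<Rightarrow> 'v set) \<Rightarrow> ('e \<Rightarrow> real) \<Rightarrow> real \<Rightarrow> ('e \<Rightarrow> bool) measure set" where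
  "DLR_random_cluster E ends p q =
     {\<phi>. prob_space \<phi> \<and> sets \<phi> = sets (config_space E) \<and>
        (\<forall>e\<in>E. AE \<omega> in \<phi>.
           real_cond_exp \<phi> (sigma_off E e) (indicator (edge_open E e)) \<omega> =
             (if \<omega> \<in> ends_joined_off E ends e then p e else p_hat p q e))}"

definition configs_agreeing_off :: "'e set \<Rightarrow> ('e \<Rightarrow> bool) \<Rightarrow> 'e set \<Rightarrow> ('e \<Rightarrow> bool) set" where
  "configs_agreeing_off E \<xi> F = {\<omega> \<in> configs E. \<forall>e\<in>E - F. \<omega> e = \<xi> e}"

definition graph_components :: "'v set \<Rightarrow> ('e \<Rightarrow> 'v set) \<Rightarrow> 'e set \<Rightarrow> 'v set set" where
  "graph_components V ends S = (\<lambda>u. {v \<in> V. joined_by ends S u v}) ` V"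

text \<open>
  A component intersects the set of edges \<open>F\<close> if it contains an end vertex of an edge of \<open>F\<close>;
  isolated vertexes are components too.
\<close>

definition num_components ::
    "'v set \<Rightarrow> 'e set \<Rightarrow> ('e \<Rightarrow> 'v set) \<Rightarrow> ('e \<Rightarrow> bool) \<Rightarrow> 'e set \<Rightarrow> nat" where
  "num_components V E ends \<omega> F =
     card {C \<in> graph_components V ends (open_edges E \<omega>). C \<inter> (\<Union>e\<in>F. ends e) \<noteq> {}}"

definition rc_weight ::
    "'v set \<Rightarrow> 'e set \<Rightarrow> ('e \<Rightarrow> 'v set) \<Rightarrow> ('e \<Rightarrow> real) \<Rightarrow> real \<Rightarrow> 'e set \<Rightarrow> ('e \<Rightarrow> bool) \<Rightarrow> real" where
  "rc_weight V E ends p q F \<omega> =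
     (\<Prod>e\<in>F. if \<omega> e then p e else 1 - p e) * q ^ num_components V E ends \<omega> F"

definition finite_random_cluster ::
    "'v set \<Rightarrow> 'e set \<Rightarrow> ('e \<Rightarrow> 'v set) \<Rightarrow> ('e \<Rightarrow> real) \<Rightarrow> real \<Rightarrow> ('e \<Rightarrow> bool) \<Rightarrow> 'e set \<Rightarrow>
       ('e \<Rightarrow> bool) measure" where
  "finite_random_cluster V E ends p q \<xi> F =
     (let \<Omega>F = configs_agreeing_off E \<xi> F;
          Z = (\<Sum>\<omega>\<in>\<Omega>F. rc_weight V E ends p q F \<omega>)
      in distr (point_measure \<Omega>F (\<lambda>\<omega>. ennreal (rc_weight V E ends p q F \<omega> / Z)))
           (config_space E) (\<lambda>\<omega>. \<omega>))"

definition weakly_converges ::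
    "'e set \<Rightarrow> (nat \<Rightarrow> ('e \<Rightarrow> bool) measure) \<Rightarrow> ('e \<Rightarrow> bool) measure \<Rightarrow> bool" where
  "weakly_converges E \<mu> \<phi> \<longleftrightarrow>
     (\<forall>f :: ('e \<Rightarrow> bool) \<Rightarrow> real.
        continuous_map (product_topology (\<lambda>_. discrete_topology UNIV) E) euclideanreal f \<and>
        bounded (f ` configs E) \<longrightarrow>
        (\<lambda>n. \<integral>\<omega>. f \<omega> \<partial>\<mu> n) \<longlonglongrightarrow> (\<integral>\<omega>. f \<omega> \<partial>\<phi>))"

definition limit_random_cluster ::
    "'v set \<Rightarrow> 'e set \<Rightarrow> ('e \<Rightarrow> 'v set) \<Rightarrow> ('e \<Rightarrow> real) \<Rightarrow> real \<Rightarrow> ('e \<Rightarrow> bool) measure set" where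
  "limit_random_cluster V E ends p q =
     {\<phi>. prob_space \<phi> \<and> sets \<phi> = sets (config_space E) \<and>
        (\<exists>\<xi> F. (\<forall>n. \<xi> n \<in> configs E) \<and> (\<forall>n. finite (F n)) \<and> incseq F \<and> (\<Union>n. F n) = E \<and>
           weakly_converges E (\<lambda>n. finite_random_cluster V E ends p q (\<xi> n) (F n)) \<phi>)}"

text \<open>
  The sum is finite: an edge lies in finitely many \<open>d\<close>-cells, each of which has finitely many edges.
\<close>

definition g_hat ::
    "(nat \<Rightarrow> (real^'d) set set) \<Rightarrow> ((real^'d) set \<Rightarrow> real) \<Rightarrow> real \<Rightarrow> (real^'d) set \<Rightarrow> real" where
  "g_hat P p q e =
     2 * (1 - p_hat p q e) + 3 * (\<Sum>e'\<in>edge_neighbours P {e}. 1 - p_hat p q e')"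

end

theory Submission
  imports Defs
begin

text \<open>
  Fix a finite set \<open>\<Lambda>\<close> of edges and a large finite \<open>D \<supseteq> \<Lambda>\<close>, and reveal the states of the edges of \<open>D\<close> one
  after another, simultaneously for two boundary conditions, always at an edge neighbouring one that was
  already found closed. If this stops before \<open>\<Lambda>\<close> is reached, the unrevealed edges around \<open>\<Lambda>\<close> form a set
  \<open>H\<close> all of whose outer neighbours are open for both boundary conditions. As Euclidean space is
  unicoherent, vertexes of \<open>H\<close> that are joined outside \<open>H\<close> are joined through these outer neighbours, so
  both laws agree in \<open>H\<close>. Every revealed edge \<open>e\<close> is closed with conditional probability at most
  \<open>1 - p_hat p q e\<close>, and the hypothesis makes the sum of the products of these bounds along paths from
  \<open>e\<close> to \<open>\<Lambda>\<close> summable over \<open>e\<close>; hence \<open>\<Lambda>\<close> is reached with small probability if \<open>D\<close> is large. So the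
  finite volume laws converge uniformly in the boundary condition, and both DLR and limit measures must
  coincide with the limit. That the limit is a DLR measure follows by applying the comparison to the
  events that the ends of an edge are joined within a large finite set of edges.
\<close>

section \<open>Finite volume random cluster laws\<close>

text \<open>The conditional law of an edge depends on connections that may run arbitrarily far, so
  the specification is not continuous, and neither inclusion between DLR measures and limit measures
  is automatic. An open barrier removes the dependence, because connections through the outside can
  be rerouted along it. The coupling of two boundary conditions is never constructed as a measure:
  an induction over the unrevealed edges bounds the difference of two expectations by a potential
  \<open>w\<close> that does not grow on average when an edge is revealed. The two expectations may
  be those of different functions, so that a connection of unbounded range can be compared with one
  of finite range. Positivity of \<open>p\<close> gives the fully open state of a finite set
  positive weight, and the conditional probabilities of single edges then determine every finite
  volume law. Geometry reaches the probabilistic part only as connectedness and separation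
  properties of the edges. Cells may be curved and unbounded, but since every edge has two end
  vertexes, a cell that contains a vertex is compact and its vertexes are joined by its edges, as in
  a convex polytope.\<close>

lemma joined_by_refl [simp]: "joined_by ends S u u"
  by (simp add: joined_by_def)

lemma joined_by_trans: "joined_by ends S u v \<Longrightarrow> joined_by ends S v w \<Longrightarrow> joined_by ends S u w"
  by (simp add: joined_by_def)

lemma joined_by_sym: "joined_by ends S u v \<Longrightarrow> joined_by ends S v u"
  unfolding joined_by_def
  by (rule sympD[OF symp_rtranclp]) (auto simp: symp_def insert_commute)

lemma joined_by_cong: "joined_by ends S u w \<Longrightarrow> joined_by ends S u v \<longleftrightarrow> joined_by ends S w v"
  by (blast intro: joined_by_trans joined_by_sym)

lemma joined_by_edge: "f \<in> S \<Longrightarrow> ends f = {u, v} \<Longrightarrow> joined_by ends S u v"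
  unfolding joined_by_def by (rule r_into_rtranclp) blast

lemma joined_by_mono: "joined_by ends S u v \<Longrightarrow> S \<subseteq> S' \<Longrightarrow> joined_by ends S' u v"
  unfolding joined_by_def
  by (erule rtranclp_mono[THEN predicate2D, rotated]) blast

lemma joined_by_induct [consumes 1, case_names refl step]:
  assumes "joined_by ends S u v" and "Q u"
    and "\<And>w w' f. joined_by ends S u w \<Longrightarrow> Q w \<Longrightarrow> f \<in> S \<Longrightarrow> ends f = {w, w'} \<Longrightarrow> Q w'"
  shows "Q v"
  using assms(1) unfolding joined_by_def
proof (induction rule: rtranclp_induct)
  case base
  show ?case by (fact assms(2))
next
  case (step y z)
  then show ?case using assms(3) unfolding joined_by_def by blast
qed

text \<open>A path has finitely many edges. This makes connection events countable unions of
  cylinders and increasing limits of events of finite range.\<close>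

lemma joined_by_finite_subset:
  assumes "joined_by ends S u v"
  obtains S' where "finite S'" "S' \<subseteq> S" "joined_by ends S' u v"
proof -
  from assms have "\<exists>S'. finite S' \<and> S' \<subseteq> S \<and> joined_by ends S' u v"
  proof (induction rule: joined_by_induct)
    case refl
    show ?case by (intro exI[of _ "{}"]) simp
  next
    case (step w w' f)
    then obtain S' where S': "finite S'" "S' \<subseteq> S" "joined_by ends S' u w" by blast
    have "joined_by ends (insert f S') u w'"
      using S'(3) step by (meson insertI1 joined_by_edge joined_by_mono joined_by_trans subset_insertI)
    then show ?case using S' step by (intro exI[of _ "insert f S'"]) auto
  qed
  then show ?thesis using that by blast
qed

text \<open>Repeated crossings of \<open>e\<close> can be cut out, so a path needs \<open>e\<close>
  at most once, in one of its two directions.\<close>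

lemma joined_by_insert_iff:
  assumes "ends e = {a, b}"
  shows "joined_by ends (insert e S) u v \<longleftrightarrow>
    joined_by ends S u v \<or>
    (joined_by ends S u a \<and> joined_by ends S b v) \<or>
    (joined_by ends S u b \<and> joined_by ends S a v)" (is "?L \<longleftrightarrow> ?R")
proof
  assume ?L
  then show ?R
  proof (induction rule: joined_by_induct)
    case refl
    show ?case by simp
  next
    case (step w w' f)
    show ?case
    proof (cases "f = e")
      case True
      then have "{w, w'} = {a, b}" using step assms by simp
      then have "(w = a \<and> w' = b) \<or> (w = b \<and> w' = a)" by (auto simp: doubleton_eq_iff)
      moreover have "joined_by ends S u a \<or> joined_by ends S u b" if "w = a \<or> w = b"
        using step.IH that by auto
      ultimately show ?thesis by auto
    next
      case False
      then have "joined_by ends S w w'" using step by (auto intro: joined_by_edge)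
      then show ?thesis using step.IH by (blast intro: joined_by_trans)
    qed
  qed
next
  have ab: "joined_by ends (insert e S) a b" using assms by (auto intro: joined_by_edge)
  have m: "\<And>x y. joined_by ends S x y \<Longrightarrow> joined_by ends (insert e S) x y"
    by (rule joined_by_mono) auto
  assume ?R
  then show ?L using m ab by (meson joined_by_sym joined_by_trans)
qed

text \<open>A component that meets the end vertexes of \<open>D\<close> is the class of any such
  vertex. For finite \<open>D\<close> this counts the classes of finitely many vertexes, even if the
  graph has infinitely many components.\<close>

lemma num_components_eq_card_image:
  assumes "\<And>e. e \<in> D \<Longrightarrow> ends e \<subseteq> V"
  shows "num_components V E ends \<omega> D =
    card ((\<lambda>u. {v \<in> V. joined_by ends (open_edges E \<omega>) u v}) ` (\<Union>e\<in>D. ends e))"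
proof -
  let ?j = "joined_by ends (open_edges E \<omega>)"
  let ?U = "\<Union>e\<in>D. ends e"
  have "{C \<in> graph_components V ends (open_edges E \<omega>). C \<inter> ?U \<noteq> {}} = (\<lambda>u. {v \<in> V. ?j u v}) ` ?U"
  proof (intro equalityI subsetI)
    fix C assume "C \<in> {C \<in> graph_components V ends (open_edges E \<omega>). C \<inter> ?U \<noteq> {}}"
    then obtain u w where u: "u \<in> V" "C = {v \<in> V. ?j u v}" and w: "w \<in> C" "w \<in> ?U"
      unfolding graph_components_def by blast
    then have "?j u w" by auto
    then have "C = {v \<in> V. ?j w v}" using u by (simp add: joined_by_cong[of _ _ u w])
    then show "C \<in> (\<lambda>u. {v \<in> V. ?j u v}) ` ?U" using w by blast
  next
    fix C assume "C \<in> (\<lambda>u. {v \<in> V. ?j u v}) ` ?U"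
    then obtain u where u: "u \<in> ?U" "C = {v \<in> V. ?j u v}" by blast
    then have "u \<in> V" "u \<in> C" using assms by auto
    then show "C \<in> {C \<in> graph_components V ends (open_edges E \<omega>). C \<inter> ?U \<noteq> {}}"
      using u unfolding graph_components_def by blast
  qed
  then show ?thesis unfolding num_components_def by simp
qed

text \<open>Opening \<open>e\<close> merges the classes of its ends and leaves the others alone. As
  \<open>U\<close> contains both ends, exactly one class is lost unless the ends were already
  joined.\<close>

lemma card_classes_insert_edge:
  assumes ab: "ends e = {a, b}" and U: "finite U" "U \<subseteq> V" "a \<in> U" "b \<in> U"
  shows "card ((\<lambda>u. {v \<in> V. joined_by ends S u v}) ` U) =
    card ((\<lambda>u. {v \<in> V. joined_by ends (insert e S) u v}) ` U) + (if joined_by ends S a b then 0 else 1)"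
proof (cases "joined_by ends S a b")
  case True
  then have "joined_by ends (insert e S) u v \<longleftrightarrow> joined_by ends S u v" for u v
    unfolding joined_by_insert_iff[where ends = ends, OF ab] by (meson joined_by_sym joined_by_trans)
  then show ?thesis using True by simp
next
  case False
  define c where "c u = {v \<in> V. joined_by ends S u v}" for u
  define d where "d u = {v \<in> V. joined_by ends (insert e S) u v}" for u
  have d_ab: "d u = c a \<union> c b" if "joined_by ends S u a \<or> joined_by ends S u b" for u
    using that unfolding d_def c_def joined_by_insert_iff[where ends = ends, OF ab]
    by (auto intro: joined_by_trans dest: joined_by_sym)
  have d_off: "d u = c u" if "\<not> joined_by ends S u a" "\<not> joined_by ends S u b" for u
    using that unfolding d_def c_def joined_by_insert_iff[where ends = ends, OF ab] by auto
  have c_eq: "c u = c w \<longleftrightarrow> joined_by ends S u w" if "u \<in> U" "w \<in> U" for u w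
  proof
    assume "c u = c w"
    moreover have "w \<in> c w" using that U by (auto simp: c_def)
    ultimately have "w \<in> c u" by simp
    then show "joined_by ends S u w" by (simp add: c_def)
  next
    assume "joined_by ends S u w"
    then show "c u = c w" unfolding c_def by (simp add: joined_by_cong[of ends S u w])
  qed
  have eq: "d ` U = insert (c a \<union> c b) (c ` U - {c a, c b})"
  proof (intro equalityI subsetI)
    fix x assume "x \<in> d ` U"
    then obtain u where u: "u \<in> U" "x = d u" by auto
    show "x \<in> insert (c a \<union> c b) (c ` U - {c a, c b})"
    proof (cases "joined_by ends S u a \<or> joined_by ends S u b")
      case True
      then show ?thesis using u d_ab by auto
    next
      case False
      then show ?thesis using u d_off U c_eq by auto
    qed
  next
    fix x assume "x \<in> insert (c a \<union> c b) (c ` U - {c a, c b})"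
    then show "x \<in> d ` U"
    proof
      assume "x = c a \<union> c b"
      then have "x = d a" using d_ab[of a] by simp
      then show ?thesis using U by auto
    next
      assume "x \<in> c ` U - {c a, c b}"
      then obtain u where u: "u \<in> U" "x = c u" "c u \<noteq> c a" "c u \<noteq> c b" by auto
      then have "x = d u" using d_off[of u] c_eq U by auto
      then show ?thesis using u by auto
    qed
  qed
  \<comment> \<open>An old class equal to the merged one would contain \<open>a\<close>, hence be
    the class of \<open>a\<close>.\<close>
  have "c a \<union> c b \<notin> c ` U - {c a, c b}"
  proof
    assume "c a \<union> c b \<in> c ` U - {c a, c b}"
    then obtain u where u: "u \<in> U" "c u = c a \<union> c b" "c u \<noteq> c a" by auto
    have "a \<in> c a" using U by (auto simp: c_def)
    then have "a \<in> c u" using u by auto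
    then have "joined_by ends S u a" by (auto simp: c_def)
    then show False using c_eq u U by auto
  qed
  then have 1: "card (d ` U) = Suc (card (c ` U - {c a, c b}))"
    using eq U by simp
  have ne: "c a \<noteq> c b" using c_eq U False by auto
  have "card (c ` U - {c a, c b}) = card (c ` U) - card {c a, c b}"
    using U by (intro card_Diff_subset) auto
  moreover have "card {c a, c b} \<le> card (c ` U)" using U by (intro card_mono) auto
  ultimately have "card (c ` U) = card (d ` U) + 1" using 1 ne by simp
  then show ?thesis using False unfolding c_def d_def by simp
qed

text \<open>A state of the finite set \<open>D\<close> is coded by its set \<open>S\<close> of open
  edges, so finite volume laws become functions on \<open>Pow D\<close> and induction on
  \<open>S\<close> is available.\<close>

definition patch :: "('e \<Rightarrow> bool) \<Rightarrow> 'e set \<Rightarrow> 'e set \<Rightarrow> 'e \<Rightarrow> bool" where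
  "patch \<omega> D S = (\<lambda>f. if f \<in> D then f \<in> S else \<omega> f)"

definition agree_on :: "'e set \<Rightarrow> ('e \<Rightarrow> bool) \<Rightarrow> ('e \<Rightarrow> bool) \<Rightarrow> bool" where
  "agree_on H \<omega> \<eta> \<longleftrightarrow> (\<forall>e\<in>H. \<omega> e = \<eta> e)"

definition open_on :: "'e set \<Rightarrow> ('e \<Rightarrow> bool) \<Rightarrow> bool" where
  "open_on H \<omega> \<longleftrightarrow> (\<forall>e\<in>H. \<omega> e)"

text \<open>The map \<open>nb\<close> abstracts the relation of lying in a common cell of full
  dimension. Several edges may have the same pair of ends, but no edge is a loop.\<close>

locale rc_graph =
  fixes V :: "'v set" and E :: "'e set" and ends :: "'e \<Rightarrow> 'v set" and nb :: "'e \<Rightarrow> 'e set"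
    and p :: "'e \<Rightarrow> real" and q :: real
  assumes countable_E: "countable E"
    and ends_subset: "e \<in> E \<Longrightarrow> ends e \<subseteq> V"
    and two_ends: "e \<in> E \<Longrightarrow> card (ends e) = 2"
    and p_pos: "e \<in> E \<Longrightarrow> 0 < p e" and p_le_1: "e \<in> E \<Longrightarrow> p e \<le> 1" and q_ge_1: "1 \<le> q"
    and nb_subset: "e \<in> E \<Longrightarrow> nb e \<subseteq> E - {e}"
    and finite_nb: "e \<in> E \<Longrightarrow> finite (nb e)"
    and nb_sym: "e \<in> E \<Longrightarrow> f \<in> nb e \<Longrightarrow> e \<in> nb f"
begin

definition cond_prob :: "'e \<Rightarrow> ('e \<Rightarrow> bool) \<Rightarrow> real" where
  "cond_prob e \<omega> = (if \<omega> \<in> ends_joined_off E ends e then p e else p_hat p q e)"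

text \<open>An upper bound for the conditional probability that \<open>e\<close> is closed, whatever
  the states of the other edges.\<close>

definition closed_bound :: "'e \<Rightarrow> real" where
  "closed_bound e = 1 - p_hat p q e"

definition linked :: "'e \<Rightarrow> 'e \<Rightarrow> bool" where
  "linked e f \<longleftrightarrow> f \<in> nb e \<or> ends e \<inter> ends f \<noteq> {}"

definition link_connected :: "'e set \<Rightarrow> bool" where
  "link_connected H \<longleftrightarrow> (\<forall>a\<in>H. \<forall>b\<in>H. (\<lambda>x y. x \<in> H \<and> y \<in> H \<and> linked x y)\<^sup>*\<^sup>* a b)"

definition outer_nb :: "'e set \<Rightarrow> 'e set" where
  "outer_nb H = (\<Union>h\<in>H. nb h) - H"

definition gibbs_prob :: "'e set \<Rightarrow> ('e \<Rightarrow> bool) \<Rightarrow> 'e set \<Rightarrow> real" where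
  "gibbs_prob D \<omega> S = rc_weight V E ends p q D (patch \<omega> D S) /
     (\<Sum>T\<in>Pow D. rc_weight V E ends p q D (patch \<omega> D T))"

definition gibbs_expect :: "'e set \<Rightarrow> ('e \<Rightarrow> bool) \<Rightarrow> (('e \<Rightarrow> bool) \<Rightarrow> real) \<Rightarrow> real" where
  "gibbs_expect D \<omega> f = (\<Sum>S\<in>Pow D. gibbs_prob D \<omega> S * f (patch \<omega> D S))"

text \<open>The detailed balance equations for switching one edge: under a law with weights
  \<open>m\<close> on the states of \<open>D\<close>, the edge \<open>e\<close> is open with
  conditional probability \<open>cond_prob e\<close> given the other edges.\<close>

definition balanced :: "'e set \<Rightarrow> ('e \<Rightarrow> bool) \<Rightarrow> ('e set \<Rightarrow> real) \<Rightarrow> bool" where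
  "balanced D \<omega> m \<longleftrightarrow> (\<forall>e\<in>D. \<forall>S. S \<subseteq> D - {e} \<longrightarrow>
     cond_prob e (patch \<omega> D S) * m S = (1 - cond_prob e (patch \<omega> D S)) * m (insert e S))"

section \<open>Bounds on the conditional probability of one edge\<close>

lemma p_hat_pos: "e \<in> E \<Longrightarrow> 0 < p_hat p q e"
  unfolding p_hat_def using p_pos[of e] p_le_1[of e] q_ge_1
  by (intro divide_pos_pos add_pos_nonneg mult_nonneg_nonneg) auto

lemma p_hat_le: "e \<in> E \<Longrightarrow> p_hat p q e \<le> p e"
proof -
  assume e: "e \<in> E"
  \<comment> \<open>As \<open>q\<close> is at least 1, so is the denominator of
    \<open>p_hat\<close>; disconnected ends can only lower the probability of being open.\<close>
  have "1 \<le> p e + q * (1 - p e)"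
    using mult_right_mono[OF q_ge_1, of "1 - p e"] p_le_1[OF e] by simp
  then show ?thesis unfolding p_hat_def
    using divide_left_mono[of 1 "p e + q * (1 - p e)" "p e"] p_pos[OF e] by simp
qed

lemma cond_prob_bounds:
  assumes "e \<in> E"
  shows "p_hat p q e \<le> cond_prob e \<omega>" "cond_prob e \<omega> \<le> 1" "0 < cond_prob e \<omega>"
  using p_hat_pos[OF assms] p_hat_le[OF assms] p_le_1[OF assms] unfolding cond_prob_def by auto

lemma closed_bound_bounds:
  assumes "e \<in> E" shows "0 \<le> closed_bound e" "closed_bound e \<le> 1"
  using p_hat_pos[OF assms] p_hat_le[OF assms] p_le_1[OF assms] unfolding closed_bound_def by auto

lemma patch_in_configs:
  "\<omega> \<in> configs E \<Longrightarrow> D \<subseteq> E \<Longrightarrow> patch \<omega> D S \<in> configs E"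
  by (auto simp: patch_def PiE_iff extensional_def)

lemma ends_joined_off_agree:
  assumes "\<omega> \<in> configs E" "\<eta> \<in> configs E" "agree_on (E - {e}) \<omega> \<eta>"
  shows "\<omega> \<in> ends_joined_off E ends e \<longleftrightarrow> \<eta> \<in> ends_joined_off E ends e"
proof -
  have "open_edges E \<omega> - {e} = open_edges E \<eta> - {e}"
    using assms(3) by (auto simp: open_edges_def agree_on_def)
  then show ?thesis using assms by (simp add: ends_joined_off_def)
qed

lemma cond_prob_agree:
  assumes "\<omega> \<in> configs E" "\<eta> \<in> configs E" "agree_on (E - {e}) \<omega> \<eta>"
  shows "cond_prob e \<omega> = cond_prob e \<eta>"
  using ends_joined_off_agree[OF assms] by (simp add: cond_prob_def)

lemma cond_prob_insert:
  assumes "\<omega> \<in> configs E" "D \<subseteq> E"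
  shows "cond_prob e (patch \<omega> D (insert e S)) = cond_prob e (patch \<omega> D S)"
  using assms by (intro cond_prob_agree patch_in_configs) (auto simp: agree_on_def patch_def)

lemma num_components_insert:
  assumes \<omega>: "\<omega> \<in> configs E" and D: "finite D" "D \<subseteq> E" and e: "e \<in> D" "S \<subseteq> D - {e}"
  shows "num_components V E ends (patch \<omega> D S) D =
    num_components V E ends (patch \<omega> D (insert e S)) D +
      (if patch \<omega> D S \<in> ends_joined_off E ends e then 0 else 1)"
proof -
  have eE: "e \<in> E" using e D by auto
  obtain a b where ab: "ends e = {a, b}" "a \<noteq> b"
    using two_ends[OF eE] by (auto simp: card_2_iff)
  let ?S = "open_edges E (patch \<omega> D S)"
  have S1: "open_edges E (patch \<omega> D (insert e S)) = insert e ?S"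
    using e D by (auto simp: open_edges_def patch_def)
  \<comment> \<open>\<open>S\<close> omits \<open>e\<close>, so being joined off \<open>e\<close> is
    being joined by the open edges themselves.\<close>
  have S0: "?S - {e} = ?S" using e by (auto simp: open_edges_def patch_def)
  have joined: "patch \<omega> D S \<in> ends_joined_off E ends e \<longleftrightarrow> joined_by ends ?S a b"
    unfolding ends_joined_off_def mem_Collect_eq S0 ab(1)
    using patch_in_configs[OF \<omega> D(2)] by (auto simp: doubleton_eq_iff dest: joined_by_sym)
  have sub: "\<And>f. f \<in> D \<Longrightarrow> ends f \<subseteq> V" using ends_subset D by auto
  have "finite (ends f)" if "f \<in> D" for f
    using two_ends[of f] that D by (intro card_ge_0_finite) auto
  then have fin: "finite (\<Union>f\<in>D. ends f)" using D by auto
  have "num_components V E ends \<omega>' D =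
      card ((\<lambda>u. {v \<in> V. joined_by ends (open_edges E \<omega>') u v}) ` (\<Union>e\<in>D. ends e))" for \<omega>'
    using sub by (rule num_components_eq_card_image)
  then show ?thesis
    unfolding joined
    by (simp only: S1, intro card_classes_insert_edge[where ends = ends, OF ab(1) fin])
      (use sub e ab in auto)
qed

lemma rc_weight_nonneg: "D \<subseteq> E \<Longrightarrow> 0 \<le> rc_weight V E ends p q D \<omega>"
  unfolding rc_weight_def using p_pos p_le_1 q_ge_1
  by (intro mult_nonneg_nonneg prod_nonneg) (auto simp: less_imp_le subset_iff)

text \<open>Positivity of \<open>p\<close> enters here: the fully open state has positive weight and
  serves as the reference state for all ratios.\<close>

lemma rc_weight_open_pos:
  assumes "D \<subseteq> E" shows "0 < rc_weight V E ends p q D (patch \<omega> D D)"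
proof -
  have "(\<Prod>e\<in>D. if patch \<omega> D D e then p e else 1 - p e) = (\<Prod>e\<in>D. p e)"
    by (intro prod.cong) (auto simp: patch_def)
  moreover have "0 < (\<Prod>e\<in>D. p e)" using assms p_pos by (intro prod_pos) auto
  ultimately show ?thesis unfolding rc_weight_def using q_ge_1 by auto
qed

text \<open>The weights with \<open>e\<close> open and with \<open>e\<close> closed are in the
  proportion of \<open>p e\<close> to \<open>1 - p e\<close> if the ends are joined off
  \<open>e\<close>, and of \<open>p e\<close> to \<open>q * (1 - p e)\<close> otherwise. These are
  the odds of \<open>p e\<close> and of \<open>p_hat p q e\<close>.\<close>

lemma rc_weight_balanced:
  assumes \<omega>: "\<omega> \<in> configs E" and D: "finite D" "D \<subseteq> E"
  shows "balanced D \<omega> (\<lambda>S. rc_weight V E ends p q D (patch \<omega> D S))"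
  unfolding balanced_def
proof (intro ballI allI impI)
  fix e S assume e: "e \<in> D" and S: "S \<subseteq> D - {e}"
  then have eE: "e \<in> E" using D by auto
  define R where "R = (\<Prod>f\<in>D - {e}. if patch \<omega> D S f then p f else 1 - p f)"
  define k where "k = num_components V E ends (patch \<omega> D (insert e S)) D"
  have k0: "num_components V E ends (patch \<omega> D S) D =
      k + (if patch \<omega> D S \<in> ends_joined_off E ends e then 0 else 1)"
    unfolding k_def by (rule num_components_insert[OF \<omega> D e S])
  have "(\<Prod>f\<in>D. if patch \<omega> D S f then p f else 1 - p f) = (1 - p e) * R"
    unfolding R_def using e S D
    by (subst prod.remove[of D e]) (auto simp: patch_def)
  then have w0: "rc_weight V E ends p q D (patch \<omega> D S) = (1 - p e) * R *
      (q ^ k * (if patch \<omega> D S \<in> ends_joined_off E ends e then 1 else q))"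
    unfolding rc_weight_def k0 by simp
  have "(\<Prod>f\<in>D. if patch \<omega> D (insert e S) f then p f else 1 - p f) = p e * R"
    unfolding R_def using e S D
    by (subst prod.remove[of D e]) (auto simp: patch_def intro!: prod.cong)
  then have w1: "rc_weight V E ends p q D (patch \<omega> D (insert e S)) = p e * R * q ^ k"
    unfolding rc_weight_def k_def by simp
  show "cond_prob e (patch \<omega> D S) * rc_weight V E ends p q D (patch \<omega> D S) =
    (1 - cond_prob e (patch \<omega> D S)) * rc_weight V E ends p q D (patch \<omega> D (insert e S))"
  proof (cases "patch \<omega> D S \<in> ends_joined_off E ends e")
    case True
    then show ?thesis unfolding w0 w1 cond_prob_def by simp
  next
    case False
    have pos: "0 < p e + q * (1 - p e)"
      using p_pos[OF eE] p_le_1[OF eE] q_ge_1 by (intro add_pos_nonneg) auto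
    have "1 - p_hat p q e = q * (1 - p e) / (p e + q * (1 - p e))"
      unfolding p_hat_def using pos by (simp add: field_simps)
    then show ?thesis using False unfolding w0 w1 cond_prob_def by (simp add: p_hat_def)
  qed
qed

text \<open>As \<open>p\<close> is positive, the balance equations express all values of \<open>m\<close> through \<open>m D\<close>.\<close>

lemma balanced_unique:
  assumes \<omega>: "\<omega> \<in> configs E" and D: "finite D" "D \<subseteq> E"
    and m: "balanced D \<omega> m" and m': "balanced D \<omega> m'" and S: "S \<subseteq> D"
  shows "m S * m' D = m' S * m D"
  using S
proof (induction "card (D - S)" arbitrary: S)
  case 0
  then have "D - S = {}" using D by (metis card_eq_0_iff finite_Diff)
  then have "S = D" using 0 by auto
  then show ?case by simp
next
  case (Suc n)
  then obtain e where e: "e \<in> D - S" by (metis card.empty ex_in_conv nat.simps(3))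
  then have eE: "e \<in> E" using D by auto
  have "D - insert e S = (D - S) - {e}" by auto
  then have "n = card (D - insert e S)" using Suc e D by (simp add: card_Diff_singleton)
  then have IH: "m (insert e S) * m' D = m' (insert e S) * m D"
    using Suc e by (intro Suc.hyps(1)) auto
  define c where "c = cond_prob e (patch \<omega> D S)"
  have c: "0 < c" unfolding c_def by (rule cond_prob_bounds[OF eE])
  have "S \<subseteq> D - {e}" "e \<in> D" using e Suc by auto
  then have 1: "c * m S = (1 - c) * m (insert e S)" "c * m' S = (1 - c) * m' (insert e S)"
    using m m' unfolding balanced_def c_def by auto
  have "c * (m S * m' D) = (1 - c) * (m (insert e S) * m' D)" by (metis 1(1) mult.assoc)
  also have "\<dots> = c * (m' S * m D)" by (metis 1(2) IH mult.assoc)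
  finally show ?case using c by simp
qed

lemma gibbs_prob_nonneg: "D \<subseteq> E \<Longrightarrow> 0 \<le> gibbs_prob D \<omega> S"
  unfolding gibbs_prob_def by (intro divide_nonneg_nonneg sum_nonneg rc_weight_nonneg)

lemma rc_weight_sum_pos:
  assumes "finite D" "D \<subseteq> E"
  shows "0 < (\<Sum>T\<in>Pow D. rc_weight V E ends p q D (patch \<omega> D T))"
  using assms rc_weight_nonneg rc_weight_open_pos
  by (intro sum_pos2[of _ D]) auto

lemma gibbs_prob_sum:
  assumes "finite D" "D \<subseteq> E" shows "(\<Sum>S\<in>Pow D. gibbs_prob D \<omega> S) = 1"
  using rc_weight_sum_pos[OF assms, of \<omega>] unfolding gibbs_prob_def
  by (simp flip: sum_divide_distrib)

lemma gibbs_prob_open_pos: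
  assumes "finite D" "D \<subseteq> E" shows "0 < gibbs_prob D \<omega> D"
  unfolding gibbs_prob_def using rc_weight_sum_pos[OF assms] rc_weight_open_pos assms
  by (intro divide_pos_pos) auto

lemma gibbs_prob_balanced:
  assumes "\<omega> \<in> configs E" "finite D" "D \<subseteq> E"
  shows "balanced D \<omega> (gibbs_prob D \<omega>)"
  using rc_weight_balanced[OF assms] unfolding balanced_def gibbs_prob_def by simp

text \<open>The balance equations fix a solution up to a factor, and the total mass fixes the
  factor. Laws are later identified by checking balance, without returning to component
  counts.\<close>

lemma balanced_eq_gibbs_prob:
  assumes "\<omega> \<in> configs E" "finite D" "D \<subseteq> E" "balanced D \<omega> m" "S \<subseteq> D"
  shows "m S = (\<Sum>T\<in>Pow D. m T) * gibbs_prob D \<omega> S"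
proof -
  have "m T * gibbs_prob D \<omega> D = gibbs_prob D \<omega> T * m D" if "T \<subseteq> D" for T
    using assms that by (intro balanced_unique[of \<omega>] gibbs_prob_balanced)
  then have eq: "m T = gibbs_prob D \<omega> T * (m D / gibbs_prob D \<omega> D)" if "T \<subseteq> D" for T
    using gibbs_prob_open_pos[OF assms(2,3), of \<omega>] that by (simp add: field_simps)
  have "(\<Sum>T\<in>Pow D. m T) = (\<Sum>T\<in>Pow D. gibbs_prob D \<omega> T * (m D / gibbs_prob D \<omega> D))"
    by (intro sum.cong refl eq) auto
  also have "\<dots> = m D / gibbs_prob D \<omega> D"
    unfolding sum_distrib_right[symmetric] gibbs_prob_sum[OF assms(2,3)] by simp
  finally show ?thesis unfolding eq[OF assms(5)] by (simp only: mult.commute)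
qed

lemma sum_Pow_remove:
  fixes g :: "'e set \<Rightarrow> real"
  assumes "finite D" "e \<in> D"
  shows "(\<Sum>S\<in>Pow D. g S) = (\<Sum>S\<in>Pow (D - {e}). g (insert e S)) + (\<Sum>S\<in>Pow (D - {e}). g S)"
proof -
  have "Pow D = Pow (D - {e}) \<union> insert e ` Pow (D - {e})"
    using Pow_insert[of e "D - {e}"] assms by (simp add: insert_absorb)
  moreover have "inj_on (insert e) (Pow (D - {e}))" by (auto simp: inj_on_def)
  ultimately show ?thesis using assms
    by (subst \<open>Pow D = _\<close>, subst sum.union_disjoint) (auto simp: sum.reindex)
qed

text \<open>The restrictions of the law to \<open>e\<close> open and to \<open>e\<close> closed
  still satisfy the balance equations in \<open>D - {e}\<close>, hence are multiples of finite
  volume laws there. The weight \<open>a\<close> does not depend on \<open>f\<close>.\<close>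

lemma gibbs_expect_reveal:
  assumes \<omega>: "\<omega> \<in> configs E" and D: "finite D" "D \<subseteq> E" and e: "e \<in> D"
  obtains a where "p_hat p q e \<le> a" "a \<le> 1"
    "\<And>f. gibbs_expect D \<omega> f =
       a * gibbs_expect (D - {e}) (fun_upd \<omega> e True) f + (1 - a) * gibbs_expect (D - {e}) (fun_upd \<omega> e False) f"
proof -
  let ?D = "D - {e}"
  let ?m = "gibbs_prob D \<omega>"
  define a where "a = (\<Sum>S\<in>Pow ?D. ?m (insert e S))"
  define b where "b = (\<Sum>S\<in>Pow ?D. ?m S)"
  have eE: "e \<in> E" using e D by auto
  have ab: "a + b = 1" using sum_Pow_remove[OF D(1) e, of ?m] gibbs_prob_sum[OF D, of \<omega>]
    unfolding a_def b_def by simp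
  have b0: "0 \<le> b" unfolding b_def by (intro sum_nonneg gibbs_prob_nonneg D)
  then have a1: "a \<le> 1" using ab by simp
  have bal: "balanced D \<omega> ?m" by (rule gibbs_prob_balanced[OF \<omega> D])
  \<comment> \<open>Given the other edges, \<open>e\<close> is open with conditional probability
    \<open>c\<close>, which is at least \<open>p_hat p q e\<close>; summing over the other edges
    keeps the bound.\<close>
  have "p_hat p q e * (?m (insert e S) + ?m S) \<le> ?m (insert e S)" if "S \<in> Pow ?D" for S
  proof -
    define c where "c = cond_prob e (patch \<omega> D S)"
    have "c * ?m S = (1 - c) * ?m (insert e S)"
      using bal that e unfolding balanced_def c_def by auto
    then have "c * (?m (insert e S) + ?m S) = ?m (insert e S)" by (simp add: algebra_simps)
    moreover have "p_hat p q e * (?m (insert e S) + ?m S) \<le> c * (?m (insert e S) + ?m S)"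
      unfolding c_def using D
      by (intro mult_right_mono cond_prob_bounds eE add_nonneg_nonneg gibbs_prob_nonneg)
    ultimately show ?thesis by simp
  qed
  then have "(\<Sum>S\<in>Pow ?D. p_hat p q e * (?m (insert e S) + ?m S)) \<le> a"
    unfolding a_def by (rule sum_mono)
  then have a0: "p_hat p q e \<le> a"
    using ab unfolding a_def b_def by (simp flip: sum_distrib_left add: sum.distrib)
  have \<omega>': "(fun_upd \<omega> e c) \<in> configs E" for c using \<omega> eE by (auto simp: PiE_iff extensional_def)
  have D': "finite ?D" "?D \<subseteq> E" using D by auto
  have spT: "patch (fun_upd \<omega> e True) ?D S = patch \<omega> D (insert e S)" if "S \<subseteq> ?D" for S
    using that e by (auto simp: patch_def fun_eq_iff)
  have spF: "patch (fun_upd \<omega> e False) ?D S = patch \<omega> D S" if "S \<subseteq> ?D" for S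
    using that e by (auto simp: patch_def fun_eq_iff)
  have "balanced ?D (fun_upd \<omega> e True) (\<lambda>S. ?m (insert e S))"
    unfolding balanced_def
  proof (intro ballI allI impI)
    fix g S assume g: "g \<in> ?D" "S \<subseteq> ?D - {g}"
    then have "cond_prob g (patch \<omega> D (insert e S)) * ?m (insert e S) =
      (1 - cond_prob g (patch \<omega> D (insert e S))) * ?m (insert g (insert e S))"
      using e by (intro bal[unfolded balanced_def, rule_format]) auto
    moreover have "patch (fun_upd \<omega> e True) ?D S = patch \<omega> D (insert e S)" using g by (intro spT) auto
    ultimately show "cond_prob g (patch (fun_upd \<omega> e True) ?D S) * ?m (insert e S) =
      (1 - cond_prob g (patch (fun_upd \<omega> e True) ?D S)) * ?m (insert e (insert g S))"
      by (simp add: insert_commute)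
  qed
  from balanced_eq_gibbs_prob[OF \<omega>' D' this]
  have mT: "?m (insert e S) = a * gibbs_prob ?D (fun_upd \<omega> e True) S" if "S \<subseteq> ?D" for S
    using that unfolding a_def by simp
  have "balanced ?D (fun_upd \<omega> e False) ?m"
    unfolding balanced_def
  proof (intro ballI allI impI)
    fix g S assume g: "g \<in> ?D" "S \<subseteq> ?D - {g}"
    then have "cond_prob g (patch \<omega> D S) * ?m S = (1 - cond_prob g (patch \<omega> D S)) * ?m (insert g S)"
      using e by (intro bal[unfolded balanced_def, rule_format]) auto
    moreover have "patch (fun_upd \<omega> e False) ?D S = patch \<omega> D S" using g by (intro spF) auto
    ultimately show "cond_prob g (patch (fun_upd \<omega> e False) ?D S) * ?m S =
      (1 - cond_prob g (patch (fun_upd \<omega> e False) ?D S)) * ?m (insert g S)" by simp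
  qed
  from balanced_eq_gibbs_prob[OF \<omega>' D' this]
  have mF: "?m S = (1 - a) * gibbs_prob ?D (fun_upd \<omega> e False) S" if "S \<subseteq> ?D" for S
    using that ab unfolding b_def by simp
  have "gibbs_expect D \<omega> f =
    a * gibbs_expect ?D (fun_upd \<omega> e True) f + (1 - a) * gibbs_expect ?D (fun_upd \<omega> e False) f" for f
    unfolding gibbs_expect_def sum_Pow_remove[OF D(1) e] sum_distrib_left
    by (intro arg_cong2[of _ _ _ _ "(+)"] sum.cong refl) (auto simp: mT mF spT spF)
  with a0 a1 show ?thesis by (rule that)
qed

lemma gibbs_expect_const:
  assumes "finite D" "D \<subseteq> E" shows "gibbs_expect D \<omega> (\<lambda>_. c) = c"
  unfolding gibbs_expect_def sum_distrib_right[symmetric] gibbs_prob_sum[OF assms] by simp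

lemma gibbs_expect_bounds:
  assumes D: "finite D" "D \<subseteq> E" and \<omega>: "\<omega> \<in> configs E"
    and f: "\<And>\<eta>. \<eta> \<in> configs E \<Longrightarrow> 0 \<le> f \<eta> \<and> f \<eta> \<le> 1"
  shows "0 \<le> gibbs_expect D \<omega> f" "gibbs_expect D \<omega> f \<le> 1"
proof -
  have *: "0 \<le> f (patch \<omega> D S)" "f (patch \<omega> D S) \<le> 1" for S
    using f patch_in_configs[OF \<omega> D(2)] by auto
  show "0 \<le> gibbs_expect D \<omega> f" unfolding gibbs_expect_def
    by (intro sum_nonneg mult_nonneg_nonneg gibbs_prob_nonneg D *)
  have "gibbs_expect D \<omega> f \<le> (\<Sum>S\<in>Pow D. gibbs_prob D \<omega> S)" unfolding gibbs_expect_def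
    by (intro sum_mono mult_left_le gibbs_prob_nonneg D *)
  then show "gibbs_expect D \<omega> f \<le> 1" using gibbs_prob_sum[OF D] by simp
qed

text \<open>Consistency: the law in \<open>G\<close> is a mixture of laws in \<open>F\<close>.\<close>

lemma gibbs_expect_enlarge:
  assumes "finite G" "F \<subseteq> G" "G \<subseteq> E" "\<omega> \<in> configs E"
    and F: "\<And>\<eta>. \<eta> \<in> configs E \<Longrightarrow> (\<forall>f\<in>E - G. \<eta> f = \<omega> f) \<Longrightarrow> \<bar>gibbs_expect F \<eta> f - c\<bar> \<le> \<epsilon>"
  shows "\<bar>gibbs_expect G \<omega> f - c\<bar> \<le> \<epsilon>"
  using assms
proof (induction "card (G - F)" arbitrary: G \<omega>)
  case 0
  then have "G - F = {}" by (metis card_eq_0_iff finite_Diff)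
  then have "G = F" using 0 by auto
  then show ?case using 0 by auto
next
  case (Suc n)
  then obtain e where e: "e \<in> G - F" by (metis card.empty ex_in_conv nat.simps(3))
  have "G - {e} - F = (G - F) - {e}" by auto
  then have n: "n = card (G - {e} - F)" using Suc(2,3) e by (simp add: card_Diff_singleton)
  have eG: "e \<in> G" using e by auto
  have "\<bar>gibbs_expect (G - {e}) (fun_upd \<omega> e b) f - c\<bar> \<le> \<epsilon>" for b
  proof (rule Suc.hyps(1)[OF n])
    show "fun_upd \<omega> e b \<in> configs E" using Suc.prems e by (auto simp: PiE_iff extensional_def)
    show "\<bar>gibbs_expect F \<eta> f - c\<bar> \<le> \<epsilon>"
      if "\<eta> \<in> configs E" "\<forall>f\<in>E - (G - {e}). \<eta> f = (fun_upd \<omega> e b) f" for \<eta>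
    proof (rule Suc.prems(5)[OF that(1)], rule ballI)
      fix g assume "g \<in> E - G"
      then show "\<eta> g = \<omega> g" using that(2)[rule_format, of g] e by auto
    qed
    show "finite (G - {e})" "F \<subseteq> G - {e}" "G - {e} \<subseteq> E" using Suc.prems(1-3) e by auto
  qed
  note 1 = this[of True] this[of False]
  obtain a where a: "p_hat p q e \<le> a" "a \<le> 1" and
    eq: "\<And>f. gibbs_expect G \<omega> f =
       a * gibbs_expect (G - {e}) (fun_upd \<omega> e True) f + (1 - a) * gibbs_expect (G - {e}) (fun_upd \<omega> e False) f"
    using gibbs_expect_reveal[OF Suc.prems(4,1,3) eG, of thesis] by blast
  have "e \<in> E" using eG Suc.prems(3) by auto
  then have a0: "0 \<le> a" using a p_hat_pos[of e] by simp
  define x where "x = gibbs_expect (G - {e}) (fun_upd \<omega> e True) f - c"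
  define y where "y = gibbs_expect (G - {e}) (fun_upd \<omega> e False) f - c"
  have "gibbs_expect G \<omega> f - c = a * x + (1 - a) * y"
    unfolding eq x_def y_def by (simp add: algebra_simps)
  moreover have "\<bar>a * x + (1 - a) * y\<bar> \<le> a * \<bar>x\<bar> + (1 - a) * \<bar>y\<bar>"
    using a a0 abs_triangle_ineq[of "a * x" "(1 - a) * y"] by (simp add: abs_mult)
  moreover have "a * \<bar>x\<bar> + (1 - a) * \<bar>y\<bar> \<le> a * \<epsilon> + (1 - a) * \<epsilon>"
    using 1 a a0 unfolding x_def y_def by (intro add_mono mult_left_mono) auto
  ultimately show ?case by (simp add: algebra_simps)
qed

end

section \<open>Influence of the boundary condition\<close>

text \<open>The topology of the ambient space enters through \<open>separation\<close>, which for a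
  tessellation comes from unicoherence. The sums in \<open>small\<close> bound the factor by which
  closed paths multiply per step in the union bound, far away.\<close>

locale separating_rc_graph = rc_graph V E ends nb p q
  for V :: "'v set" and E :: "'e set" and ends nb p q +
  assumes link_connected_E: "link_connected E"
    and separation: "finite H \<Longrightarrow> H \<subseteq> E \<Longrightarrow> link_connected H \<Longrightarrow>
      u \<in> (\<Union>e\<in>H. ends e) \<Longrightarrow> v \<in> (\<Union>e\<in>H. ends e) \<Longrightarrow>
      joined_by ends (E - H) u v \<Longrightarrow> joined_by ends (outer_nb H) u v"
    and small: "\<exists>\<Lambda>. finite \<Lambda> \<and> \<Lambda> \<subseteq> E \<and> (\<exists>\<theta><1. \<forall>e\<in>E - \<Lambda>. (\<Sum>f\<in>nb e. closed_bound f) \<le> \<theta>)"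
begin

text \<open>Each excursion of the path outside \<open>H\<close> starts and ends at vertexes of
  \<open>H\<close>, so \<open>separation\<close> replaces it by a path of outer neighbours.\<close>

lemma joined_by_reroute:
  assumes H: "finite H" "H \<subseteq> E" "link_connected H"
    and S: "S \<subseteq> E" and u: "u \<in> (\<Union>e\<in>H. ends e)" and v: "v \<in> (\<Union>e\<in>H. ends e)"
    and uv: "joined_by ends S u v"
  shows "joined_by ends ((S \<inter> H) \<union> outer_nb H) u v"
proof -
  let ?V = "\<Union>e\<in>H. ends e"
  let ?J = "joined_by ends ((S \<inter> H) \<union> outer_nb H)"
  have reroute: "?J x y" if "x \<in> ?V" "y \<in> ?V" "joined_by ends (S - H) x y" for x y
  proof -
    have "joined_by ends (E - H) x y" by (rule joined_by_mono[OF that(3)]) (use S in auto)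
    then have "joined_by ends (outer_nb H) x y" using H that by (intro separation)
    then show ?thesis by (rule joined_by_mono) auto
  qed
  \<comment> \<open>The invariant keeps a vertex \<open>x\<close> of \<open>H\<close> that is
    already reached by rerouting and from which the current stretch uses no edge of
    \<open>H\<close>.\<close>
  from uv have "\<exists>x\<in>?V. ?J u x \<and> joined_by ends (S - H) x v"
  proof (induction rule: joined_by_induct)
    case refl
    show ?case using u by (intro bexI[of _ u]) auto
  next
    case (step w w' f)
    then obtain x where x: "x \<in> ?V" "?J u x" "joined_by ends (S - H) x w" by blast
    show ?case
    proof (cases "f \<in> H")
      case True
      then have "w \<in> ?V" "w' \<in> ?V" using step by auto
      have "?J x w" by (rule reroute) fact+
      moreover have "?J w w'" using step True by (intro joined_by_edge) auto
      ultimately have "?J u w'" using x by (blast intro: joined_by_trans)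
      with \<open>w' \<in> ?V\<close> show ?thesis by (intro bexI[of _ w']) auto
    next
      case False
      then have "joined_by ends (S - H) w w'" using step by (intro joined_by_edge) auto
      then have "joined_by ends (S - H) x w'" using x by (blast intro: joined_by_trans)
      with x show ?thesis by blast
    qed
  qed
  then obtain x where x: "x \<in> ?V" "?J u x" "joined_by ends (S - H) x v" by blast
  have "?J x v" by (rule reroute) fact+
  with x show ?thesis by (blast intro: joined_by_trans)
qed

lemma outer_nb_subset: "H \<subseteq> E \<Longrightarrow> outer_nb H \<subseteq> E - H"
  unfolding outer_nb_def using nb_subset by fastforce

text \<open>Rerouting leaves only open edges of \<open>H\<close> and outer neighbours. The set
  \<open>T\<close> is free, so that the connection can be demanded in another configuration or
  within a finite set of edges.\<close>

lemma ends_joined_off_local: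
  assumes H: "finite H" "H \<subseteq> E" "link_connected H" and e: "e \<in> H"
    and \<omega>: "\<omega> \<in> configs E"
    and joined: "\<omega> \<in> ends_joined_off E ends e"
    and T: "open_edges H \<omega> \<union> outer_nb H \<subseteq> T"
  shows "\<exists>u v. ends e = {u, v} \<and> joined_by ends (T - {e}) u v"
proof -
  obtain u v where uv: "ends e = {u, v}" "joined_by ends (open_edges E \<omega> - {e}) u v"
    using joined by (auto simp: ends_joined_off_def)
  have "joined_by ends (((open_edges E \<omega> - {e}) \<inter> H) \<union> outer_nb H) u v"
    using uv e by (intro joined_by_reroute H) (auto simp: open_edges_def)
  then have "joined_by ends (T - {e}) u v"
    by (rule joined_by_mono) (use T e in \<open>auto simp: open_edges_def outer_nb_def\<close>)
  with uv show ?thesis by blast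
qed

text \<open>Behind an open barrier each of the two configurations contains the rerouted connections
  of the other, so their connection events agree.\<close>

lemma cond_prob_local:
  assumes H: "finite H" "H \<subseteq> E" "link_connected H" and e: "e \<in> H"
    and \<omega>: "\<omega> \<in> configs E" "\<eta> \<in> configs E" and agree: "agree_on H \<omega> \<eta>"
    and op: "open_on (outer_nb H) \<omega>" "open_on (outer_nb H) \<eta>"
  shows "cond_prob e \<omega> = cond_prob e \<eta>"
proof -
  have *: "\<eta>' \<in> ends_joined_off E ends e"
    if "\<omega>' \<in> ends_joined_off E ends e" "\<omega>' \<in> configs E" "\<eta>' \<in> configs E" "agree_on H \<omega>' \<eta>'"
      "open_on (outer_nb H) \<eta>'" for \<omega>' \<eta>'
  proof -
    have "open_edges H \<omega>' \<union> outer_nb H \<subseteq> open_edges E \<eta>'"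
      using that outer_nb_subset[OF H(2)] H(2) by (auto simp: open_edges_def agree_on_def open_on_def)
    from ends_joined_off_local[OF H e that(2,1) this] show ?thesis
      using that(3) by (auto simp: ends_joined_off_def)
  qed
  have "agree_on H \<eta> \<omega>" using agree by (simp add: agree_on_def)
  with * \<omega> agree op have "\<omega> \<in> ends_joined_off E ends e \<longleftrightarrow> \<eta> \<in> ends_joined_off E ends e" by blast
  then show ?thesis by (simp add: cond_prob_def)
qed

text \<open>Behind an open barrier both boundary conditions lead to the same balance equations in
  \<open>H\<close>, and these determine the law.\<close>

lemma gibbs_prob_local:
  assumes H: "finite H" "H \<subseteq> E" "link_connected H"
    and \<omega>: "\<omega> \<in> configs E" "\<eta> \<in> configs E"
    and op: "open_on (outer_nb H) \<omega>" "open_on (outer_nb H) \<eta>" and S: "S \<subseteq> H"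
  shows "gibbs_prob H \<omega> S = gibbs_prob H \<eta> S"
proof -
  have "balanced H \<eta> (gibbs_prob H \<omega>)"
    unfolding balanced_def
  proof (intro ballI allI impI)
    fix e S assume e: "e \<in> H" and S: "S \<subseteq> H - {e}"
    have "cond_prob e (patch \<omega> H S) = cond_prob e (patch \<eta> H S)"
      by (rule cond_prob_local[OF H e patch_in_configs[OF \<omega>(1) H(2)] patch_in_configs[OF \<omega>(2) H(2)]])
        (use op in \<open>auto simp: agree_on_def open_on_def patch_def outer_nb_def\<close>)
    then show "cond_prob e (patch \<eta> H S) * gibbs_prob H \<omega> S =
        (1 - cond_prob e (patch \<eta> H S)) * gibbs_prob H \<omega> (insert e S)"
      using gibbs_prob_balanced[OF \<omega>(1) H(1,2), unfolded balanced_def, rule_format, OF e S] by simp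
  qed
  from balanced_eq_gibbs_prob[OF \<omega>(2) H(1,2) this S] show ?thesis
    using gibbs_prob_sum[OF H(1,2)] by simp
qed

text \<open>Two functions occur because one may be the indicator of a connection of unbounded range
  and the other its version of finite range; they are guaranteed to agree only where
  \<open>H\<close> is surrounded by open edges.\<close>

definition local_pair :: "'e set \<Rightarrow> (('e \<Rightarrow> bool) \<Rightarrow> real) \<Rightarrow> (('e \<Rightarrow> bool) \<Rightarrow> real) \<Rightarrow> bool" where
  "local_pair H f f' \<longleftrightarrow> (\<forall>\<omega>\<in>configs E. \<forall>\<eta>\<in>configs E.
     agree_on H \<omega> \<eta> \<longrightarrow> open_on (outer_nb H) \<omega> \<longrightarrow> open_on (outer_nb H) \<eta> \<longrightarrow> f \<omega> = f' \<eta>)"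

lemma gibbs_expect_local:
  assumes H: "finite H" "H \<subseteq> E" "link_connected H"
    and \<omega>: "\<omega> \<in> configs E" "\<eta> \<in> configs E"
    and op: "open_on (outer_nb H) \<omega>" "open_on (outer_nb H) \<eta>" and f: "local_pair H f f'"
  shows "gibbs_expect H \<omega> f = gibbs_expect H \<eta> f'"
  unfolding gibbs_expect_def
proof (intro sum.cong refl arg_cong2[of _ _ _ _ "(*)"])
  fix S assume S: "S \<in> Pow H"
  then show "gibbs_prob H \<omega> S = gibbs_prob H \<eta> S" using assms by (intro gibbs_prob_local) auto
  have "patch \<omega> H S \<in> configs E" "patch \<eta> H S \<in> configs E"
    using \<omega> H by (simp_all add: patch_in_configs)
  moreover have "agree_on H (patch \<omega> H S) (patch \<eta> H S)" by (simp add: agree_on_def patch_def)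
  moreover have "open_on (outer_nb H) (patch \<omega> H S)" "open_on (outer_nb H) (patch \<eta> H S)"
    using op by (auto simp: open_on_def patch_def outer_nb_def)
  ultimately show "f (patch \<omega> H S) = f' (patch \<eta> H S)"
    using f unfolding local_pair_def by blast
qed

text \<open>The outer neighbours of \<open>H\<close> lie outside \<open>D\<close>, so revealing
  \<open>D - H\<close> cannot close them. The law in \<open>D\<close> is a mixture of laws in
  \<open>H\<close> behind an open barrier, all of which give the same value.\<close>

lemma gibbs_expect_local_superset:
  assumes H: "link_connected H" and D: "finite D" "H \<subseteq> D" "D \<subseteq> E" "D \<inter> outer_nb H = {}"
    and \<omega>: "\<omega> \<in> configs E" "\<eta> \<in> configs E"
    and op: "open_on (outer_nb H) \<omega>" "open_on (outer_nb H) \<eta>" and f: "local_pair H f f'"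
  shows "gibbs_expect D \<omega> f = gibbs_expect D \<eta> f'"
proof -
  have H': "finite H" "H \<subseteq> E" using D by (auto intro: finite_subset)
  \<comment> \<open>The fully open configuration is a third boundary condition with which both sides
    can be compared.\<close>
  define \<zeta> where "\<zeta> = (\<lambda>e\<in>E. True)"
  have \<zeta>: "\<zeta> \<in> configs E" "open_on (outer_nb H) \<zeta>"
    using outer_nb_subset[OF H'(2)] by (auto simp: \<zeta>_def open_on_def)
  have eq: "gibbs_expect D \<omega>' g = c" if \<omega>': "\<omega>' \<in> configs E" "open_on (outer_nb H) \<omega>'"
    and g: "\<And>\<xi>. \<xi> \<in> configs E \<Longrightarrow> open_on (outer_nb H) \<xi> \<Longrightarrow> gibbs_expect H \<xi> g = c" for \<omega>' g c
  proof -
    have "\<bar>gibbs_expect D \<omega>' g - c\<bar> \<le> 0"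
    proof (rule gibbs_expect_enlarge[OF D(1-3) \<omega>'(1)])
      fix \<xi> assume \<xi>: "\<xi> \<in> configs E" "\<forall>f\<in>E - D. \<xi> f = \<omega>' f"
      have "open_on (outer_nb H) \<xi>"
        using \<xi> \<omega>' D outer_nb_subset[OF H'(2)] by (auto simp: open_on_def)
      with g \<xi> show "\<bar>gibbs_expect H \<xi> g - c\<bar> \<le> 0" by simp
    qed
    then show ?thesis by simp
  qed
  have "gibbs_expect D \<omega> f = gibbs_expect H \<zeta> f'"
    by (intro eq \<omega> op gibbs_expect_local H H' \<zeta> f)
  moreover have "gibbs_expect D \<eta> f' = gibbs_expect H \<omega> f"
    by (intro eq \<omega> op gibbs_expect_local[symmetric] H H' \<zeta> f)
  moreover have "gibbs_expect H \<omega> f = gibbs_expect H \<zeta> f'"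
    by (intro gibbs_expect_local H H' \<omega> \<zeta> op f)
  ultimately show ?thesis by simp
qed

section \<open>Link components and the exploration of closed edges\<close>

lemma linked_sym: "a \<in> E \<Longrightarrow> b \<in> E \<Longrightarrow> linked a b \<Longrightarrow> linked b a"
  unfolding linked_def using nb_sym by blast

text \<open>\<open>H\<close> is the link component of \<Lambda> in \<open>D\<close>. A neighbour of
  \<open>H\<close> inside \<open>D\<close> would be linked to it, so all outer neighbours lie
  outside \<open>D\<close>.\<close>

lemma link_component:
  assumes \<Lambda>: "link_connected \<Lambda>" "\<Lambda> \<subseteq> D" and D: "D \<subseteq> E"
  obtains H where "\<Lambda> \<subseteq> H" "H \<subseteq> D" "link_connected H" "D \<inter> outer_nb H = {}"
proof
  let ?r = "\<lambda>K x y. x \<in> K \<and> y \<in> K \<and> linked x y"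
  define H where "H = {f \<in> D. \<exists>e\<in>\<Lambda>. (?r D)\<^sup>*\<^sup>* e f}"
  show "\<Lambda> \<subseteq> H" "H \<subseteq> D" using \<Lambda> by (auto simp: H_def)
  have mono: "(?r K')\<^sup>*\<^sup>* a b" if "(?r K)\<^sup>*\<^sup>* a b" "K \<subseteq> K'" for K K' a b
    using that by (auto elim!: rtranclp_mono[THEN predicate2D, rotated])
  have in_H: "f \<in> H \<and> (?r H)\<^sup>*\<^sup>* e f" if "e \<in> \<Lambda>" "(?r D)\<^sup>*\<^sup>* e f" for e f
    using that(2)
  proof (induction rule: rtranclp_induct)
    case base
    show ?case using that(1) \<Lambda> by (auto simp: H_def)
  next
    case (step y z)
    then have "z \<in> H" using that(1) unfolding H_def by (auto intro: rtranclp.rtrancl_into_rtrancl)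
    moreover have "?r H y z" using step calculation by auto
    ultimately show ?case using step by (auto intro: rtranclp.rtrancl_into_rtrancl)
  qed
  have HE: "H \<subseteq> E" using D by (auto simp: H_def)
  have sym: "(?r H)\<^sup>*\<^sup>* b a" if "(?r H)\<^sup>*\<^sup>* a b" for a b
  proof -
    have "symp (?r H)" using linked_sym HE by (auto simp: symp_def)
    from sympD[OF symp_rtranclp[OF this]] that show ?thesis .
  qed
  show "link_connected H"
    unfolding link_connected_def
  proof (intro ballI)
    fix a b assume ab: "a \<in> H" "b \<in> H"
    then obtain e e' where e: "e \<in> \<Lambda>" "(?r D)\<^sup>*\<^sup>* e a" "e' \<in> \<Lambda>" "(?r D)\<^sup>*\<^sup>* e' b"
      unfolding H_def by blast
    have "(?r \<Lambda>)\<^sup>*\<^sup>* e e'" using \<Lambda>(1) e unfolding link_connected_def by blast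
    then have "(?r H)\<^sup>*\<^sup>* e e'" by (rule mono) (use \<open>\<Lambda> \<subseteq> H\<close> in auto)
    moreover have "(?r H)\<^sup>*\<^sup>* a e" using in_H[OF e(1,2)] sym by blast
    moreover have "(?r H)\<^sup>*\<^sup>* e' b" using in_H[OF e(3,4)] by blast
    ultimately show "(?r H)\<^sup>*\<^sup>* a b" by (meson rtranclp_trans)
  qed
  show "D \<inter> outer_nb H = {}"
  proof (rule ccontr)
    assume "D \<inter> outer_nb H \<noteq> {}"
    then obtain f h where f: "f \<in> D" "h \<in> H" "f \<in> nb h" "f \<notin> H" unfolding outer_nb_def by blast
    then obtain e where e: "e \<in> \<Lambda>" "(?r D)\<^sup>*\<^sup>* e h" unfolding H_def by blast
    have "?r D h f" using f \<open>H \<subseteq> D\<close> by (auto simp: linked_def)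
    then have "(?r D)\<^sup>*\<^sup>* e f" using e by (auto intro: rtranclp.rtrancl_into_rtrancl)
    then show False using in_H e f by blast
  qed
qed

text \<open>
  The edges of \<open>B\<close> are those explored and found closed in one of the two configurations. The bound
  on the right dominates the probability that the exploration reaches \<open>\<Lambda>\<close>; if it stops before,
  \<open>\<Lambda>\<close> is surrounded by edges that are open in both configurations.
\<close>

lemma gibbs_expect_compare:
  assumes "finite D" "D \<subseteq> E" and \<Lambda>: "\<Lambda> \<subseteq> D" "link_connected \<Lambda>" and B: "B \<subseteq> E - D"
    and \<omega>: "\<omega> \<in> configs E" "\<eta> \<in> configs E"
    and op: "open_on (E - D - B) \<omega>" "open_on (E - D - B) \<eta>"
    and f: "\<And>\<xi>. \<xi> \<in> configs E \<Longrightarrow> 0 \<le> f \<xi> \<and> f \<xi> \<le> 1"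
      "\<And>\<xi>. \<xi> \<in> configs E \<Longrightarrow> 0 \<le> f' \<xi> \<and> f' \<xi> \<le> 1"
    and local: "\<And>H. \<Lambda> \<subseteq> H \<Longrightarrow> H \<subseteq> D \<Longrightarrow> link_connected H \<Longrightarrow> local_pair H f f'"
    and w: "\<And>e. e \<in> E \<Longrightarrow> 0 \<le> w e" "\<And>e. e \<in> \<Lambda> \<Longrightarrow> 1 \<le> w e"
      "\<And>e. e \<in> E - \<Lambda> \<Longrightarrow> closed_bound e * (\<Sum>g\<in>nb e. w g) \<le> w e"
  shows "\<bar>gibbs_expect D \<omega> f - gibbs_expect D \<eta> f'\<bar> \<le> (\<Sum>g\<in>D \<inter> (\<Union>b\<in>B. nb b). w g)"
  using assms(1,2) \<Lambda>(1) B \<omega> op local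
proof (induction "card D" arbitrary: D B \<omega> \<eta> rule: less_induct)
  case less
  note D = less.prems(1,2) and \<Lambda>D = less.prems(3) and B = less.prems(4) and \<omega> = less.prems(5,6)
    and op = less.prems(7,8) and local = less.prems(9)
  let ?N = "\<lambda>B. \<Union>b\<in>B. nb b"
  have le1: "\<bar>gibbs_expect D \<omega> f - gibbs_expect D \<eta> f'\<bar> \<le> 1"
    using gibbs_expect_bounds[where f = f, OF D \<omega>(1) f(1)]
      gibbs_expect_bounds[where f = f', OF D \<omega>(2) f(2)] by auto
  have w_nonneg: "g \<in> D \<Longrightarrow> 0 \<le> w g" for g using w(1) D by auto
  \<comment> \<open>The front consists of the unrevealed neighbours of \<open>B\<close>. Either it
    touches \<Lambda>, where the bound is at least 1; or it is empty and the exploration stops; or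
    one of its edges is revealed next.\<close>
  consider g where "g \<in> D \<inter> ?N B" "g \<in> \<Lambda>" | "D \<inter> ?N B = {}" | e where "e \<in> D \<inter> ?N B" "e \<notin> \<Lambda>"
    by blast
  then show ?case
  proof cases
    case 1
    have "1 \<le> w g" using 1 w by auto
    also have "w g \<le> (\<Sum>g\<in>D \<inter> ?N B. w g)"
      using 1 D w_nonneg by (intro member_le_sum) auto
    finally show ?thesis using le1 by simp
  next
    case 2
    obtain H where H: "\<Lambda> \<subseteq> H" "H \<subseteq> D" "link_connected H" "D \<inter> outer_nb H = {}"
      using link_component[OF \<Lambda>(2) \<Lambda>D D(2)] .
    \<comment> \<open>An outer neighbour in \<open>B\<close> would put an edge of \<open>H\<close>
      into the empty front. So all outer neighbours lie outside \<open>D\<close> and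
      \<open>B\<close>, where both configurations are open.\<close>
    have "outer_nb H \<subseteq> E - D - B"
    proof
      fix g assume g: "g \<in> outer_nb H"
      then obtain h where h: "h \<in> H" "g \<in> nb h" by (auto simp: outer_nb_def)
      have "h \<in> E" using h H D by auto
      then have "h \<in> nb g" using h nb_sym by blast
      then have "g \<notin> B" using 2 h H by blast
      then show "g \<in> E - D - B" using g outer_nb_subset[of H] H D by blast
    qed
    then have "gibbs_expect D \<omega> f = gibbs_expect D \<eta> f'"
      using op by (intro gibbs_expect_local_superset[OF H(3) D(1) H(2) D(2) H(4) \<omega>] local H)
        (auto simp: open_on_def)
    moreover have "0 \<le> (\<Sum>g\<in>D \<inter> ?N B. w g)" using w_nonneg by (intro sum_nonneg) auto
    ultimately show ?thesis by simp
  next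
    case 3
    then have eD: "e \<in> D" and eE: "e \<in> E" using D by auto
    let ?D = "D - {e}"
    let ?x = "\<lambda>i. gibbs_expect ?D (fun_upd \<omega> e i) f" and ?y = "\<lambda>i. gibbs_expect ?D (fun_upd \<eta> e i) f'"
    define G where "G = (\<Sum>g\<in>D \<inter> ?N B. w g)"
    define G1 where "G1 = (\<Sum>g\<in>?D \<inter> ?N B. w g)"
    define G2 where "G2 = (\<Sum>g\<in>?D \<inter> ?N (insert e B). w g)"
    have lt: "card ?D < card D" using D(1) eD by (rule card_Diff1_less)
    have upd: "fun_upd \<xi> e i \<in> configs E" if "\<xi> \<in> configs E" for \<xi> i
      using that eE by (auto simp: PiE_iff extensional_def)
    have localD: "local_pair H f f'" if "\<Lambda> \<subseteq> H" "H \<subseteq> ?D" "link_connected H" for H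
      using that by (intro local) auto
    have \<Lambda>': "\<Lambda> \<subseteq> ?D" using \<Lambda>D 3 by auto
    have D': "finite ?D" "?D \<subseteq> E" using D by auto
    \<comment> \<open>If \<open>e\<close> is open on both sides, \<open>B\<close> stays the same and
      the front just loses \<open>e\<close>.\<close>
    have 11: "\<bar>?x True - ?y True\<bar> \<le> G1"
      unfolding G1_def
    proof (rule less.hyps[OF lt D' \<Lambda>' _ upd[OF \<omega>(1)] upd[OF \<omega>(2)] _ _ localD])
      show "B \<subseteq> E - ?D" using B by auto
      show "open_on (E - ?D - B) (fun_upd \<omega> e True)" "open_on (E - ?D - B) (fun_upd \<eta> e True)"
        using op by (auto simp: open_on_def)
    qed
    \<comment> \<open>For the other outcomes \<open>e\<close> joins \<open>B\<close>, and its
      unrevealed neighbours join the front.\<close>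
    have any: "\<bar>?x i - ?y j\<bar> \<le> G2" for i j
      unfolding G2_def
    proof (rule less.hyps[OF lt D' \<Lambda>' _ upd[OF \<omega>(1)] upd[OF \<omega>(2)] _ _ localD])
      show "insert e B \<subseteq> E - ?D" using B eE by auto
      show "open_on (E - ?D - insert e B) (fun_upd \<omega> e i)" "open_on (E - ?D - insert e B) (fun_upd \<eta> e j)"
        using op by (auto simp: open_on_def)
    qed
    have G: "G = w e + G1"
    proof -
      have "D \<inter> ?N B = insert e (?D \<inter> ?N B)" using 3 by auto
      then show ?thesis unfolding G_def G1_def using D by simp
    qed
    have G12: "G2 \<le> G1 + (\<Sum>g\<in>nb e. w g)"
    proof -
      have fin: "finite (?D \<inter> ?N B)" "finite (nb e)" using D finite_nb[OF eE] by auto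
      have nn: "0 \<le> w g" if "g \<in> (?D \<inter> ?N B) \<union> nb e" for g
        using that w(1) D nb_subset[OF eE] by auto
      have "G2 \<le> (\<Sum>g\<in>(?D \<inter> ?N B) \<union> nb e. w g)"
        unfolding G2_def using fin nn by (intro sum_mono2) auto
      also have "\<dots> \<le> G1 + (\<Sum>g\<in>nb e. w g)"
        unfolding G1_def using sum_Un[OF fin, of w]
          sum_nonneg[of "(?D \<inter> ?N B) \<inter> nb e" w] nn by fastforce
      finally show ?thesis .
    qed
    have G1G2: "G1 \<le> G2"
      unfolding G1_def G2_def using D w_nonneg by (intro sum_mono2) auto
    obtain a where a: "p_hat p q e \<le> a" "a \<le> 1" and
      eqa: "\<And>f. gibbs_expect D \<omega> f =
         a * gibbs_expect ?D (fun_upd \<omega> e True) f + (1 - a) * gibbs_expect ?D (fun_upd \<omega> e False) f"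
      using gibbs_expect_reveal[OF \<omega>(1) D eD, of thesis] by blast
    obtain b where b: "p_hat p q e \<le> b" "b \<le> 1" and
      eqb: "\<And>f. gibbs_expect D \<eta> f =
         b * gibbs_expect ?D (fun_upd \<eta> e True) f + (1 - b) * gibbs_expect ?D (fun_upd \<eta> e False) f"
      using gibbs_expect_reveal[OF \<omega>(2) D eD, of thesis] by blast
    \<comment> \<open>Maximal coupling of the state of \<open>e\<close>: both sides are open with
      probability \<open>min a b\<close>, so some side is closed with probability at most
      \<open>closed_bound e\<close>.\<close>
    define m where "m = min a b"
    have p0: "0 < p_hat p q e" by (rule p_hat_pos[OF eE])
    have couple: "\<bar>gibbs_expect D \<omega> f - gibbs_expect D \<eta> f'\<bar> \<le> m * G1 + (1 - m) * G2"
    proof -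
      have tri: "\<bar>s * x + t * y + r * z\<bar> \<le> s * X + t * Y + r * Y"
        if "0 \<le> s" "0 \<le> t" "0 \<le> r" "\<bar>x\<bar> \<le> X" "\<bar>y\<bar> \<le> Y" "\<bar>z\<bar> \<le> Y" for s t r x y z X Y :: real
      proof -
        have "\<bar>s * x + t * y + r * z\<bar> \<le> \<bar>s * x\<bar> + \<bar>t * y\<bar> + \<bar>r * z\<bar>" by linarith
        also have "\<dots> = s * \<bar>x\<bar> + t * \<bar>y\<bar> + r * \<bar>z\<bar>" using that by (simp add: abs_mult)
        also have "\<dots> \<le> s * X + t * Y + r * Y" using that by (intro add_mono mult_left_mono) auto
        finally show ?thesis .
      qed
      show ?thesis
      proof (cases "a \<le> b")
        case True
        have "gibbs_expect D \<omega> f - gibbs_expect D \<eta> f' =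
          a * (?x True - ?y True) + (b - a) * (?x False - ?y True) + (1 - b) * (?x False - ?y False)"
          unfolding eqa eqb by (simp add: algebra_simps)
        also have "\<bar>\<dots>\<bar> \<le> a * G1 + (b - a) * G2 + (1 - b) * G2"
          using True a b p0 11 any by (intro tri) auto
        also have "\<dots> = m * G1 + (1 - m) * G2" using True by (simp add: m_def algebra_simps)
        finally show ?thesis .
      next
        case False
        have "gibbs_expect D \<omega> f - gibbs_expect D \<eta> f' =
          b * (?x True - ?y True) + (a - b) * (?x True - ?y False) + (1 - a) * (?x False - ?y False)"
          unfolding eqa eqb by (simp add: algebra_simps)
        also have "\<bar>\<dots>\<bar> \<le> b * G1 + (a - b) * G2 + (1 - a) * G2"
          using False a b p0 11 any by (intro tri) auto
        also have "\<dots> = m * G1 + (1 - m) * G2" using False by (simp add: m_def algebra_simps)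
        finally show ?thesis .
      qed
    qed
    \<comment> \<open>The weight \<open>w e\<close> that leaves the front pays for the neighbours
      that enter it with probability at most \<open>closed_bound e\<close>.\<close>
    have "m * G1 + (1 - m) * G2 = G1 + (1 - m) * (G2 - G1)" by (simp add: algebra_simps)
    also have "\<dots> \<le> G1 + closed_bound e * (G2 - G1)"
      using a b G1G2 unfolding closed_bound_def m_def by (intro add_left_mono mult_right_mono) auto
    also have "\<dots> \<le> G1 + closed_bound e * (\<Sum>g\<in>nb e. w g)"
      using G12 closed_bound_bounds[OF eE] by (intro add_left_mono mult_left_mono) auto
    also have "\<dots> \<le> G" using w(3)[of e] eE 3 G by simp
    finally show ?thesis using couple unfolding G_def by simp
  qed
qed

text \<open>
  The weight of \<open>e\<close> is the sum of the products of the \<open>closed_bound\<close>s along the paths from \<open>e\<close> that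
  end when they first hit \<open>\<Lambda>\<close>, as in the union bound for the event that \<open>e\<close> has a closed path to \<open>\<Lambda>\<close>.
\<close>

lemma summable_weight_exists:
  assumes \<Lambda>: "finite \<Lambda>" "\<Lambda> \<subseteq> E" and \<theta>: "\<theta> < 1" "\<And>e. e \<in> E - \<Lambda> \<Longrightarrow> (\<Sum>f\<in>nb e. closed_bound f) \<le> \<theta>"
  obtains w where "\<And>e. e \<in> E \<Longrightarrow> 0 \<le> w e" "\<And>e. e \<in> \<Lambda> \<Longrightarrow> 1 \<le> w e"
    "\<And>e. e \<in> E - \<Lambda> \<Longrightarrow> closed_bound e * (\<Sum>g\<in>nb e. w g) \<le> w e" "w summable_on E"
proof -
  define \<theta>' where "\<theta>' = max 0 \<theta>"
  have \<theta>': "0 \<le> \<theta>'" "\<theta>' < 1" "\<And>e. e \<in> E - \<Lambda> \<Longrightarrow> (\<Sum>f\<in>nb e. closed_bound f) \<le> \<theta>'"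
    using \<theta> by (simp_all add: \<theta>'_def max.coboundedI2)
  \<comment> \<open>\<open>u n f\<close> collects the paths of \<open>n\<close> steps from
    \<open>f\<close> that hit \<Lambda> for the first time at their end; \<open>A n\<close> below is
    a finite set containing its support.\<close>
  define u where "u = rec_nat (\<lambda>f. if f \<in> \<Lambda> then 1 else (0::real))
    (\<lambda>_ u f. if f \<in> E - \<Lambda> then closed_bound f * (\<Sum>g\<in>nb f. u g) else 0)"
  have u0: "u 0 = (\<lambda>f. if f \<in> \<Lambda> then 1 else 0)"
    and uS: "u (Suc n) = (\<lambda>f. if f \<in> E - \<Lambda> then closed_bound f * (\<Sum>g\<in>nb f. u n g) else 0)" for n
    by (simp_all only: u_def nat.rec)
  define A where "A = rec_nat \<Lambda> (\<lambda>_ A. \<Union>g\<in>A. nb g)"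
  have A0: "A 0 = \<Lambda>" and AS: "A (Suc n) = (\<Union>g\<in>A n. nb g)" for n by (simp_all only: A_def nat.rec)
  have A: "finite (A n) \<and> A n \<subseteq> E" for n
  proof (induction n)
    case (Suc n)
    then show ?case using finite_nb nb_subset unfolding AS by blast
  qed (use \<Lambda> A0 in auto)
  have nbE: "g \<in> E" if "f \<in> E" "g \<in> nb f" for f g using nb_subset that by blast
  have u_nonneg: "0 \<le> u n f" for n f
  proof (induction n arbitrary: f)
    case (Suc n)
    then show ?case
      unfolding uS using closed_bound_bounds(1) by (auto intro!: mult_nonneg_nonneg sum_nonneg)
  qed (simp add: u0)
  have u_supp: "f \<in> A n" if "u n f \<noteq> 0" for n f
  proof (cases n)
    case 0
    then show ?thesis using that by (auto simp: u0 A0 split: if_splits)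
  next
    case (Suc k)
    have "\<forall>f. u k f \<noteq> 0 \<longrightarrow> f \<in> A k"
    proof (induction k)
      case 0
      show ?case by (auto simp: u0 A0)
    next
      case (Suc k)
      show ?case
      proof (intro allI impI)
        fix f assume "u (Suc k) f \<noteq> 0"
        then have f: "f \<in> E" "(\<Sum>g\<in>nb f. u k g) \<noteq> 0" by (auto simp: uS split: if_splits)
        then obtain g where "g \<in> nb f" "u k g \<noteq> 0" using sum.not_neutral_contains_not_neutral by blast
        then show "f \<in> A (Suc k)" using Suc f nb_sym unfolding AS by blast
      qed
    qed
    moreover have f: "f \<in> E" "(\<Sum>g\<in>nb f. u k g) \<noteq> 0"
      using that Suc by (auto simp: uS split: if_splits)
    then obtain g where "g \<in> nb f" "u k g \<noteq> 0" using sum.not_neutral_contains_not_neutral by blast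
    ultimately show ?thesis using Suc f nb_sym unfolding Suc AS by blast
  qed
  define a where "a n = (\<Sum>f\<in>A n. u n f)" for n
  have sum_le: "(\<Sum>f\<in>F. u n f) \<le> a n" if "finite F" for F n
  proof -
    have "(\<Sum>f\<in>F. u n f) = (\<Sum>f\<in>F \<inter> A n. u n f)"
      using that u_supp by (intro sum.mono_neutral_right) auto
    also have "\<dots> \<le> a n" unfolding a_def using A u_nonneg by (intro sum_mono2) auto
    finally show ?thesis .
  qed
  \<comment> \<open>By the symmetry of \<open>nb\<close> the double sum can be taken over the inner
    edge \<open>g\<close> first; each term then carries the sum of \<open>closed_bound\<close> over
    all neighbours of \<open>g\<close>.\<close>
  have aS: "a (Suc n) \<le> (\<Sum>g\<in>A n. u n g * (\<Sum>f\<in>nb g. closed_bound f))" for n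
  proof -
    have "a (Suc n) \<le> (\<Sum>f\<in>A (Suc n). \<Sum>g\<in>A n. if f \<in> nb g then closed_bound f * u n g else 0)"
      unfolding a_def
    proof (rule sum_mono)
      fix f assume "f \<in> A (Suc n)"
      then have f: "f \<in> E" using A by auto
      have "(\<Sum>g\<in>nb f. u n g) = (\<Sum>g\<in>nb f \<inter> A n. u n g)"
        using finite_nb[OF f] u_supp by (intro sum.mono_neutral_right) auto
      also have "\<dots> = (\<Sum>g\<in>A n. if f \<in> nb g then u n g else 0)"
      proof -
        have "nb f \<inter> A n = {g \<in> A n. f \<in> nb g}" using A[of n] f nb_sym by blast
        then show ?thesis using A[of n] by (simp add: sum.If_cases Int_def)
      qed
      finally have "closed_bound f * (\<Sum>g\<in>nb f. u n g) =
        (\<Sum>g\<in>A n. if f \<in> nb g then closed_bound f * u n g else 0)"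
        by (simp add: sum_distrib_left if_distrib cong: if_cong)
      moreover have "u (Suc n) f \<le> closed_bound f * (\<Sum>g\<in>nb f. u n g)"
        unfolding uS using f closed_bound_bounds u_nonneg by (auto intro!: mult_nonneg_nonneg sum_nonneg)
      ultimately show "u (Suc n) f \<le> (\<Sum>g\<in>A n. if f \<in> nb g then closed_bound f * u n g else 0)"
        by simp
    qed
    also have "\<dots> = (\<Sum>g\<in>A n. \<Sum>f\<in>A (Suc n). if f \<in> nb g then closed_bound f * u n g else 0)"
      by (rule sum.swap)
    also have "\<dots> = (\<Sum>g\<in>A n. u n g * (\<Sum>f\<in>nb g. closed_bound f))"
    proof (rule sum.cong[OF refl])
      fix g assume g: "g \<in> A n"
      then have "{f \<in> A (Suc n). f \<in> nb g} = nb g" unfolding AS by auto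
      then show "(\<Sum>f\<in>A (Suc n). if f \<in> nb g then closed_bound f * u n g else 0) =
          u n g * (\<Sum>f\<in>nb g. closed_bound f)"
        using A[of "Suc n"] by (simp add: sum.If_cases Int_def sum_distrib_left mult.commute)
    qed
    finally show ?thesis .
  qed
  \<comment> \<open>From the first step on \<open>u\<close> vanishes on \<Lambda>, so the bound by
    \<theta>' applies to every term. It does not cover the step from \<open>a 0\<close> to
    \<open>a 1\<close>, whence the factor \<open>a 1\<close> in the geometric bound.\<close>
  have aSS: "a (Suc (Suc n)) \<le> \<theta>' * a (Suc n)" for n
  proof -
    have "u (Suc n) g * (\<Sum>f\<in>nb g. closed_bound f) \<le> \<theta>' * u (Suc n) g" for g
    proof (cases "g \<in> E - \<Lambda>")
      case True
      then show ?thesis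
        using mult_right_mono[OF \<theta>'(3)[OF True] u_nonneg[of "Suc n" g]] by (simp add: mult.commute)
    qed (auto simp: uS)
    then have "(\<Sum>g\<in>A (Suc n). u (Suc n) g * (\<Sum>f\<in>nb g. closed_bound f)) \<le> (\<Sum>g\<in>A (Suc n). \<theta>' * u (Suc n) g)"
      by (intro sum_mono)
    then show ?thesis using aS[of "Suc n"] unfolding a_def[of "Suc n"] by (simp add: sum_distrib_left)
  qed
  have geo: "a (Suc n) \<le> a 1 * \<theta>' ^ n" for n
  proof (induction n)
    case (Suc n)
    have "a (Suc (Suc n)) \<le> \<theta>' * (a 1 * \<theta>' ^ n)"
      using aSS[of n] mult_left_mono[OF Suc \<theta>'(1)] by linarith
    then show ?case by (simp add: algebra_simps)
  qed simp
  have a_nonneg: "0 \<le> a n" for n unfolding a_def by (intro sum_nonneg u_nonneg)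
  have "summable (\<lambda>n. a 1 * \<theta>' ^ n)" using \<theta>' by (intro summable_mult summable_geometric) auto
  then have "summable (\<lambda>n. a (Suc n))"
    by (rule summable_comparison_test') (use geo a_nonneg in auto)
  then have suma: "summable a" by (simp add: summable_Suc_iff)
  have u_le: "u n f \<le> a n" for n f using sum_le[of "{f}" n] by simp
  have sumu: "summable (\<lambda>n. u n f)" for f
    using suma by (rule summable_comparison_test') (use u_le u_nonneg in auto)
  define w where "w f = suminf (\<lambda>n. u n f)" for f
  show ?thesis
  proof (rule that[of w])
    show "0 \<le> w e" for e unfolding w_def by (intro suminf_nonneg sumu u_nonneg)
    show "1 \<le> w e" if "e \<in> \<Lambda>" for e
      using sum_le_suminf[OF sumu[of e], of "{0}"] u_nonneg that by (simp add: w_def u0)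
    show "closed_bound e * (\<Sum>g\<in>nb e. w g) \<le> w e" if e: "e \<in> E - \<Lambda>" for e
    proof -
      have "w e = suminf (\<lambda>n. u (Suc n) e)"
        using suminf_split_head[OF sumu[of e]] e by (simp add: w_def u0)
      also have "\<dots> = suminf (\<lambda>n. closed_bound e * (\<Sum>g\<in>nb e. u n g))" using e by (simp add: uS)
      also have "\<dots> = closed_bound e * suminf (\<lambda>n. \<Sum>g\<in>nb e. u n g)"
        by (intro suminf_mult summable_sum sumu)
      also have "suminf (\<lambda>n. \<Sum>g\<in>nb e. u n g) = (\<Sum>g\<in>nb e. w g)"
        unfolding w_def by (intro suminf_sum sumu)
      finally show ?thesis by simp
    qed
    have "(\<Sum>f\<in>F. w f) \<le> suminf a" if "finite F" for F
    proof -
      have "(\<Sum>f\<in>F. w f) = suminf (\<lambda>n. \<Sum>f\<in>F. u n f)"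
        unfolding w_def by (intro suminf_sum[symmetric] sumu)
      also have "\<dots> \<le> suminf a"
        by (intro suminf_le sum_le that summable_sum sumu suma)
      finally show ?thesis .
    qed
    then show "w summable_on E"
      by (intro nonneg_bdd_above_summable_on bdd_aboveI2[where M = "suminf a"])
        (auto simp: w_def intro!: suminf_nonneg sumu u_nonneg)
  qed
qed

lemma summable_on_small_tail:
  fixes w :: "'b \<Rightarrow> real"
  assumes "w summable_on A" "0 < \<epsilon>"
  obtains X where "finite X" "X \<subseteq> A" "\<And>Y. finite Y \<Longrightarrow> Y \<subseteq> A - X \<Longrightarrow> sum w Y < \<epsilon>"
proof -
  obtain S where "(w has_sum S) A" using assms by (auto simp: summable_on_def)
  then have "(sum w \<longlongrightarrow> S) (finite_subsets_at_top A)" by (simp add: has_sum_def)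
  then have "\<forall>\<^sub>F F in finite_subsets_at_top A. dist (sum w F) S < \<epsilon> / 2"
    using assms(2) by (intro tendstoD) auto
  then obtain X where X: "finite X" "X \<subseteq> A"
    "\<And>Y. finite Y \<Longrightarrow> X \<subseteq> Y \<Longrightarrow> Y \<subseteq> A \<Longrightarrow> dist (sum w Y) S < \<epsilon> / 2"
    by (auto simp: eventually_finite_subsets_at_top)
  show ?thesis
  proof (rule that[of X])
    fix Y assume Y: "finite Y" "Y \<subseteq> A - X"
    have "dist (sum w (X \<union> Y)) S < \<epsilon> / 2" "dist (sum w X) S < \<epsilon> / 2"
      by (rule X(3); use X Y in auto)+
    moreover have "sum w (X \<union> Y) = sum w X + sum w Y"
      using X Y by (intro sum.union_disjoint) auto
    ultimately show "sum w Y < \<epsilon>" by (auto simp: dist_real_def abs_if split: if_splits)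
  qed (use X in auto)
qed

text \<open>Each edge is linked to a fixed \<open>a\<close> by a finite chain. Recording that every
  element of the chain is reached from \<open>a\<close> makes the union of the chains link
  connected.\<close>

lemma link_connected_superset:
  assumes "finite \<Lambda>" "\<Lambda> \<subseteq> E"
  obtains \<Lambda>' where "finite \<Lambda>'" "\<Lambda> \<subseteq> \<Lambda>'" "\<Lambda>' \<subseteq> E" "link_connected \<Lambda>'"
proof -
  let ?r = "\<lambda>K x y. x \<in> K \<and> y \<in> K \<and> linked x y"
  have mono: "(?r K')\<^sup>*\<^sup>* a b" if "(?r K)\<^sup>*\<^sup>* a b" "K \<subseteq> K'" for K K' a b
    using that by (auto elim!: rtranclp_mono[THEN predicate2D, rotated])
  have sym: "(?r H)\<^sup>*\<^sup>* b a" if "(?r H)\<^sup>*\<^sup>* a b" "H \<subseteq> E" for a b H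
  proof -
    have "symp (?r H)" using linked_sym that by (auto simp: symp_def)
    from sympD[OF symp_rtranclp[OF this]] that show ?thesis by blast
  qed
  have chain: "\<exists>K. finite K \<and> K \<subseteq> E \<and> a \<in> K \<and> b \<in> K \<and> (?r K)\<^sup>*\<^sup>* a b \<and> (\<forall>x\<in>K. (?r K)\<^sup>*\<^sup>* a x)"
    if "a \<in> E" "(?r E)\<^sup>*\<^sup>* a b" for a b
    using that(2)
  proof (induction rule: rtranclp_induct)
    case base
    show ?case using that(1) by (intro exI[of _ "{a}"]) auto
  next
    case (step y z)
    then obtain K where K: "finite K" "K \<subseteq> E" "a \<in> K" "y \<in> K" "(?r K)\<^sup>*\<^sup>* a y" "\<forall>x\<in>K. (?r K)\<^sup>*\<^sup>* a x"
      by blast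
    have m: "(?r (insert z K))\<^sup>*\<^sup>* a x" if "(?r K)\<^sup>*\<^sup>* a x" for x by (rule mono[OF that]) auto
    have z: "(?r (insert z K))\<^sup>*\<^sup>* a z"
      using m[OF K(5)] by (rule rtranclp.rtrancl_into_rtrancl) (use step K in auto)
    show ?case using K step m z by (intro exI[of _ "insert z K"]) auto
  qed
  show ?thesis
  proof (cases "\<Lambda> = {}")
    case True
    then show ?thesis by (intro that[of "{}"]) (auto simp: link_connected_def)
  next
    case False
    then obtain a where a: "a \<in> \<Lambda>" by auto
    have "\<exists>K. finite K \<and> K \<subseteq> E \<and> a \<in> K \<and> b \<in> K \<and> (?r K)\<^sup>*\<^sup>* a b \<and> (\<forall>x\<in>K. (?r K)\<^sup>*\<^sup>* a x)"
      if "b \<in> \<Lambda>" for b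
      using link_connected_E a that assms unfolding link_connected_def by (intro chain) auto
    then have "\<forall>b\<in>\<Lambda>. \<exists>K. finite K \<and> K \<subseteq> E \<and> b \<in> K \<and> (\<forall>x\<in>K. (?r K)\<^sup>*\<^sup>* a x)" by blast
    from bchoice[OF this] obtain K
      where K: "\<And>b. b \<in> \<Lambda> \<Longrightarrow> finite (K b) \<and> K b \<subseteq> E \<and> b \<in> K b \<and> (\<forall>x\<in>K b. (?r (K b))\<^sup>*\<^sup>* a x)"
      by auto
    let ?L = "\<Union>b\<in>\<Lambda>. K b"
    have L: "?L \<subseteq> E" using K by auto
    have reach: "(?r ?L)\<^sup>*\<^sup>* a x" if x: "x \<in> ?L" for x
    proof -
      obtain b where b: "b \<in> \<Lambda>" "x \<in> K b" using x by auto
      then have "(?r (K b))\<^sup>*\<^sup>* a x" using K by blast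
      then show ?thesis by (rule mono) (use b in auto)
    qed
    have "link_connected ?L" unfolding link_connected_def
    proof (intro ballI)
      fix x y assume "x \<in> ?L" "y \<in> ?L"
      then show "(?r ?L)\<^sup>*\<^sup>* x y" using reach sym[OF _ L] by (meson rtranclp_trans)
    qed
    then show ?thesis using K L assms by (intro that[of ?L]) auto
  qed
qed

text \<open>One set \<open>X\<close> serves all local pairs and all boundary conditions. This
  uniformity is needed when the finite range version of an event runs through a sequence.\<close>

definition boundary_insensitive :: "'e set \<Rightarrow> 'e set \<Rightarrow> real \<Rightarrow> bool" where
  "boundary_insensitive \<Lambda> X \<epsilon> \<longleftrightarrow> (\<forall>F G \<omega> \<eta> f f'.
      X \<subseteq> F \<longrightarrow> F \<subseteq> G \<longrightarrow> G \<subseteq> E \<longrightarrow> finite G \<longrightarrow> \<omega> \<in> configs E \<longrightarrow> \<eta> \<in> configs E \<longrightarrow>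
      (\<forall>\<xi>\<in>configs E. 0 \<le> f \<xi> \<and> f \<xi> \<le> 1) \<longrightarrow> (\<forall>\<xi>\<in>configs E. 0 \<le> f' \<xi> \<and> f' \<xi> \<le> 1) \<longrightarrow>
      (\<forall>H. \<Lambda> \<subseteq> H \<longrightarrow> H \<subseteq> F \<longrightarrow> link_connected H \<longrightarrow> local_pair H f f') \<longrightarrow>
      \<bar>gibbs_expect G \<omega> f - gibbs_expect F \<eta> f'\<bar> \<le> \<epsilon>)"

lemma boundary_insensitiveD:
  assumes "boundary_insensitive \<Lambda> X \<epsilon>" "X \<subseteq> F" "F \<subseteq> G" "G \<subseteq> E" "finite G" "\<omega> \<in> configs E" "\<eta> \<in> configs E"
    "\<And>\<xi>. \<xi> \<in> configs E \<Longrightarrow> 0 \<le> f \<xi> \<and> f \<xi> \<le> 1" "\<And>\<xi>. \<xi> \<in> configs E \<Longrightarrow> 0 \<le> f' \<xi> \<and> f' \<xi> \<le> 1"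
    "\<And>H. \<Lambda> \<subseteq> H \<Longrightarrow> H \<subseteq> F \<Longrightarrow> link_connected H \<Longrightarrow> local_pair H f f'"
  shows "\<bar>gibbs_expect G \<omega> f - gibbs_expect F \<eta> f'\<bar> \<le> \<epsilon>"
  using assms unfolding boundary_insensitive_def by simp

text \<open>Treating all edges outside \<open>F\<close> as closed, the exploration starts with the
  edges of \<open>F\<close> that neighbour its complement. Their total weight is small for large
  \<open>F\<close>, since \<open>w\<close> is summable.\<close>

lemma gibbs_expect_uniform:
  assumes J: "finite J" "J \<subseteq> E"
  obtains \<Lambda> where "finite \<Lambda>" "J \<subseteq> \<Lambda>" "\<Lambda> \<subseteq> E" "link_connected \<Lambda>"
    "\<And>\<epsilon>. 0 < \<epsilon> \<Longrightarrow> \<exists>X. finite X \<and> X \<subseteq> E \<and> \<Lambda> \<subseteq> X \<and> boundary_insensitive \<Lambda> X \<epsilon>"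
proof -
  obtain \<Lambda>0 \<theta> where \<Lambda>0: "finite \<Lambda>0" "\<Lambda>0 \<subseteq> E" and \<theta>: "\<theta> < 1"
    "\<forall>e\<in>E - \<Lambda>0. (\<Sum>f\<in>nb e. closed_bound f) \<le> \<theta>" using small by blast
  \<comment> \<open>The exceptional set \<open>\<Lambda>0\<close> is absorbed into \<Lambda>, so
    that the bound by \<theta> holds at every edge outside \<Lambda>.\<close>
  obtain \<Lambda> where \<Lambda>: "finite \<Lambda>" "J \<union> \<Lambda>0 \<subseteq> \<Lambda>" "\<Lambda> \<subseteq> E" "link_connected \<Lambda>"
    using link_connected_superset[of "J \<union> \<Lambda>0"] J \<Lambda>0 by auto
  obtain w where w: "\<And>e. e \<in> E \<Longrightarrow> 0 \<le> w e" "\<And>e. e \<in> \<Lambda> \<Longrightarrow> 1 \<le> w e"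
    "\<And>e. e \<in> E - \<Lambda> \<Longrightarrow> closed_bound e * (\<Sum>g\<in>nb e. w g) \<le> w e" "w summable_on E"
    by (rule summable_weight_exists[OF \<Lambda>(1,3) \<theta>(1)]) (use \<theta>(2) \<Lambda>(2) in blast)+
  show ?thesis
  proof (rule that[OF \<Lambda>(1) _ \<Lambda>(3,4)])
    show "J \<subseteq> \<Lambda>" using \<Lambda> by auto
    fix \<epsilon> :: real assume "0 < \<epsilon>"
    then obtain X0 where X0: "finite X0" "X0 \<subseteq> E" "\<And>Y. finite Y \<Longrightarrow> Y \<subseteq> E - X0 \<Longrightarrow> sum w Y < \<epsilon>"
      using summable_on_small_tail[OF w(4), of \<epsilon>] by blast
    \<comment> \<open>As the neighbours of \<open>X0\<close> lie in \<open>F\<close> too, no edge of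
      \<open>X0\<close> neighbours the complement of \<open>F\<close>.\<close>
    define X where "X = \<Lambda> \<union> X0 \<union> (\<Union>e\<in>X0. nb e)"
    have X: "finite X" "X \<subseteq> E" "\<Lambda> \<subseteq> X"
      unfolding X_def using \<Lambda> X0 finite_nb nb_subset by blast+
    have "\<bar>gibbs_expect G \<omega> f - gibbs_expect F \<eta> f'\<bar> \<le> \<epsilon>"
      if F: "X \<subseteq> F" "F \<subseteq> G" and G: "G \<subseteq> E" "finite G" and \<omega>: "\<omega> \<in> configs E" "\<eta> \<in> configs E"
        and f: "\<forall>\<xi>\<in>configs E. 0 \<le> f \<xi> \<and> f \<xi> \<le> 1" "\<forall>\<xi>\<in>configs E. 0 \<le> f' \<xi> \<and> f' \<xi> \<le> 1"
        and local: "\<forall>H. \<Lambda> \<subseteq> H \<longrightarrow> H \<subseteq> F \<longrightarrow> link_connected H \<longrightarrow> local_pair H f f'" for F G \<omega> \<eta> f f'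
    proof (rule gibbs_expect_enlarge[OF G(2) F(2) G(1) \<omega>(1)])
      fix \<xi> assume \<xi>: "\<xi> \<in> configs E"
      have FE: "finite F" "F \<subseteq> E" using F G by (auto intro: finite_subset)
      have "\<bar>gibbs_expect F \<xi> f - gibbs_expect F \<eta> f'\<bar> \<le> (\<Sum>g\<in>F \<inter> (\<Union>b\<in>E - F. nb b). w g)"
      proof (rule gibbs_expect_compare[OF FE _ \<Lambda>(4) _ \<xi> \<omega>(2)])
        show "\<Lambda> \<subseteq> F" using X F by auto
        show "open_on (E - F - (E - F)) \<xi>" "open_on (E - F - (E - F)) \<eta>" by (auto simp: open_on_def)
      qed (use f local w in auto)
      also have "F \<inter> (\<Union>b\<in>E - F. nb b) \<subseteq> E - X0"
      proof
        fix g assume "g \<in> F \<inter> (\<Union>b\<in>E - F. nb b)"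
        then obtain b where b: "g \<in> F" "b \<in> E - F" "g \<in> nb b" by blast
        then have "b \<in> nb g" "g \<in> E" using nb_sym FE by blast+
        moreover have "b \<notin> X" using b F by auto
        ultimately show "g \<in> E - X0" unfolding X_def by blast
      qed
      then have "(\<Sum>g\<in>F \<inter> (\<Union>b\<in>E - F. nb b). w g) < \<epsilon>"
        using FE by (intro X0) auto
      finally show "\<bar>gibbs_expect F \<xi> f - gibbs_expect F \<eta> f'\<bar> \<le> \<epsilon>" by simp
    qed
    then show "\<exists>X. finite X \<and> X \<subseteq> E \<and> \<Lambda> \<subseteq> X \<and> boundary_insensitive \<Lambda> X \<epsilon>"
      using X unfolding boundary_insensitive_def by blast
  qed
qed

end

section \<open>Measures on the configuration space\<close>

definition cylinder :: "'e set \<Rightarrow> 'e set \<Rightarrow> 'e set \<Rightarrow> ('e \<Rightarrow> bool) set" where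
  "cylinder E J S = {\<omega> \<in> configs E. \<forall>e\<in>J. \<omega> e \<longleftrightarrow> e \<in> S}"

definition depends_on :: "'e set \<Rightarrow> 'e set \<Rightarrow> (('e \<Rightarrow> bool) \<Rightarrow> real) \<Rightarrow> bool" where
  "depends_on E J f \<longleftrightarrow> (\<forall>\<omega>\<in>configs E. \<forall>\<eta>\<in>configs E. agree_on J \<omega> \<eta> \<longrightarrow> f \<omega> = f \<eta>)"

section \<open>Cylinders and functions of finitely many edges\<close>

lemma space_config [simp]: "space (config_space E) = configs E"
  by (simp add: space_PiM)

lemma measurable_coordinate: "e \<in> E \<Longrightarrow> (\<lambda>\<omega>. \<omega> e) \<in> config_space E \<rightarrow>\<^sub>M count_space UNIV"
  by (rule measurable_component_singleton)

lemma sets_cylinder: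
  assumes "finite J" "J \<subseteq> E" shows "cylinder E J S \<in> sets (config_space E)"
proof -
  have "{\<omega> \<in> space (config_space E). \<forall>e\<in>J. \<omega> e \<longleftrightarrow> e \<in> S} \<in> sets (config_space E)"
  proof (rule sets.sets_Collect_finite_All)
    fix e assume "e \<in> J"
    then have "(\<lambda>\<omega>. \<omega> e) -` {e \<in> S} \<inter> space (config_space E) \<in> sets (config_space E)"
      using assms by (intro measurable_sets[OF measurable_coordinate]) auto
    moreover have "(\<lambda>\<omega>. \<omega> e) -` {e \<in> S} \<inter> space (config_space E) =
      {\<omega> \<in> space (config_space E). \<omega> e = (e \<in> S)}" by auto
    ultimately show "{\<omega> \<in> space (config_space E). \<omega> e = (e \<in> S)} \<in> sets (config_space E)" by simp
  qed (use assms in auto)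
  then show ?thesis by (simp add: cylinder_def)
qed

lemma depends_onD:
  "depends_on E J f \<Longrightarrow> \<omega> \<in> configs E \<Longrightarrow> \<eta> \<in> configs E \<Longrightarrow> agree_on J \<omega> \<eta> \<Longrightarrow> f \<omega> = f \<eta>"
  by (simp add: depends_on_def)

text \<open>The configuration \<zeta> just fills in states off \<open>J\<close>, on which
  \<open>f\<close> does not depend.\<close>

lemma depends_on_sum_cylinder:
  assumes "finite J" "J \<subseteq> E" "depends_on E J f" and \<zeta>: "\<zeta> \<in> configs E" and \<omega>: "\<omega> \<in> configs E"
  shows "f \<omega> = (\<Sum>S\<in>Pow J. f (patch \<zeta> J S) * indicator (cylinder E J S) \<omega>)"
proof -
  define S0 where "S0 = {e \<in> J. \<omega> e}"
  have "patch \<zeta> J S0 \<in> configs E" using \<zeta> assms(2) by (auto simp: patch_def PiE_iff extensional_def)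
  moreover have "agree_on J \<omega> (patch \<zeta> J S0)" by (auto simp: agree_on_def patch_def S0_def)
  ultimately have eq: "f \<omega> = f (patch \<zeta> J S0)" using depends_onD[OF assms(3) \<omega>] by blast
  have "(\<Sum>S\<in>Pow J. f (patch \<zeta> J S) * indicator (cylinder E J S) \<omega>) =
    (\<Sum>S\<in>{S0}. f (patch \<zeta> J S) * indicator (cylinder E J S) \<omega>)"
  proof (rule sum.mono_neutral_right)
    show "\<forall>S\<in>Pow J - {S0}. f (patch \<zeta> J S) * indicator (cylinder E J S) \<omega> = 0"
      by (auto simp: cylinder_def S0_def indicator_def)
  qed (use assms S0_def in auto)
  moreover have "\<omega> \<in> cylinder E J S0" using \<omega> by (auto simp: cylinder_def S0_def)
  ultimately show ?thesis using eq by simp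
qed

lemma depends_on_mono: "depends_on E J f \<Longrightarrow> J \<subseteq> J' \<Longrightarrow> depends_on E J' f"
  unfolding depends_on_def[of E J' f]
  by (intro ballI impI depends_onD[of E J f]) (auto simp: agree_on_def)

lemma depends_on_cylinder: "depends_on E J (indicator (cylinder E J S))"
  unfolding depends_on_def agree_on_def cylinder_def indicator_def by simp

lemma measurable_depends_on:
  assumes "finite J" "J \<subseteq> E" "depends_on E J f"
  shows "f \<in> borel_measurable (config_space E)"
proof -
  define \<zeta> where "\<zeta> = (\<lambda>e\<in>E. True)"
  have "\<zeta> \<in> configs E" by (simp add: \<zeta>_def)
  from depends_on_sum_cylinder[OF assms this]
  show ?thesis
    by (subst measurable_cong[where g = "\<lambda>\<omega>. \<Sum>S\<in>Pow J. f (patch \<zeta> J S) * indicator (cylinder E J S) \<omega>"])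
      (auto intro!: borel_measurable_sum borel_measurable_times borel_measurable_indicator
        sets_cylinder assms)
qed

text \<open>Cylinders that prescribe open edges only are stable under intersection; as they generate
  the product sigma-algebra, they suffice to identify measures.\<close>

lemma sets_sigma_config:
  "sets (config_space E) = sigma_sets (configs E) {cylinder E S S | S. finite S \<and> S \<subseteq> E}"
    (is "_ = sigma_sets _ ?G")
proof (intro equalityI)
  have *: "{\<omega> \<in> configs E. \<omega> e \<in> A} \<in> sigma_sets (configs E) ?G" if e: "e \<in> E" for e A
  proof -
    have T: "{\<omega> \<in> configs E. \<omega> e} \<in> sigma_sets (configs E) ?G"
      using e by (intro sigma_sets.Basic CollectI exI[of _ "{e}"]) (auto simp: cylinder_def)
    have U: "configs E \<in> sigma_sets (configs E) ?G" by (rule sigma_sets_top)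
    have N: "configs E - {\<omega> \<in> configs E. \<omega> e} \<in> sigma_sets (configs E) ?G"
      using T by (rule sigma_sets.Compl)
    have E: "{} \<in> sigma_sets (configs E) ?G" by (rule sigma_sets.Empty)
    have "{\<omega> \<in> configs E. \<omega> e \<in> A} =
      (if True \<in> A then if False \<in> A then configs E else {\<omega> \<in> configs E. \<omega> e}
       else if False \<in> A then configs E - {\<omega> \<in> configs E. \<omega> e} else {})"
      by (auto, (metis (full_types))+)
    then show ?thesis using T U N E by (simp only: split: if_splits) auto
  qed
  have "sets (config_space E) =
      sigma_sets (configs E) {{f \<in> configs E. f i \<in> A} |i A. i \<in> E \<and> A \<in> UNIV}"
    by (simp add: sets_PiM_single)
  also have "\<dots> \<subseteq> sigma_sets (configs E) ?G"
    by (rule sigma_sets_mono) (use * in auto)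
  finally show "sets (config_space E) \<subseteq> sigma_sets (configs E) ?G" .
  show "sigma_sets (configs E) ?G \<subseteq> sets (config_space E)"
    using sets_cylinder sets.sigma_sets_subset[of ?G "config_space E"] by (auto simp: subset_iff)
qed

lemma config_measure_eqI:
  fixes M N :: "('e \<Rightarrow> bool) measure"
  assumes "finite_measure M" "sets M = sets (config_space E)" "sets N = sets (config_space E)"
    and eq: "\<And>S. finite S \<Longrightarrow> S \<subseteq> E \<Longrightarrow> emeasure M (cylinder E S S) = emeasure N (cylinder E S S)"
  shows "M = N"
proof (rule measure_eqI_generator_eq[where \<Omega> = "configs E" and A = "\<lambda>_. configs E"
      and E = "{cylinder E S S | S. finite S \<and> S \<subseteq> E}"])
  show "Int_stable {cylinder E S S | S. finite S \<and> S \<subseteq> E}"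
  proof (rule Int_stableI)
    fix a b assume "a \<in> {cylinder E S S | S. finite S \<and> S \<subseteq> E}" "b \<in> {cylinder E S S | S. finite S \<and> S \<subseteq> E}"
    then obtain S T where "a = cylinder E S S" "b = cylinder E T T" "finite S" "finite T" "S \<subseteq> E" "T \<subseteq> E"
      by auto
    moreover have "cylinder E S S \<inter> cylinder E T T = cylinder E (S \<union> T) (S \<union> T)"
      by (auto simp: cylinder_def)
    ultimately show "a \<inter> b \<in> {cylinder E S S | S. finite S \<and> S \<subseteq> E}" by auto
  qed
  show "{cylinder E S S | S. finite S \<and> S \<subseteq> E} \<subseteq> Pow (configs E)" by (auto simp: cylinder_def)
  have "configs E = cylinder E {} {}" by (auto simp: cylinder_def)
  then show "range (\<lambda>_. configs E) \<subseteq> {cylinder E S S | S. finite S \<and> S \<subseteq> E}" by auto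
  interpret finite_measure M by fact
  show "emeasure M (configs E) \<noteq> \<infinity>" by simp
qed (use assms eq sets_sigma_config[of E] in auto)

lemma integral_depends_on:
  assumes fin: "finite_measure M" and sets: "sets M = sets (config_space E)"
    and J: "finite J" "J \<subseteq> E" "depends_on E J f" and \<zeta>: "\<zeta> \<in> configs E"
  shows "(\<integral>\<omega>. f \<omega> \<partial>M) = (\<Sum>S\<in>Pow J. f (patch \<zeta> J S) * measure M (cylinder E J S))"
proof -
  interpret finite_measure M by (rule fin)
  have space: "space M = configs E" using sets_eq_imp_space_eq[OF sets] by simp
  have cyl: "cylinder E J S \<in> sets M" for S using sets sets_cylinder J by auto
  have "(\<integral>\<omega>. f \<omega> \<partial>M) = (\<integral>\<omega>. (\<Sum>S\<in>Pow J. f (patch \<zeta> J S) * indicator (cylinder E J S) \<omega>) \<partial>M)"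
    using space by (intro Bochner_Integration.integral_cong refl depends_on_sum_cylinder J \<zeta>) auto
  also have "\<dots> = (\<Sum>S\<in>Pow J. \<integral>\<omega>. f (patch \<zeta> J S) * indicator (cylinder E J S) \<omega> \<partial>M)"
    using cyl by (intro Bochner_Integration.integral_sum integrable_mult_right integrable_real_indicator)
      (auto simp: emeasure_eq_measure)
  also have "\<dots> = (\<Sum>S\<in>Pow J. f (patch \<zeta> J S) * measure M (cylinder E J S))"
    using cyl by simp
  finally show ?thesis .
qed

text \<open>Kolmogorov extension. States are encoded as the reals 0 and 1 in order to take a
  projective limit of Borel measures on a Polish space, and decoded by the threshold 1/2.\<close>

lemma config_measure_exists:
  fixes \<rho> :: "'e set \<Rightarrow> 'e set \<Rightarrow> real"
  assumes nonneg: "\<And>J S. finite J \<Longrightarrow> J \<subseteq> E \<Longrightarrow> S \<subseteq> J \<Longrightarrow> 0 \<le> \<rho> J S"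
    and total: "\<rho> {} {} = 1"
    and consistent: "\<And>J H S. J \<subseteq> H \<Longrightarrow> finite H \<Longrightarrow> H \<subseteq> E \<Longrightarrow> S \<subseteq> J \<Longrightarrow>
      \<rho> J S = (\<Sum>T\<in>{T \<in> Pow H. T \<inter> J = S}. \<rho> H T)"
  obtains \<phi> where "prob_space \<phi>" "sets \<phi> = sets (config_space E)"
    "\<And>J S. finite J \<Longrightarrow> J \<subseteq> E \<Longrightarrow> S \<subseteq> J \<Longrightarrow> measure \<phi> (cylinder E J S) = \<rho> J S"
proof -
  let ?B = "\<lambda>J. PiM J (\<lambda>_. borel :: real measure)"
  define enc where "enc J S = (\<lambda>e\<in>J. of_bool (e \<in> S) :: real)" for J S :: "'e set"
  define P where "P J = distr (point_measure (Pow J) (\<lambda>S. ennreal (\<rho> J S))) (?B J) (enc J)" for J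
  have enc_space: "enc J S \<in> space (?B J)" for J S by (auto simp: enc_def space_PiM)
  have enc_meas: "enc J \<in> point_measure A g \<rightarrow>\<^sub>M ?B J" for J A g
    using enc_space by (auto simp: measurable_point_measure_eq1)
  have P_emeasure: "emeasure (distr (point_measure (Pow H) (\<lambda>S. ennreal (\<rho> H S))) (?B J) (enc J)) X =
      (\<Sum>T\<in>{T \<in> Pow H. enc J T \<in> X}. ennreal (\<rho> H T))"
    if "finite H" "X \<in> sets (?B J)" for H J X
  proof -
    have "enc J -` X \<inter> space (point_measure (Pow H) (\<lambda>S. ennreal (\<rho> H S))) = {T \<in> Pow H. enc J T \<in> X}"
      by (auto simp: space_point_measure)
    then show ?thesis
      using that emeasure_point_measure_finite[of "Pow H" "{T \<in> Pow H. enc J T \<in> X}"]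
      by (subst emeasure_distr[OF enc_meas]) auto
  qed
  have proj: "P J = distr (P H) (?B J) (\<lambda>f. restrict f J)" if "J \<subseteq> H" "finite H" "H \<subseteq> E" for J H
  proof -
    have finJ: "finite J" using that by (auto intro: finite_subset)
    have "restrict (enc H T) J = enc J T" for T using that by (auto simp: enc_def fun_eq_iff restrict_def)
    then have comp: "(\<lambda>f. restrict f J) \<circ> enc H = enc J" by (auto simp: fun_eq_iff)
    have "distr (P H) (?B J) (\<lambda>f. restrict f J) =
        distr (point_measure (Pow H) (\<lambda>S. ennreal (\<rho> H S))) (?B J) (enc J)"
      unfolding P_def comp[symmetric]
      by (rule distr_distr[OF measurable_restrict_subset[OF that(1)] enc_meas])
    also have "\<dots> = P J"
    proof (rule measure_eqI)
      fix X assume "X \<in> sets (distr (point_measure (Pow H) (\<lambda>S. ennreal (\<rho> H S))) (?B J) (enc J))"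
      then have X: "X \<in> sets (?B J)" by simp
      have encI: "enc J T = enc J (T \<inter> J)" for T by (auto simp: enc_def fun_eq_iff restrict_def)
      \<comment> \<open>Subsets of \<open>H\<close> are grouped by their trace on \<open>J\<close>,
        the only part that \<open>enc J\<close> sees.\<close>
      have "(\<Sum>T\<in>{T \<in> Pow H. enc J T \<in> X}. ennreal (\<rho> H T)) =
        (\<Sum>S\<in>{S \<in> Pow J. enc J S \<in> X}. \<Sum>T\<in>{T \<in> {T \<in> Pow H. enc J T \<in> X}. T \<inter> J = S}. ennreal (\<rho> H T))"
        using that finJ encI by (intro sum.group[symmetric]) auto
      also have "\<dots> = (\<Sum>S\<in>{S \<in> Pow J. enc J S \<in> X}. ennreal (\<rho> J S))"
      proof (rule sum.cong[OF refl])
        fix S assume S: "S \<in> {S \<in> Pow J. enc J S \<in> X}"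
        then have "{T \<in> {T \<in> Pow H. enc J T \<in> X}. T \<inter> J = S} = {T \<in> Pow H. T \<inter> J = S}"
          using encI by auto
        moreover have "(\<Sum>T\<in>{T \<in> Pow H. T \<inter> J = S}. ennreal (\<rho> H T)) = ennreal (\<rho> J S)"
          using consistent[OF that, of S] S nonneg[OF that(2,3)] by (subst sum_ennreal) auto
        ultimately show "(\<Sum>T\<in>{T \<in> {T \<in> Pow H. enc J T \<in> X}. T \<inter> J = S}. ennreal (\<rho> H T)) = ennreal (\<rho> J S)"
          by simp
      qed
      finally show "emeasure (distr (point_measure (Pow H) (\<lambda>S. ennreal (\<rho> H S))) (?B J) (enc J)) X = emeasure (P J) X"
        unfolding P_def using P_emeasure[OF that(2) X] P_emeasure[OF finJ X] by simp
    qed (simp add: P_def)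
    finally show ?thesis by simp
  qed
  have prob: "prob_space (P J)" if "finite J" "J \<subseteq> E" for J
  proof (rule prob_spaceI)
    have "(\<Sum>T\<in>Pow J. \<rho> J T) = 1"
      using consistent[of "{}" J "{}"] that total by (simp add: Pow_def)
    moreover have "(\<Sum>T\<in>Pow J. ennreal (\<rho> J T)) = ennreal (\<Sum>T\<in>Pow J. \<rho> J T)"
      using nonneg[OF that] by (intro sum_ennreal) auto
    moreover have "{T \<in> Pow J. enc J T \<in> space (?B J)} = Pow J" using enc_space by auto
    ultimately show "emeasure (P J) (space (P J)) = 1"
      unfolding P_def using P_emeasure[OF that(1), of "space (?B J)" J] by simp
  qed
  interpret polish_projective E P
    by (intro polish_projective.intro projective_family.intro) (fact proj, fact prob)
  have sets_lim: "sets lim = sets (?B E)" by simp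
  define dec where "dec = (\<lambda>\<omega>::'e \<Rightarrow> real. \<lambda>e\<in>E. \<omega> e > 1/2)"
  have dec: "dec \<in> lim \<rightarrow>\<^sub>M config_space E"
    unfolding dec_def measurable_cong_sets[OF sets_lim refl]
  proof (rule measurable_restrict)
    fix e assume "e \<in> E"
    then have [measurable]: "(\<lambda>\<omega>::'e \<Rightarrow> real. \<omega> e) \<in> borel_measurable (?B E)"
      by (rule measurable_component_singleton)
    show "(\<lambda>\<omega>. 1 / 2 < \<omega> e) \<in> ?B E \<rightarrow>\<^sub>M count_space UNIV" by measurable
  qed
  define \<phi> where "\<phi> = distr lim (config_space E) dec"
  show ?thesis
  proof (rule that[of \<phi>])
    show "prob_space \<phi>" unfolding \<phi>_def by (rule P.prob_space_distr[OF dec])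
    show "sets \<phi> = sets (config_space E)" by (simp add: \<phi>_def)
    fix J S assume J: "finite J" "J \<subseteq> E" "S \<subseteq> J"
    define X where "X = {\<omega> \<in> space (?B J). \<forall>e\<in>J. (\<omega> e > 1/2) = (e \<in> S)}"
    have X: "X \<in> sets (?B J)"
      unfolding X_def
    proof (rule sets.sets_Collect_finite_All)
      fix e assume "e \<in> J"
      then have [measurable]: "(\<lambda>\<omega>::'e \<Rightarrow> real. \<omega> e) \<in> borel_measurable (?B J)"
        by (rule measurable_component_singleton)
      show "{\<omega> \<in> space (?B J). (\<omega> e > 1/2) = (e \<in> S)} \<in> sets (?B J)" by measurable
    qed (rule J)
    have "dec -` cylinder E J S \<inter> space lim = emb E J X"
      using J sets_eq_imp_space_eq[OF sets_lim]
      by (auto simp: dec_def cylinder_def X_def prod_emb_def space_PiM subset_iff)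
    then have "emeasure \<phi> (cylinder E J S) = emeasure (P J) X"
      unfolding \<phi>_def using J X by (simp add: emeasure_distr[OF dec] sets_cylinder emeasure_lim_emb)
    also have "\<dots> = (\<Sum>T\<in>{T \<in> Pow J. enc J T \<in> X}. ennreal (\<rho> J T))"
      unfolding P_def by (rule P_emeasure[OF J(1) X])
    also have "{T \<in> Pow J. enc J T \<in> X} = {S}"
      using J by (auto simp: X_def enc_def space_PiM)
    finally show "measure \<phi> (cylinder E J S) = \<rho> J S"
      using nonneg[OF J] by (simp add: measure_def)
  qed
qed

section \<open>Finite random cluster measures as finite sums\<close>

context rc_graph begin

lemma configs_agreeing_off_eq:
  assumes "\<xi> \<in> configs E" "F \<subseteq> E"
  shows "configs_agreeing_off E \<xi> F = patch \<xi> F ` Pow F"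
proof (intro equalityI subsetI)
  fix \<omega> assume \<omega>: "\<omega> \<in> configs_agreeing_off E \<xi> F"
  have "\<omega> = patch \<xi> F {e \<in> F. \<omega> e}"
  proof
    fix e
    show "\<omega> e = patch \<xi> F {e \<in> F. \<omega> e} e"
      using \<omega> assms by (cases "e \<in> E") (auto simp: configs_agreeing_off_def patch_def PiE_iff extensional_def)
  qed
  then show "\<omega> \<in> patch \<xi> F ` Pow F" by blast
next
  fix \<omega> assume "\<omega> \<in> patch \<xi> F ` Pow F"
  then obtain S where S: "\<omega> = patch \<xi> F S" by blast
  have "\<omega> \<in> configs E" unfolding S using assms by (rule patch_in_configs)
  then show "\<omega> \<in> configs_agreeing_off E \<xi> F"
    by (simp add: configs_agreeing_off_def S patch_def)
qed

lemma inj_on_patch: "inj_on (patch \<xi> F) (Pow F)"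
  by (rule inj_on_inverseI[where g = "\<lambda>\<omega>. {e \<in> F. \<omega> e}"]) (auto simp: patch_def)

lemma integral_finite_random_cluster:
  assumes \<xi>: "\<xi> \<in> configs E" and F: "finite F" "F \<subseteq> E" and f: "f \<in> borel_measurable (config_space E)"
  shows "(\<integral>\<omega>. f \<omega> \<partial>finite_random_cluster V E ends p q \<xi> F) = gibbs_expect F \<xi> f"
proof -
  let ?\<Omega> = "configs_agreeing_off E \<xi> F" and ?W = "rc_weight V E ends p q F"
  define Z where "Z = (\<Sum>\<omega>\<in>?\<Omega>. ?W \<omega>)"
  have eq: "?\<Omega> = patch \<xi> F ` Pow F" by (rule configs_agreeing_off_eq[OF \<xi> F(2)])
  have Z: "Z = (\<Sum>S\<in>Pow F. ?W (patch \<xi> F S))"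
    unfolding Z_def eq by (simp add: sum.reindex[OF inj_on_patch])
  have Z0: "0 < Z" unfolding Z by (rule rc_weight_sum_pos[OF F])
  have "(\<lambda>\<omega>. \<omega>) \<in> point_measure ?\<Omega> (\<lambda>\<omega>. ennreal (?W \<omega> / Z)) \<rightarrow>\<^sub>M config_space E"
    by (auto simp: measurable_point_measure_eq1 configs_agreeing_off_def)
  then have "(\<integral>\<omega>. f \<omega> \<partial>finite_random_cluster V E ends p q \<xi> F) =
      (\<integral>\<omega>. f \<omega> \<partial>point_measure ?\<Omega> (\<lambda>\<omega>. ennreal (?W \<omega> / Z)))"
    unfolding finite_random_cluster_def Let_def Z_def using f by (subst integral_distr) auto
  also have "\<dots> = (\<Sum>\<omega>\<in>?\<Omega>. ?W \<omega> / Z * f \<omega>)"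
    using F rc_weight_nonneg[OF F(2)] Z0
    by (subst lebesgue_integral_point_measure_finite) (auto simp: eq intro!: divide_nonneg_pos)
  also have "\<dots> = gibbs_expect F \<xi> f"
    unfolding eq gibbs_expect_def gibbs_prob_def Z by (simp add: sum.reindex[OF inj_on_patch])
  finally show ?thesis .
qed

end

section \<open>The sigma-algebra generated by the other edges\<close>

lemma space_sigma_off [simp]: "space (sigma_off E e) = configs E"
  unfolding sigma_off_def by (rule space_measure_of) auto

lemma sets_sigma_off:
  "sets (sigma_off E e) = sigma_sets (configs E)
     {{\<omega> \<in> configs E. \<forall>f\<in>F. \<omega> f = \<eta> f} | F \<eta>. finite F \<and> F \<subseteq> E - {e}}"
  unfolding sigma_off_def by (rule sets_measure_of) auto

lemma sigma_off_generator_eq_cylinder: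
  "{\<omega> \<in> configs E. \<forall>f\<in>F. \<omega> f = \<eta> f} = cylinder E F {f \<in> F. \<eta> f}"
  by (auto simp: cylinder_def)

lemma sets_sigma_off_subset: "sets (sigma_off E e) \<subseteq> sets (config_space E)"
proof -
  have "{{\<omega> \<in> configs E. \<forall>f\<in>F. \<omega> f = \<eta> f} | F \<eta>. finite F \<and> F \<subseteq> E - {e}} \<subseteq> sets (config_space E)"
    unfolding sigma_off_generator_eq_cylinder using sets_cylinder[of _ E] by blast
  from sets.sigma_sets_subset[OF this] show ?thesis by (simp add: sets_sigma_off)
qed

lemma measurable_fun_upd_sigma_off:
  assumes "e \<in> E" shows "(\<lambda>\<omega>. fun_upd \<omega> e i) \<in> sigma_off E e \<rightarrow>\<^sub>M config_space E"
proof -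
  have "(\<lambda>\<omega> f. fun_upd \<omega> e i f) \<in> sigma_off E e \<rightarrow>\<^sub>M config_space E"
  proof (rule measurable_PiM_single')
    fix f assume f: "f \<in> E"
    show "(\<lambda>\<omega>. fun_upd \<omega> e i f) \<in> sigma_off E e \<rightarrow>\<^sub>M count_space UNIV"
    proof (cases "f = e")
      case False
      have "{\<omega> \<in> configs E. \<forall>f\<in>{f}. \<omega> f = (\<lambda>_. True) f} \<in> sets (sigma_off E e)"
        unfolding sets_sigma_off using f False
        by (intro sigma_sets.Basic CollectI exI[of _ "{f}"] exI[of _ "\<lambda>_. True"]) auto
      then have "Measurable.pred (sigma_off E e) (\<lambda>\<omega>. \<omega> f)" by (simp add: pred_def)
      with False show ?thesis by simp
    qed simp
  qed (use assms in \<open>auto simp: PiE_iff extensional_def\<close>)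
  then show ?thesis .
qed

text \<open>A function that ignores the state of \<open>e\<close> equals its composition with
  opening \<open>e\<close>, and that map is measurable from the smaller sigma-algebra.\<close>

lemma measurable_sigma_off_if_invariant:
  assumes "e \<in> E" and g: "g \<in> borel_measurable (config_space E)"
    and inv: "\<And>\<omega>. \<omega> \<in> configs E \<Longrightarrow> g (fun_upd \<omega> e True) = (g \<omega> :: real)"
  shows "g \<in> borel_measurable (sigma_off E e)"
  by (subst measurable_cong[where g = "\<lambda>\<omega>. g (fun_upd \<omega> e True)"])
    (auto simp: inv intro: measurable_compose[OF measurable_fun_upd_sigma_off[OF assms(1)] g])

definition bounded_measurable :: "'e set \<Rightarrow> (('e \<Rightarrow> bool) \<Rightarrow> real) \<Rightarrow> bool" where
  "bounded_measurable E g \<longleftrightarrow> g \<in> borel_measurable (config_space E) \<and> (\<exists>B. \<forall>\<omega>\<in>configs E. \<bar>g \<omega>\<bar> \<le> B)"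

definition invariant_on :: "'e set \<Rightarrow> 'e set \<Rightarrow> (('e \<Rightarrow> bool) \<Rightarrow> real) \<Rightarrow> bool" where
  "invariant_on E F g \<longleftrightarrow> (\<forall>\<omega>\<in>configs E. \<forall>\<eta>\<in>configs E. agree_on (E - F) \<omega> \<eta> \<longrightarrow> g \<omega> = g \<eta>)"

lemma invariant_onD:
  "invariant_on E F g \<Longrightarrow> \<omega> \<in> configs E \<Longrightarrow> \<eta> \<in> configs E \<Longrightarrow> agree_on (E - F) \<omega> \<eta> \<Longrightarrow> g \<omega> = g \<eta>"
  by (simp add: invariant_on_def)

lemma bounded_measurable_mult:
  assumes "bounded_measurable E f" "bounded_measurable E g"
  shows "bounded_measurable E (\<lambda>\<omega>. f \<omega> * g \<omega>)"
proof -
  obtain A B where "\<forall>\<omega>\<in>configs E. \<bar>f \<omega>\<bar> \<le> A" "\<forall>\<omega>\<in>configs E. \<bar>g \<omega>\<bar> \<le> B"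
    using assms by (auto simp: bounded_measurable_def)
  then have "\<forall>\<omega>\<in>configs E. \<bar>f \<omega> * g \<omega>\<bar> \<le> \<bar>A\<bar> * \<bar>B\<bar>"
    unfolding abs_mult by (intro ballI mult_mono) force+
  then show ?thesis using assms by (auto simp: bounded_measurable_def intro: borel_measurable_times)
qed

lemma bounded_measurable_diff:
  assumes "bounded_measurable E f" "bounded_measurable E g"
  shows "bounded_measurable E (\<lambda>\<omega>. f \<omega> - g \<omega>)"
proof -
  obtain A B where AB: "\<forall>\<omega>\<in>configs E. \<bar>f \<omega>\<bar> \<le> A" "\<forall>\<omega>\<in>configs E. \<bar>g \<omega>\<bar> \<le> B"
    using assms by (auto simp: bounded_measurable_def)
  have "\<forall>\<omega>\<in>configs E. \<bar>f \<omega> - g \<omega>\<bar> \<le> A + B"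
    using AB by (intro ballI order_trans[OF abs_triangle_ineq4] add_mono) auto
  then show ?thesis using assms by (auto simp: bounded_measurable_def intro: borel_measurable_diff)
qed

lemma bounded_measurable_const: "bounded_measurable E (\<lambda>_. c)"
  by (auto simp: bounded_measurable_def)

lemma bounded_measurable_indicator: "A \<in> sets (config_space E) \<Longrightarrow> bounded_measurable E (indicator A)"
  by (auto simp: bounded_measurable_def indicator_def intro!: exI[of _ 1])

lemma bounded_measurable_integrable:
  assumes "finite_measure M" "sets M = sets (config_space E)" "bounded_measurable E g"
  shows "integrable M g"
proof -
  interpret finite_measure M by fact
  obtain B where "\<forall>\<omega>\<in>configs E. \<bar>g \<omega>\<bar> \<le> B" using assms by (auto simp: bounded_measurable_def)
  moreover have "space M = configs E" using sets_eq_imp_space_eq[OF assms(2)] by simp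
  moreover have "g \<in> borel_measurable M"
    using assms by (simp add: bounded_measurable_def measurable_cong_sets[OF assms(2) refl])
  ultimately show ?thesis by (intro integrable_const_bound[of _ B]) auto
qed

lemma measurable_patch:
  assumes "F \<subseteq> E" shows "(\<lambda>\<omega>. patch \<omega> F S) \<in> config_space E \<rightarrow>\<^sub>M config_space E"
proof -
  have "(\<lambda>\<omega> f. patch \<omega> F S f) \<in> config_space E \<rightarrow>\<^sub>M config_space E"
  proof (rule measurable_PiM_single')
    fix f assume f: "f \<in> E"
    then show "(\<lambda>\<omega>. patch \<omega> F S f) \<in> config_space E \<rightarrow>\<^sub>M count_space UNIV"
      using measurable_coordinate[OF f] by (cases "f \<in> F") (auto simp: patch_def)
  qed (use assms in \<open>auto simp: patch_def PiE_iff extensional_def\<close>)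
  then show ?thesis .
qed

context rc_graph begin

lemma bounded_measurable_patch:
  assumes "F \<subseteq> E" "bounded_measurable E g"
  shows "bounded_measurable E (\<lambda>\<omega>. g (patch \<omega> F S))"
proof -
  obtain B where B: "g \<in> borel_measurable (config_space E)" "\<forall>\<omega>\<in>configs E. \<bar>g \<omega>\<bar> \<le> B"
    using assms(2) by (auto simp: bounded_measurable_def)
  have "\<forall>\<omega>\<in>configs E. \<bar>g (patch \<omega> F S)\<bar> \<le> B"
    by (intro ballI B(2)[rule_format] patch_in_configs assms(1))
  then show ?thesis
    using measurable_compose[OF measurable_patch[OF assms(1)] B(1)] unfolding bounded_measurable_def by blast
qed

lemma invariant_on_patch:
  assumes "F \<subseteq> E" shows "invariant_on E F (\<lambda>\<omega>. g (patch \<omega> F S))"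
  unfolding invariant_on_def
proof (intro ballI impI)
  fix \<omega> \<eta> assume "\<omega> \<in> configs E" "\<eta> \<in> configs E" and eq: "agree_on (E - F) \<omega> \<eta>"
  then have "patch \<omega> F S = patch \<eta> F S"
    by (auto simp: patch_def agree_on_def fun_eq_iff PiE_iff extensional_def)
  then show "g (patch \<omega> F S) = g (patch \<eta> F S)" by simp
qed

text \<open>A connection off \<open>e\<close> is witnessed by a finite set of open edges, and the
  countable set \<open>E\<close> has only countably many finite subsets.\<close>

lemma sets_ends_joined_off:
  assumes "e \<in> E" shows "ends_joined_off E ends e \<in> sets (config_space E)"
proof -
  let ?\<S> = "{S. S \<subseteq> E \<and> finite S}"
  let ?good = "\<lambda>S. S \<subseteq> E - {e} \<and> (\<exists>u v. ends e = {u, v} \<and> joined_by ends S u v)"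
  have "ends_joined_off E ends e = (\<Union>S\<in>{S \<in> ?\<S>. ?good S}. cylinder E S S)"
  proof (intro equalityI subsetI)
    fix \<omega> assume "\<omega> \<in> ends_joined_off E ends e"
    then obtain u v where uv: "\<omega> \<in> configs E" "ends e = {u, v}" "joined_by ends (open_edges E \<omega> - {e}) u v"
      by (auto simp: ends_joined_off_def)
    obtain S where S: "finite S" "S \<subseteq> open_edges E \<omega> - {e}" "joined_by ends S u v"
      by (rule joined_by_finite_subset[OF uv(3)])
    then have "S \<in> {S \<in> ?\<S>. ?good S}" "\<omega> \<in> cylinder E S S"
      using uv by (auto simp: open_edges_def cylinder_def)
    then show "\<omega> \<in> (\<Union>S\<in>{S \<in> ?\<S>. ?good S}. cylinder E S S)" by blast
  next
    fix \<omega> assume "\<omega> \<in> (\<Union>S\<in>{S \<in> ?\<S>. ?good S}. cylinder E S S)"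
    then obtain S u v where S: "finite S" "S \<subseteq> E - {e}" "ends e = {u, v}" "joined_by ends S u v" "\<omega> \<in> cylinder E S S"
      by blast
    then have "joined_by ends (open_edges E \<omega> - {e}) u v"
      by (intro joined_by_mono[OF S(4)]) (auto simp: open_edges_def cylinder_def)
    then show "\<omega> \<in> ends_joined_off E ends e"
      using S by (auto simp: ends_joined_off_def cylinder_def)
  qed
  also have "\<dots> \<in> sets (config_space E)"
  proof (rule sets.countable_UN')
    have "countable ?\<S>" using countable_Collect_finite_subset[OF countable_E] by (simp add: conj_commute)
    then show "countable {S \<in> ?\<S>. ?good S}" by (rule countable_subset[rotated]) auto
  qed (auto intro: sets_cylinder)
  finally show ?thesis .
qed

lemma bounded_measurable_cond_prob:
  assumes "e \<in> E" shows "bounded_measurable E (cond_prob e)"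
proof -
  have "cond_prob e \<in> borel_measurable (config_space E)"
    unfolding cond_prob_def using sets_ends_joined_off[OF assms] sets.top[of "config_space E", unfolded space_config]
    by (intro measurable_If_set) auto
  moreover have "\<forall>\<omega>\<in>configs E. \<bar>cond_prob e \<omega>\<bar> \<le> 1"
    using cond_prob_bounds[OF assms] by (auto simp: abs_le_iff less_imp_le intro: order_trans[of _ 0])
  ultimately show ?thesis by (auto simp: bounded_measurable_def)
qed

section \<open>The DLR equations in integrated form\<close>

lemma sets_edge_open: "e \<in> E \<Longrightarrow> edge_open E e \<in> sets (config_space E)"
  using sets_cylinder[of "{e}" E "{e}"] by (simp add: edge_open_def cylinder_def)

lemma DLR_integral:
  assumes \<phi>: "\<phi> \<in> DLR_random_cluster E ends p q" and e: "e \<in> E"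
    and g: "bounded_measurable E g" "invariant_on E {e} g"
  shows "(\<integral>\<omega>. g \<omega> * indicator (edge_open E e) \<omega> \<partial>\<phi>) = (\<integral>\<omega>. g \<omega> * cond_prob e \<omega> \<partial>\<phi>)"
proof -
  have prob: "prob_space \<phi>" and sets: "sets \<phi> = sets (config_space E)"
    and AE: "AE \<omega> in \<phi>. real_cond_exp \<phi> (sigma_off E e) (indicator (edge_open E e)) \<omega> = cond_prob e \<omega>"
    using \<phi> e by (auto simp: DLR_random_cluster_def cond_prob_def)
  interpret prob_space \<phi> by (rule prob)
  have space: "space \<phi> = configs E" using sets_eq_imp_space_eq[OF sets] by simp
  interpret finite_measure_subalgebra \<phi> "sigma_off E e"
    by unfold_locales (auto simp: subalgebra_def space sets sets_sigma_off_subset)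
  have inv: "g (fun_upd \<omega> e True) = g \<omega>" if "\<omega> \<in> configs E" for \<omega>
    using that e by (intro invariant_onD[OF g(2)]) (auto simp: agree_on_def PiE_iff extensional_def)
  have gm: "g \<in> borel_measurable (sigma_off E e)"
    using g(1) by (intro measurable_sigma_off_if_invariant e inv) (auto simp: bounded_measurable_def)
  have Lm: "edge_open E e \<in> sets \<phi>" using sets sets_edge_open[OF e] by simp
  have int: "integrable \<phi> (\<lambda>\<omega>. g \<omega> * indicator (edge_open E e) \<omega>)"
    by (rule bounded_measurable_integrable[OF finite_measure_axioms sets])
      (intro bounded_measurable_mult g bounded_measurable_indicator sets_edge_open e)
  have "(\<integral>\<omega>. g \<omega> * indicator (edge_open E e) \<omega> \<partial>\<phi>) =
      (\<integral>\<omega>. g \<omega> * real_cond_exp \<phi> (sigma_off E e) (indicator (edge_open E e)) \<omega> \<partial>\<phi>)"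
    by (rule real_cond_exp_intg(2)[symmetric, OF int gm]) (use Lm in simp)
  also have "\<dots> = (\<integral>\<omega>. g \<omega> * cond_prob e \<omega> \<partial>\<phi>)"
  proof (rule integral_cong_AE)
    have "g \<in> borel_measurable \<phi>" using g sets
      by (simp add: bounded_measurable_def measurable_cong_sets[OF sets refl])
    moreover have "cond_prob e \<in> borel_measurable \<phi>" using bounded_measurable_cond_prob[OF e] sets
      by (simp add: bounded_measurable_def measurable_cong_sets[OF sets refl])
    ultimately show "(\<lambda>\<omega>. g \<omega> * cond_prob e \<omega>) \<in> borel_measurable \<phi>"
      "(\<lambda>\<omega>. g \<omega> * real_cond_exp \<phi> (sigma_off E e) (indicator (edge_open E e)) \<omega>) \<in> borel_measurable \<phi>"
      by auto
    show "AE \<omega> in \<phi>. g \<omega> * real_cond_exp \<phi> (sigma_off E e) (indicator (edge_open E e)) \<omega> = g \<omega> * cond_prob e \<omega>"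
      using AE by eventually_elim simp
  qed
  finally show ?thesis .
qed

text \<open>Tested against functions of the other edges, the DLR equation at \<open>e\<close> says
  that the mass with \<open>e\<close> closed is a density times the mass with \<open>e\<close> open.
  Closed edges are opened one by one until \<open>F\<close> is fully open; \<open>r\<close> is the
  product of the odds met on the way.\<close>

lemma DLR_density_ratio:
  assumes \<phi>: "\<phi> \<in> DLR_random_cluster E ends p q" and F: "finite F" "F \<subseteq> E" and S: "S \<subseteq> F"
  shows "\<exists>r. bounded_measurable E r \<and> invariant_on E F r \<and>
    (\<forall>\<omega>\<in>configs E. gibbs_prob F \<omega> S = r \<omega> * gibbs_prob F \<omega> F) \<and>
    (\<forall>g. bounded_measurable E g \<longrightarrow> invariant_on E F g \<longrightarrow>
      (\<integral>\<omega>. g \<omega> * indicator (cylinder E F S) \<omega> \<partial>\<phi>) =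
      (\<integral>\<omega>. g \<omega> * r \<omega> * indicator (cylinder E F F) \<omega> \<partial>\<phi>))"
  using S
proof (induction "card (F - S)" arbitrary: S)
  case 0
  then have "F - S = {}" using F by (metis card_eq_0_iff finite_Diff)
  then have "S = F" using 0 by auto
  then show ?case
    by (intro exI[of _ "\<lambda>_. 1"]) (auto simp: bounded_measurable_const invariant_on_def)
next
  case (Suc n)
  then obtain e where e: "e \<in> F - S" by (metis card.empty ex_in_conv nat.simps(3))
  then have eE: "e \<in> E" and eF: "e \<in> F" using F by auto
  have "F - insert e S = (F - S) - {e}" by auto
  then have "n = card (F - insert e S)" using Suc e F by (simp add: card_Diff_singleton)
  from Suc.hyps(1)[OF this] obtain r' where r': "bounded_measurable E r'" "invariant_on E F r'"
    "\<And>\<omega>. \<omega> \<in> configs E \<Longrightarrow> gibbs_prob F \<omega> (insert e S) = r' \<omega> * gibbs_prob F \<omega> F"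
    "\<And>g. bounded_measurable E g \<Longrightarrow> invariant_on E F g \<Longrightarrow>
      (\<integral>\<omega>. g \<omega> * indicator (cylinder E F (insert e S)) \<omega> \<partial>\<phi>) =
      (\<integral>\<omega>. g \<omega> * r' \<omega> * indicator (cylinder E F F) \<omega> \<partial>\<phi>)"
    using Suc.prems eF by auto
  have prob: "prob_space \<phi>" and sets: "sets \<phi> = sets (config_space E)"
    using \<phi> by (auto simp: DLR_random_cluster_def)
  interpret prob_space \<phi> by (rule prob)
  have space: "space \<phi> = configs E" using sets_eq_imp_space_eq[OF sets] by simp
  define c where "c \<omega> = cond_prob e (patch \<omega> F S)" for \<omega>
  \<comment> \<open>The odds of \<open>e\<close> being closed; they are bounded because
    \<open>c\<close> is at least the positive number \<open>p_hat p q e\<close>.\<close>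
  define h where "h \<omega> = (1 - c \<omega>) / c \<omega>" for \<omega>
  have c0: "p_hat p q e \<le> c \<omega>" "c \<omega> \<le> 1" "0 < c \<omega>" for \<omega>
    unfolding c_def by (rule cond_prob_bounds[OF eE])+
  have cb: "bounded_measurable E c" unfolding c_def
    by (rule bounded_measurable_patch[OF F(2) bounded_measurable_cond_prob[OF eE]])
  have ci: "invariant_on E F c" unfolding c_def by (rule invariant_on_patch[OF F(2)])
  have hb: "bounded_measurable E h"
  proof -
    have "h \<in> borel_measurable (config_space E)" using cb unfolding h_def
      by (auto simp: bounded_measurable_def)
    moreover have "\<bar>h \<omega>\<bar> \<le> 1 / p_hat p q e" for \<omega>
      unfolding h_def using c0[of \<omega>] p_hat_pos[OF eE] by (auto intro!: frac_le simp: abs_mult)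
    ultimately show ?thesis by (auto simp: bounded_measurable_def)
  qed
  have hi: "invariant_on E F h" using ci unfolding invariant_on_def h_def by metis
  \<comment> \<open>On this cylinder the states in \<open>F - {e}\<close> are prescribed, so the
    conditional probability becomes a function of the edges outside \<open>F\<close>.\<close>
  have cond_c: "cond_prob e \<omega> = c \<omega>" if "\<omega> \<in> cylinder E (F - {e}) S" for \<omega>
    unfolding c_def using that e patch_in_configs[OF _ F(2)]
    by (intro cond_prob_agree) (auto simp: cylinder_def agree_on_def patch_def)
  have cylS: "indicator (cylinder E F S) \<omega> =
      indicator (cylinder E (F - {e}) S) \<omega> - (indicator (cylinder E (F - {e}) S) \<omega> * indicator (edge_open E e) \<omega> :: real)"
    and cylS': "indicator (cylinder E F (insert e S)) \<omega> =
      (indicator (cylinder E (F - {e}) S) \<omega> * indicator (edge_open E e) \<omega> :: real)" for \<omega>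
    using e by (auto simp: cylinder_def edge_open_def indicator_def)
  have Fe: "finite (F - {e})" "F - {e} \<subseteq> E" using F by auto
  have "(\<integral>\<omega>. g \<omega> * indicator (cylinder E F S) \<omega> \<partial>\<phi>) =
      (\<integral>\<omega>. g \<omega> * (h \<omega> * r' \<omega>) * indicator (cylinder E F F) \<omega> \<partial>\<phi>)"
    if g: "bounded_measurable E g" "invariant_on E F g" for g
  proof -
    define k where "k \<omega> = g \<omega> * indicator (cylinder E (F - {e}) S) \<omega>" for \<omega>
    have kb: "bounded_measurable E k" unfolding k_def
      by (intro bounded_measurable_mult g bounded_measurable_indicator sets_cylinder Fe)
    have inv_e: "invariant_on E {e} (\<lambda>\<omega>. G \<omega> * indicator (cylinder E (F - {e}) S) \<omega>)"
      if "invariant_on E F G" for G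
      unfolding invariant_on_def
    proof (intro ballI impI)
      fix \<omega> \<eta> assume \<omega>: "\<omega> \<in> configs E" "\<eta> \<in> configs E" "agree_on (E - {e}) \<omega> \<eta>"
      have "G \<omega> = G \<eta>" by (rule invariant_onD[OF that \<omega>(1,2)]) (use \<omega>(3) eF in \<open>auto simp: agree_on_def\<close>)
      moreover have "\<omega> \<in> cylinder E (F - {e}) S \<longleftrightarrow> \<eta> \<in> cylinder E (F - {e}) S"
      proof -
        have "\<omega> f = \<eta> f" if "f \<in> F - {e}" for f
          using \<omega>(3) that F by (auto simp: agree_on_def)
        then show ?thesis using \<omega> by (auto simp: cylinder_def)
      qed
      ultimately show "G \<omega> * indicator (cylinder E (F - {e}) S) \<omega> = G \<eta> * indicator (cylinder E (F - {e}) S) \<eta>"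
        by (simp add: indicator_def)
    qed
    have ki: "invariant_on E {e} k" unfolding k_def by (rule inv_e[OF g(2)])
    have ghi: "invariant_on E F (\<lambda>\<omega>. g \<omega> * h \<omega>)"
      using g(2) hi unfolding invariant_on_def by metis
    have khi: "invariant_on E {e} (\<lambda>\<omega>. k \<omega> * h \<omega>)"
      using inv_e[OF ghi] unfolding k_def by (simp add: ac_simps)
    have khb: "bounded_measurable E (\<lambda>\<omega>. k \<omega> * h \<omega>)" by (intro bounded_measurable_mult kb hb)
    have int: "integrable \<phi> f" if "bounded_measurable E f" for f
      by (rule bounded_measurable_integrable[OF finite_measure_axioms sets that])
    have Lb: "bounded_measurable E (indicator (edge_open E e))"
      by (intro bounded_measurable_indicator sets_edge_open eE)
    have "(\<integral>\<omega>. g \<omega> * indicator (cylinder E F S) \<omega> \<partial>\<phi>) = (\<integral>\<omega>. k \<omega> - k \<omega> * indicator (edge_open E e) \<omega> \<partial>\<phi>)"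
      unfolding k_def cylS by (simp add: algebra_simps)
    also have "\<dots> = (\<integral>\<omega>. k \<omega> \<partial>\<phi>) - (\<integral>\<omega>. k \<omega> * indicator (edge_open E e) \<omega> \<partial>\<phi>)"
      by (intro Bochner_Integration.integral_diff int bounded_measurable_mult kb Lb)
    also have "(\<integral>\<omega>. k \<omega> * indicator (edge_open E e) \<omega> \<partial>\<phi>) = (\<integral>\<omega>. k \<omega> * cond_prob e \<omega> \<partial>\<phi>)"
      by (rule DLR_integral[OF \<phi> eE kb ki])
    also have "(\<integral>\<omega>. k \<omega> \<partial>\<phi>) - (\<integral>\<omega>. k \<omega> * cond_prob e \<omega> \<partial>\<phi>) = (\<integral>\<omega>. k \<omega> - k \<omega> * cond_prob e \<omega> \<partial>\<phi>)"
      by (intro Bochner_Integration.integral_diff[symmetric] int bounded_measurable_mult kb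
          bounded_measurable_cond_prob eE)
    \<comment> \<open>By the definition of \<open>h\<close>, \<open>1 - c = h * c\<close>, and
      \<open>c\<close> is the conditional probability wherever \<open>k\<close> is nonzero. The DLR
      equation is then used backwards.\<close>
    also have "\<dots> = (\<integral>\<omega>. k \<omega> * h \<omega> * cond_prob e \<omega> \<partial>\<phi>)"
    proof (rule Bochner_Integration.integral_cong[OF refl])
      fix \<omega>
      show "k \<omega> - k \<omega> * cond_prob e \<omega> = k \<omega> * h \<omega> * cond_prob e \<omega>"
      proof (cases "\<omega> \<in> cylinder E (F - {e}) S")
        case True
        then show ?thesis using cond_c[OF True] c0(3)[of \<omega>] by (simp add: h_def field_simps)
      qed (simp add: k_def)
    qed
    also have "\<dots> = (\<integral>\<omega>. k \<omega> * h \<omega> * indicator (edge_open E e) \<omega> \<partial>\<phi>)"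
      by (rule DLR_integral[symmetric, OF \<phi> eE khb khi])
    also have "\<dots> = (\<integral>\<omega>. g \<omega> * h \<omega> * indicator (cylinder E F (insert e S)) \<omega> \<partial>\<phi>)"
      unfolding k_def cylS' by (simp add: ac_simps)
    also have "\<dots> = (\<integral>\<omega>. g \<omega> * h \<omega> * r' \<omega> * indicator (cylinder E F F) \<omega> \<partial>\<phi>)"
      by (intro r'(4) bounded_measurable_mult g hb ghi)
    finally show ?thesis by (simp add: ac_simps)
  qed
  moreover have "gibbs_prob F \<omega> S = h \<omega> * r' \<omega> * gibbs_prob F \<omega> F" if \<omega>: "\<omega> \<in> configs E" for \<omega>
  proof -
    have "c \<omega> * gibbs_prob F \<omega> S = (1 - c \<omega>) * gibbs_prob F \<omega> (insert e S)"
      unfolding c_def using e Suc.prems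
      by (intro gibbs_prob_balanced[OF \<omega> F, unfolded balanced_def, rule_format]) auto
    then show ?thesis using r'(3)[OF \<omega>] c0(3)[of \<omega>] by (simp add: h_def field_simps)
  qed
  moreover have "invariant_on E F (\<lambda>\<omega>. h \<omega> * r' \<omega>)"
    using hi r'(2) unfolding invariant_on_def by metis
  ultimately show ?case
    by (intro exI[of _ "\<lambda>\<omega>. h \<omega> * r' \<omega>"] conjI ballI allI impI bounded_measurable_mult hb r') auto
qed

text \<open>The density ratios yield the DLR equation for finite sets of edges: the integral of
  \<open>f\<close> is an average of finite volume expectations of \<open>f\<close> over boundary
  conditions, all of them close to \<open>c\<close>.\<close>

lemma DLR_integral_approx:
  assumes \<phi>: "\<phi> \<in> DLR_random_cluster E ends p q" and F: "finite F" "F \<subseteq> E"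
    and f: "bounded_measurable E f"
    and approx: "\<And>\<omega>. \<omega> \<in> configs E \<Longrightarrow> \<bar>gibbs_expect F \<omega> f - c\<bar> \<le> \<epsilon>"
  shows "\<bar>(\<integral>\<omega>. f \<omega> \<partial>\<phi>) - c\<bar> \<le> \<epsilon>"
proof -
  have prob: "prob_space \<phi>" and sets: "sets \<phi> = sets (config_space E)"
    using \<phi> by (auto simp: DLR_random_cluster_def)
  interpret prob_space \<phi> by (rule prob)
  have space: "space \<phi> = configs E" using sets_eq_imp_space_eq[OF sets] by simp
  have int: "integrable \<phi> f" if "bounded_measurable E f" for f
    by (rule bounded_measurable_integrable[OF finite_measure_axioms sets that])
  define Q where "Q S r \<longleftrightarrow> bounded_measurable E r \<and> invariant_on E F r \<and>
    (\<forall>\<omega>\<in>configs E. gibbs_prob F \<omega> S = r \<omega> * gibbs_prob F \<omega> F) \<and>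
    (\<forall>g. bounded_measurable E g \<longrightarrow> invariant_on E F g \<longrightarrow>
      (\<integral>\<omega>. g \<omega> * indicator (cylinder E F S) \<omega> \<partial>\<phi>) =
      (\<integral>\<omega>. g \<omega> * r \<omega> * indicator (cylinder E F F) \<omega> \<partial>\<phi>))" for S r
  have "\<forall>S\<in>Pow F. \<exists>r. Q S r"
    unfolding Q_def by (intro ballI DLR_density_ratio[OF \<phi> F]) simp
  from bchoice[OF this] obtain r where "\<forall>S\<in>Pow F. Q S (r S)" by (elim exE)
  then have Q: "Q S (r S)" if "S \<in> Pow F" for S using that by (rule bspec)
  have r: "\<And>S. S \<in> Pow F \<Longrightarrow> bounded_measurable E (r S)"
    "\<And>S \<omega>. S \<in> Pow F \<Longrightarrow> \<omega> \<in> configs E \<Longrightarrow> gibbs_prob F \<omega> S = r S \<omega> * gibbs_prob F \<omega> F"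
    "\<And>S g. S \<in> Pow F \<Longrightarrow> bounded_measurable E g \<Longrightarrow> invariant_on E F g \<Longrightarrow>
      (\<integral>\<omega>. g \<omega> * indicator (cylinder E F S) \<omega> \<partial>\<phi>) =
      (\<integral>\<omega>. g \<omega> * r S \<omega> * indicator (cylinder E F F) \<omega> \<partial>\<phi>)"
    using Q unfolding Q_def by (simp_all del: Pow_iff)
  let ?I = "indicator (cylinder E F F) :: ('e \<Rightarrow> bool) \<Rightarrow> real"
  have Ib: "bounded_measurable E (indicator (cylinder E F S))" for S
    by (intro bounded_measurable_indicator sets_cylinder F)
  \<comment> \<open>\<open>f\<close> is split according to the state of \<open>F\<close>, and each
    part is moved onto the cylinder on which \<open>F\<close> is fully open.\<close>
  have main: "(\<integral>\<omega>. f \<omega> \<partial>\<phi>) = (\<integral>\<omega>. (\<Sum>S\<in>Pow F. f (patch \<omega> F S) * r S \<omega> * ?I \<omega>) \<partial>\<phi>)"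
    if f: "bounded_measurable E f" for f
  proof -
    have "f \<omega> = (\<Sum>S\<in>Pow F. f (patch \<omega> F S) * indicator (cylinder E F S) \<omega>)" if "\<omega> \<in> configs E" for \<omega>
    proof -
      define S0 where "S0 = {e \<in> F. \<omega> e}"
      have "(\<Sum>S\<in>Pow F. f (patch \<omega> F S) * indicator (cylinder E F S) \<omega>) =
          (\<Sum>S\<in>{S0}. f (patch \<omega> F S) * indicator (cylinder E F S) \<omega>)"
        using F by (intro sum.mono_neutral_right) (auto simp: cylinder_def S0_def indicator_def)
      moreover have "patch \<omega> F S0 = \<omega>" by (auto simp: patch_def S0_def fun_eq_iff)
      moreover have "\<omega> \<in> cylinder E F S0" using that by (auto simp: cylinder_def S0_def)
      ultimately show ?thesis by simp
    qed
    then have "(\<integral>\<omega>. f \<omega> \<partial>\<phi>) = (\<integral>\<omega>. (\<Sum>S\<in>Pow F. f (patch \<omega> F S) * indicator (cylinder E F S) \<omega>) \<partial>\<phi>)"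
      using space by (intro Bochner_Integration.integral_cong refl) blast
    also have "\<dots> = (\<Sum>S\<in>Pow F. \<integral>\<omega>. f (patch \<omega> F S) * indicator (cylinder E F S) \<omega> \<partial>\<phi>)"
      by (intro Bochner_Integration.integral_sum int bounded_measurable_mult Ib
          bounded_measurable_patch F f)
    also have "\<dots> = (\<Sum>S\<in>Pow F. \<integral>\<omega>. f (patch \<omega> F S) * r S \<omega> * ?I \<omega> \<partial>\<phi>)"
      by (intro sum.cong refl r(3) bounded_measurable_patch F f invariant_on_patch)
    also have "\<dots> = (\<integral>\<omega>. (\<Sum>S\<in>Pow F. f (patch \<omega> F S) * r S \<omega> * ?I \<omega>) \<partial>\<phi>)"
      by (intro Bochner_Integration.integral_sum[symmetric] int bounded_measurable_mult Ib
          bounded_measurable_patch F f r)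
    finally show ?thesis .
  qed
  \<comment> \<open>As the finite volume probabilities sum to 1, \<open>Z\<close> is the reciprocal
    of \<open>gibbs_prob F \<omega> F\<close>.\<close>
  define Z where "Z \<omega> = (\<Sum>S\<in>Pow F. r S \<omega>)" for \<omega>
  have rZ: "r S \<omega> = Z \<omega> * gibbs_prob F \<omega> S" and Z0: "0 \<le> Z \<omega>" if "\<omega> \<in> configs E" "S \<in> Pow F" for S \<omega>
  proof -
    let ?g = "gibbs_prob F \<omega> F"
    have g: "0 < ?g" by (rule gibbs_prob_open_pos[OF F])
    have "(\<Sum>S\<in>Pow F. gibbs_prob F \<omega> S) = Z \<omega> * ?g"
      unfolding Z_def sum_distrib_right by (intro sum.cong refl r(2) that(1))
    then have 1: "Z \<omega> * ?g = 1" using gibbs_prob_sum[OF F] by simp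
    then have "0 < Z \<omega>" using g by (metis zero_less_mult_pos2 zero_less_one)
    then show "0 \<le> Z \<omega>" by simp
    have "Z \<omega> * gibbs_prob F \<omega> S = Z \<omega> * (r S \<omega> * ?g)" by (simp only: r(2)[OF that(2,1)])
    also have "\<dots> = r S \<omega> * (Z \<omega> * ?g)" by (simp only: ac_simps)
    finally show "r S \<omega> = Z \<omega> * gibbs_prob F \<omega> S" using 1 by simp
  qed
  have pt: "(\<Sum>S\<in>Pow F. f (patch \<omega> F S) * r S \<omega> * ?I \<omega>) = Z \<omega> * ?I \<omega> * gibbs_expect F \<omega> f"
    if "\<omega> \<in> configs E" for \<omega> f
    unfolding gibbs_expect_def sum_distrib_left using rZ[OF that] by (intro sum.cong) auto
  have fb: "bounded_measurable E (\<lambda>\<omega>. f \<omega> - c)" by (intro bounded_measurable_diff f bounded_measurable_const)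
  have ex: "gibbs_expect F \<omega> (\<lambda>\<omega>. f \<omega> - c) = gibbs_expect F \<omega> f - c" for \<omega>
    using gibbs_expect_const[OF F, of \<omega> c] unfolding gibbs_expect_def
    by (simp add: right_diff_distrib sum_subtractf)
  have ZIb: "integrable \<phi> (\<lambda>\<omega>. Z \<omega> * ?I \<omega>)"
  proof -
    have "integrable \<phi> (\<lambda>\<omega>. \<Sum>S\<in>Pow F. r S \<omega> * ?I \<omega>)"
      by (intro Bochner_Integration.integrable_sum int bounded_measurable_mult r Ib)
    then show ?thesis by (simp add: Z_def sum_distrib_right)
  qed
  \<comment> \<open>Taking the constant 1 for \<open>f\<close> shows that \<open>Z\<close> times the
    indicator is a probability density.\<close>
  have one: "(\<integral>\<omega>. Z \<omega> * ?I \<omega> \<partial>\<phi>) = 1"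
  proof -
    have "(\<integral>\<omega>. 1 \<partial>\<phi>) = (\<integral>\<omega>. (\<Sum>S\<in>Pow F. 1 * r S \<omega> * ?I \<omega>) \<partial>\<phi>)"
      by (rule main[OF bounded_measurable_const])
    then show ?thesis by (simp add: prob_space Z_def sum_distrib_right)
  qed
  have "\<bar>(\<integral>\<omega>. f \<omega> \<partial>\<phi>) - c\<bar> = \<bar>\<integral>\<omega>. f \<omega> - c \<partial>\<phi>\<bar>"
    using int[OF f] by (simp add: prob_space)
  also have "(\<integral>\<omega>. f \<omega> - c \<partial>\<phi>) = (\<integral>\<omega>. Z \<omega> * ?I \<omega> * (gibbs_expect F \<omega> f - c) \<partial>\<phi>)"
    unfolding main[OF fb] using pt[of _ "\<lambda>\<omega>. f \<omega> - c"] space ex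
    by (intro Bochner_Integration.integral_cong refl) simp
  also have "\<bar>\<dots>\<bar> \<le> (\<integral>\<omega>. \<epsilon> * (Z \<omega> * ?I \<omega>) \<partial>\<phi>)"
  proof (rule order_trans[OF integral_abs_bound integral_mono])
    have "integrable \<phi> (\<lambda>\<omega>. \<Sum>S\<in>Pow F. (f (patch \<omega> F S) - c) * r S \<omega> * ?I \<omega>)"
      by (intro Bochner_Integration.integrable_sum int bounded_measurable_mult r Ib
          bounded_measurable_patch[where g = "\<lambda>\<omega>. f \<omega> - c"] F fb)
    then have "integrable \<phi> (\<lambda>\<omega>. Z \<omega> * ?I \<omega> * (gibbs_expect F \<omega> f - c))"
      using pt[of _ "\<lambda>\<omega>. f \<omega> - c"] space ex
      by (subst Bochner_Integration.integrable_cong[OF refl,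
          where g = "\<lambda>\<omega>. \<Sum>S\<in>Pow F. (f (patch \<omega> F S) - c) * r S \<omega> * ?I \<omega>"]) auto
    then show "integrable \<phi> (\<lambda>\<omega>. \<bar>Z \<omega> * ?I \<omega> * (gibbs_expect F \<omega> f - c)\<bar>)" by (rule integrable_abs)
    show "integrable \<phi> (\<lambda>\<omega>. \<epsilon> * (Z \<omega> * ?I \<omega>))" using ZIb by simp
    fix \<omega> assume "\<omega> \<in> space \<phi>"
    then have \<omega>: "\<omega> \<in> configs E" using space by simp
    have "0 \<le> Z \<omega> * ?I \<omega>" using Z0[OF \<omega>, of F] by simp
    then show "\<bar>Z \<omega> * ?I \<omega> * (gibbs_expect F \<omega> f - c)\<bar> \<le> \<epsilon> * (Z \<omega> * ?I \<omega>)"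
      using mult_left_mono[OF approx[OF \<omega>], of "Z \<omega> * ?I \<omega>"] Z0[OF \<omega>, of F]
      by (simp add: abs_mult mult.commute)
  qed
  also have "\<dots> = \<epsilon>" using one by simp
  finally show ?thesis .
qed

end

section \<open>The limit measure\<close>

text \<open>The configuration space is compact by Tychonoff, so finitely many basic open sets on
  which \<open>f\<close> varies by less than \<epsilon> cover it; \<open>J\<close> collects the
  edges that they restrict.\<close>

lemma continuous_config_uniform:
  assumes f: "continuous_map (product_topology (\<lambda>_. discrete_topology UNIV) E) euclideanreal f"
    and \<epsilon>: "0 < \<epsilon>"
  obtains J where "finite J" "J \<subseteq> E"
    "\<And>\<omega> \<eta>. \<omega> \<in> configs E \<Longrightarrow> \<eta> \<in> configs E \<Longrightarrow> agree_on J \<omega> \<eta> \<Longrightarrow> \<bar>f \<omega> - f \<eta>\<bar> < \<epsilon>"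
proof -
  let ?T = "product_topology (\<lambda>_. discrete_topology (UNIV :: bool set)) E"
  have top: "topspace ?T = configs E" by simp
  have comp: "compact_space ?T"
    by (simp add: compact_space_product_topology compact_space_discrete_topology)
  define N where "N x U \<longleftrightarrow> finite {i \<in> E. U i \<noteq> (UNIV :: bool set)} \<and> x \<in> Pi\<^sub>E E U \<and> openin ?T (Pi\<^sub>E E U) \<and>
    (\<forall>y\<in>Pi\<^sub>E E U. \<bar>f y - f x\<bar> < \<epsilon> / 2)" for x and U :: "'a \<Rightarrow> bool set"
  have "\<exists>U. N x U" if x: "x \<in> configs E" for x
  proof -
    let ?O = "{y \<in> topspace ?T. f y \<in> ball (f x) (\<epsilon> / 2)}"
    have "openin ?T ?O" by (rule openin_continuous_map_preimage[OF f]) simp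
    moreover have "x \<in> ?O" using x \<epsilon> top by simp
    ultimately obtain U where U: "finite {i \<in> E. U i \<noteq> topspace (discrete_topology (UNIV :: bool set))}"
      "\<forall>i\<in>E. openin (discrete_topology (UNIV :: bool set)) (U i)" "x \<in> Pi\<^sub>E E U" "Pi\<^sub>E E U \<subseteq> ?O"
      unfolding openin_product_topology_alt by blast
    have "openin ?T (Pi\<^sub>E E U)"
      using U(1,2) by (simp add: openin_PiE_gen)
    moreover have "\<bar>f y - f x\<bar> < \<epsilon> / 2" if "y \<in> Pi\<^sub>E E U" for y
      using that U(4) by (auto simp: dist_real_def abs_minus_commute)
    ultimately show ?thesis using U unfolding N_def by auto
  qed
  then have "\<forall>x\<in>configs E. \<exists>U. N x U" by blast
  from bchoice[OF this] obtain U where U: "\<forall>x\<in>configs E. N x (U x)" by (elim exE)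
  have cover: "topspace ?T \<subseteq> \<Union>((\<lambda>x. Pi\<^sub>E E (U x)) ` configs E)"
  proof
    fix x assume "x \<in> topspace ?T"
    then have x: "x \<in> configs E" using top by simp
    then have "x \<in> Pi\<^sub>E E (U x)" using U unfolding N_def by blast
    then show "x \<in> \<Union>((\<lambda>x. Pi\<^sub>E E (U x)) ` configs E)" using x by blast
  qed
  have op: "\<forall>W\<in>(\<lambda>x. Pi\<^sub>E E (U x)) ` configs E. openin ?T W" using U unfolding N_def by blast
  obtain \<F> where \<F>: "finite \<F>" "\<F> \<subseteq> (\<lambda>x. Pi\<^sub>E E (U x)) ` configs E" "topspace ?T \<subseteq> \<Union>\<F>"
    using comp[unfolded compact_space_alt, rule_format, OF conjI[OF op cover]] by (elim exE conjE)
  obtain X where X: "finite X" "X \<subseteq> configs E" "\<F> = (\<lambda>x. Pi\<^sub>E E (U x)) ` X"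
    using finite_subset_image[OF \<F>(1,2)] by blast
  let ?J = "\<Union>x\<in>X. {i \<in> E. U x i \<noteq> UNIV}"
  show ?thesis
  proof (rule that[of ?J])
    show "finite ?J" using X U unfolding N_def by blast
    fix \<omega> \<eta> assume \<omega>: "\<omega> \<in> configs E" "\<eta> \<in> configs E" "agree_on ?J \<omega> \<eta>"
    have "\<omega> \<in> \<Union>\<F>" using \<F>(3) \<omega>(1) unfolding top by (rule subsetD)
    then obtain x where x: "x \<in> X" "\<omega> \<in> Pi\<^sub>E E (U x)" unfolding X(3) by blast
    have "\<eta> i \<in> U x i" if "i \<in> E" for i
    proof (cases "U x i = UNIV")
      case False
      then have "\<eta> i = \<omega> i" using \<omega>(3) x(1) that by (auto simp: agree_on_def)
      then show ?thesis using x(2) that by auto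
    qed simp
    then have "\<eta> \<in> Pi\<^sub>E E (U x)" using \<omega>(2) by (auto simp: PiE_iff)
    then have "\<bar>f \<omega> - f x\<bar> < \<epsilon> / 2" "\<bar>f \<eta> - f x\<bar> < \<epsilon> / 2"
      using x X U unfolding N_def by blast+
    then show "\<bar>f \<omega> - f \<eta>\<bar> < \<epsilon>" by linarith
  qed auto
qed

lemma continuous_map_depends_on:
  assumes J: "finite J" "J \<subseteq> E" "depends_on E J f"
  shows "continuous_map (product_topology (\<lambda>_. discrete_topology UNIV) E) euclideanreal f"
proof -
  let ?T = "product_topology (\<lambda>_. discrete_topology (UNIV :: bool set)) E"
  have "openin ?T {\<omega> \<in> topspace ?T. f \<omega> \<in> W}" for W
  proof (subst openin_subopen, intro ballI)
    fix \<omega> assume "\<omega> \<in> {\<omega> \<in> topspace ?T. f \<omega> \<in> W}"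
    then have \<omega>: "\<omega> \<in> configs E" "f \<omega> \<in> W" by auto
    let ?U = "\<lambda>i. if i \<in> J then {\<omega> i} else UNIV"
    have "{i \<in> E. ?U i \<noteq> UNIV} \<subseteq> J" by auto
    then have "finite {i \<in> E. ?U i \<noteq> UNIV}" using J(1) by (rule finite_subset)
    then have "openin ?T (Pi\<^sub>E E ?U)" by (simp add: openin_PiE_gen)
    moreover have "\<omega> \<in> Pi\<^sub>E E ?U" using \<omega> by (auto simp: PiE_iff)
    moreover have "Pi\<^sub>E E ?U \<subseteq> {\<omega> \<in> topspace ?T. f \<omega> \<in> W}"
    proof
      fix \<eta> assume \<eta>: "\<eta> \<in> Pi\<^sub>E E ?U"
      then have c: "\<eta> \<in> configs E" by (auto simp: PiE_iff)
      have "agree_on J \<omega> \<eta>" unfolding agree_on_def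
      proof
        fix e assume e: "e \<in> J"
        then have "\<eta> e \<in> ?U e" using \<eta> J(2) unfolding PiE_iff by blast
        then show "\<omega> e = \<eta> e" using e by simp
      qed
      then have "f \<omega> = f \<eta>" by (rule depends_onD[OF J(3) \<omega>(1) c])
      then show "\<eta> \<in> {\<omega> \<in> topspace ?T. f \<omega> \<in> W}" using c \<omega> by simp
    qed
    ultimately show "\<exists>T. openin ?T T \<and> \<omega> \<in> T \<and> T \<subseteq> {\<omega> \<in> topspace ?T. f \<omega> \<in> W}" by blast
  qed
  then show ?thesis by (simp add: continuous_map_def Pi_iff del: openin_subopen)
qed

section \<open>Finite volume expectations as linear functionals\<close>

context rc_graph begin

lemma gibbs_expect_cong:
  assumes "\<omega> \<in> configs E" "D \<subseteq> E" "\<And>\<xi>. \<xi> \<in> configs E \<Longrightarrow> f \<xi> = g \<xi>"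
  shows "gibbs_expect D \<omega> f = gibbs_expect D \<omega> g"
  unfolding gibbs_expect_def using assms patch_in_configs by (intro sum.cong) auto

lemma gibbs_expect_add:
  "gibbs_expect D \<omega> (\<lambda>\<xi>. a * f \<xi> + b * g \<xi>) = a * gibbs_expect D \<omega> f + b * gibbs_expect D \<omega> g"
  unfolding gibbs_expect_def by (simp add: sum_distrib_left distrib_left sum.distrib mult.left_commute)

lemma gibbs_expect_sum:
  "gibbs_expect D \<omega> (\<lambda>\<xi>. \<Sum>i\<in>I. c i * f i \<xi>) = (\<Sum>i\<in>I. c i * gibbs_expect D \<omega> (f i))"
  unfolding gibbs_expect_def sum_distrib_left
  by (subst sum.swap) (simp add: mult.left_commute)

lemma gibbs_expect_dist_le:
  assumes D: "finite D" "D \<subseteq> E" and \<omega>: "\<omega> \<in> configs E"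
    and fg: "\<And>\<xi>. \<xi> \<in> configs E \<Longrightarrow> \<bar>f \<xi> - g \<xi>\<bar> \<le> \<epsilon>"
  shows "\<bar>gibbs_expect D \<omega> f - gibbs_expect D \<omega> g\<bar> \<le> \<epsilon>"
proof -
  have "gibbs_expect D \<omega> f - gibbs_expect D \<omega> g =
      (\<Sum>S\<in>Pow D. gibbs_prob D \<omega> S * (f (patch \<omega> D S) - g (patch \<omega> D S)))"
    unfolding gibbs_expect_def by (simp add: right_diff_distrib sum_subtractf)
  also have "\<bar>\<dots>\<bar> \<le> (\<Sum>S\<in>Pow D. gibbs_prob D \<omega> S * \<epsilon>)"
  proof (rule order_trans[OF sum_abs sum_mono])
    fix S
    show "\<bar>gibbs_prob D \<omega> S * (f (patch \<omega> D S) - g (patch \<omega> D S))\<bar> \<le> gibbs_prob D \<omega> S * \<epsilon>"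
      using gibbs_prob_nonneg[OF D(2), of \<omega> S] fg[OF patch_in_configs[OF \<omega> D(2)], of S]
      by (simp add: abs_mult mult_left_mono)
  qed
  also have "\<dots> = \<epsilon>" using gibbs_prob_sum[OF D, of \<omega>] by (simp flip: sum_distrib_right)
  finally show ?thesis .
qed

text \<open>The DLR equation in finite volume: when each state with \<open>e\<close> closed is
  paired with the one with \<open>e\<close> open, the balance equation gives equality pair by
  pair.\<close>

lemma gibbs_expect_edge:
  assumes \<omega>: "\<omega> \<in> configs E" and D: "finite D" "D \<subseteq> E" and e: "e \<in> D"
    and g: "invariant_on E {e} g"
  shows "gibbs_expect D \<omega> (\<lambda>\<xi>. g \<xi> * indicator (edge_open E e) \<xi>) = gibbs_expect D \<omega> (\<lambda>\<xi>. g \<xi> * cond_prob e \<xi>)"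
proof -
  let ?m = "gibbs_prob D \<omega>" and ?P = "patch \<omega> D"
  have cfg: "?P S \<in> configs E" for S by (rule patch_in_configs[OF \<omega> D(2)])
  have g_eq: "g (?P (insert e S)) = g (?P S)" for S
    by (rule invariant_onD[OF g cfg cfg]) (use e in \<open>auto simp: agree_on_def patch_def\<close>)
  have op: "indicator (edge_open E e) (?P (insert e S)) = (1::real)"
    "S \<subseteq> D - {e} \<Longrightarrow> indicator (edge_open E e) (?P S) = (0::real)" for S
    using cfg[of "insert e S"] e by (auto simp: edge_open_def indicator_def patch_def)
  have "?m (insert e S) * (g (?P (insert e S)) * indicator (edge_open E e) (?P (insert e S))) +
      ?m S * (g (?P S) * indicator (edge_open E e) (?P S)) =
    ?m (insert e S) * (g (?P (insert e S)) * cond_prob e (?P (insert e S))) +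
      ?m S * (g (?P S) * cond_prob e (?P S))" if S: "S \<subseteq> D - {e}" for S
  proof -
    have "cond_prob e (?P S) * ?m S = (1 - cond_prob e (?P S)) * ?m (insert e S)"
      by (rule gibbs_prob_balanced[OF \<omega> D, unfolded balanced_def, rule_format, OF e S])
    then have "g (?P S) * (cond_prob e (?P S) * ?m S) = g (?P S) * ((1 - cond_prob e (?P S)) * ?m (insert e S))"
      by simp
    then show ?thesis
      unfolding op(1) op(2)[OF S] g_eq cond_prob_insert[OF \<omega> D(2)] by (simp add: algebra_simps)
  qed
  then show ?thesis
    unfolding gibbs_expect_def sum_Pow_remove[OF D(1) e] sum.distrib[symmetric]
    by (intro sum.cong) auto
qed

end

section \<open>The thermodynamic limit of cylinder probabilities\<close>

context separating_rc_graph begin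

definition all_open :: "'e \<Rightarrow> bool" where
  "all_open = (\<lambda>e\<in>E. True)"

text \<open>Initial segments of an enumeration of \<open>E\<close>, serving as an exhaustion by
  finite sets; they have no metric meaning.\<close>

definition ball_edges :: "nat \<Rightarrow> 'e set" where
  "ball_edges n = {e \<in> E. to_nat_on E e < n}"

lemma all_open_in: "all_open \<in> configs E"
  by (simp add: all_open_def)

lemma ball_edges: "finite (ball_edges n)" "ball_edges n \<subseteq> E" "incseq ball_edges" "(\<Union>n. ball_edges n) = E"
proof -
  have "inj_on (to_nat_on E) (ball_edges n)"
    using inj_on_to_nat_on[OF countable_E] by (rule inj_on_subset) (auto simp: ball_edges_def)
  moreover have "finite (to_nat_on E ` ball_edges n)"
    by (rule finite_subset[of _ "{..<n}"]) (auto simp: ball_edges_def)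
  ultimately show "finite (ball_edges n)" using finite_imageD by blast
qed (auto simp: ball_edges_def incseq_def)

lemma eventually_ball_superset:
  assumes "incseq F" "(\<Union>n. F n) = E" and X: "finite X" "X \<subseteq> E"
  shows "\<forall>\<^sub>F n in sequentially. X \<subseteq> F n"
  using X
proof (induction X rule: finite_induct)
  case (insert x X)
  obtain k where "x \<in> F k" using insert assms by blast
  then have "\<forall>\<^sub>F n in sequentially. x \<in> F n"
    unfolding eventually_sequentially using assms(1) by (meson incseqD subsetD)
  then show ?case using insert by (auto elim: eventually_elim2)
qed simp

definition gibbs_limit :: "(('e \<Rightarrow> bool) \<Rightarrow> real) \<Rightarrow> real" where
  "gibbs_limit f = lim (\<lambda>n. gibbs_expect (ball_edges n) all_open f)"

text \<open>A cylinder indicator forms a local pair with itself as soon as \<open>H\<close> contains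
  its base. Insensitivity to the boundary condition makes the sequence in \<open>gibbs_limit\<close>
  Cauchy and carries the estimate over to all large volumes.\<close>

lemma gibbs_limit_cylinder:
  fixes S :: "'e set"
  assumes J: "finite J" "J \<subseteq> E"
  defines "f \<equiv> indicator (cylinder E J S)"
  shows "0 < \<epsilon> \<Longrightarrow> \<exists>X. finite X \<and> X \<subseteq> E \<and> (\<forall>G \<omega>. X \<subseteq> G \<longrightarrow> G \<subseteq> E \<longrightarrow> finite G \<longrightarrow> \<omega> \<in> configs E \<longrightarrow>
      \<bar>gibbs_expect G \<omega> f - gibbs_limit f\<bar> \<le> \<epsilon>)"
    and "(\<lambda>n. gibbs_expect (ball_edges n) all_open f) \<longlonglongrightarrow> gibbs_limit f"
proof -
  let ?x = "\<lambda>n. gibbs_expect (ball_edges n) all_open f"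
  obtain \<Lambda> where \<Lambda>: "finite \<Lambda>" "J \<subseteq> \<Lambda>" "\<Lambda> \<subseteq> E" "link_connected \<Lambda>" and
    unif: "\<And>\<epsilon>. 0 < \<epsilon> \<Longrightarrow> \<exists>X. finite X \<and> X \<subseteq> E \<and> \<Lambda> \<subseteq> X \<and> boundary_insensitive \<Lambda> X \<epsilon>"
    using gibbs_expect_uniform[OF J] by metis
  have f01: "0 \<le> f \<xi> \<and> f \<xi> \<le> 1" for \<xi> by (simp add: f_def)
  have "depends_on E \<Lambda> f"
    unfolding f_def by (rule depends_on_mono[OF depends_on_cylinder \<Lambda>(2)])
  then have local: "local_pair H f f" if "\<Lambda> \<subseteq> H" for H
    unfolding local_pair_def using that
    by (intro ballI impI depends_onD[of E \<Lambda> f]) (auto simp: agree_on_def)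
  have approx: "\<exists>X. finite X \<and> X \<subseteq> E \<and> (\<forall>F G \<omega> \<eta>. X \<subseteq> F \<longrightarrow> F \<subseteq> G \<longrightarrow> G \<subseteq> E \<longrightarrow> finite G \<longrightarrow>
      \<omega> \<in> configs E \<longrightarrow> \<eta> \<in> configs E \<longrightarrow> \<bar>gibbs_expect G \<omega> f - gibbs_expect F \<eta> f\<bar> \<le> \<epsilon>)"
    if pos: "0 < \<epsilon>" for \<epsilon>
  proof -
    obtain X where X: "finite X" "X \<subseteq> E" "boundary_insensitive \<Lambda> X \<epsilon>"
      using unif[OF pos] by blast
    show ?thesis
      by (intro exI[of _ X] conjI allI impI X(1,2) boundary_insensitiveD[OF X(3)] f01 local)
  qed
  have ev: "\<forall>\<^sub>F n in sequentially. X \<subseteq> ball_edges n" if "finite X" "X \<subseteq> E" for X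
    by (rule eventually_ball_superset[OF ball_edges(3,4) that])
  have "Cauchy ?x"
  proof (rule metric_CauchyI)
    fix \<epsilon> :: real assume \<epsilon>: "0 < \<epsilon>"
    then obtain X where X: "finite X" "X \<subseteq> E" "\<And>F G \<omega> \<eta>. X \<subseteq> F \<Longrightarrow> F \<subseteq> G \<Longrightarrow> G \<subseteq> E \<Longrightarrow> finite G \<Longrightarrow>
      \<omega> \<in> configs E \<Longrightarrow> \<eta> \<in> configs E \<Longrightarrow> \<bar>gibbs_expect G \<omega> f - gibbs_expect F \<eta> f\<bar> \<le> \<epsilon> / 2"
      using approx[of "\<epsilon> / 2"] by auto
    obtain k where k: "X \<subseteq> ball_edges k" using ev[OF X(1,2)] by (auto simp: eventually_sequentially)
    have "dist (?x m) (?x n) < \<epsilon>" if "k \<le> m" "m \<le> n" for m n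
    proof -
      have "X \<subseteq> ball_edges m" "ball_edges m \<subseteq> ball_edges n"
        using that k ball_edges(3) by (blast dest: incseqD)+
      then have "\<bar>?x n - ?x m\<bar> \<le> \<epsilon> / 2"
        by (intro X(3) ball_edges all_open_in)
      then show ?thesis using \<epsilon> by (simp add: dist_real_def abs_minus_commute)
    qed
    then have "\<forall>m\<ge>k. \<forall>n\<ge>k. dist (?x m) (?x n) < \<epsilon>"
      by (metis dist_commute nle_le)
    then show "\<exists>M. \<forall>m\<ge>M. \<forall>n\<ge>M. dist (?x m) (?x n) < \<epsilon>" by blast
  qed
  then show lim: "?x \<longlonglongrightarrow> gibbs_limit f"
    unfolding gibbs_limit_def by (simp add: Cauchy_convergent convergent_LIMSEQ_iff[symmetric])
  assume \<epsilon>: "0 < \<epsilon>"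
  then obtain X where X: "finite X" "X \<subseteq> E" "\<And>F G \<omega> \<eta>. X \<subseteq> F \<Longrightarrow> F \<subseteq> G \<Longrightarrow> G \<subseteq> E \<Longrightarrow> finite G \<Longrightarrow>
      \<omega> \<in> configs E \<Longrightarrow> \<eta> \<in> configs E \<Longrightarrow> \<bar>gibbs_expect G \<omega> f - gibbs_expect F \<eta> f\<bar> \<le> \<epsilon>"
    using approx[of \<epsilon>] by auto
  have "\<bar>gibbs_expect G \<omega> f - gibbs_limit f\<bar> \<le> \<epsilon>"
    if G: "X \<subseteq> G" "G \<subseteq> E" "finite G" "\<omega> \<in> configs E" for G \<omega>
  proof (rule tendsto_upperbound)
    show "(\<lambda>n. \<bar>gibbs_expect G \<omega> f - ?x n\<bar>) \<longlonglongrightarrow> \<bar>gibbs_expect G \<omega> f - gibbs_limit f\<bar>"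
      by (intro tendsto_intros lim)
    show "\<forall>\<^sub>F n in sequentially. \<bar>gibbs_expect G \<omega> f - ?x n\<bar> \<le> \<epsilon>"
      using ev[OF G(3,2)]
    proof eventually_elim
      case (elim n)
      have "\<bar>?x n - gibbs_expect G \<omega> f\<bar> \<le> \<epsilon>"
        by (rule X(3)[OF G(1) elim]) (use ball_edges all_open_in G in auto)
      then show ?case by (simp add: abs_minus_commute)
    qed
  qed simp
  with X show "\<exists>X. finite X \<and> X \<subseteq> E \<and> (\<forall>G \<omega>. X \<subseteq> G \<longrightarrow> G \<subseteq> E \<longrightarrow> finite G \<longrightarrow> \<omega> \<in> configs E \<longrightarrow>
      \<bar>gibbs_expect G \<omega> f - gibbs_limit f\<bar> \<le> \<epsilon>)"
    by blast
qed

text \<open>Consistency of the cylinder probabilities holds in every finite volume and passes to the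
  limit as an identity of finite sums.\<close>

lemma limit_measure_exists:
  obtains \<phi> where "prob_space \<phi>" "sets \<phi> = sets (config_space E)"
    "\<And>J S. finite J \<Longrightarrow> J \<subseteq> E \<Longrightarrow> S \<subseteq> J \<Longrightarrow> measure \<phi> (cylinder E J S) = gibbs_limit (indicator (cylinder E J S))"
proof (rule config_measure_exists[of E "\<lambda>J S. gibbs_limit (indicator (cylinder E J S))"])
  fix J S :: "'e set" assume J: "finite J" "J \<subseteq> E" "S \<subseteq> J"
  show "0 \<le> gibbs_limit (indicator (cylinder E J S))"
    by (rule tendsto_lowerbound[OF gibbs_limit_cylinder(2)[OF J(1,2)]])
      (auto intro!: always_eventually gibbs_expect_bounds(1) ball_edges all_open_in)
next
  have "gibbs_expect (ball_edges n) all_open (indicator (cylinder E {} {})) = 1" for n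
  proof -
    have "gibbs_expect (ball_edges n) all_open (indicator (cylinder E {} {})) = gibbs_expect (ball_edges n) all_open (\<lambda>_. 1)"
      by (rule gibbs_expect_cong[OF all_open_in ball_edges(2)]) (simp add: cylinder_def)
    then show ?thesis using gibbs_expect_const[OF ball_edges(1,2)] by simp
  qed
  then show "gibbs_limit (indicator (cylinder E {} {})) = 1"
    using gibbs_limit_cylinder(2)[of "{}" "{}"] by (simp add: LIMSEQ_const_iff)
next
  fix J H S :: "'e set" assume H: "J \<subseteq> H" "finite H" "H \<subseteq> E" "S \<subseteq> J"
  have J: "finite J" "J \<subseteq> E" using H by (auto intro: finite_subset)
  let ?\<T> = "{T \<in> Pow H. T \<inter> J = S}"
  have ind: "indicator (cylinder E J S) \<xi> = (\<Sum>T\<in>?\<T>. 1 * indicator (cylinder E H T) \<xi> :: real)"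
    if \<xi>: "\<xi> \<in> configs E" for \<xi>
  proof -
    define T0 where "T0 = {e \<in> H. \<xi> e}"
    have z: "indicator (cylinder E H T) \<xi> = (if T = T0 then 1 else 0 :: real)" if "T \<subseteq> H" for T
      using that \<xi> by (auto simp: cylinder_def T0_def indicator_def)
    have "(\<Sum>T\<in>?\<T>. 1 * indicator (cylinder E H T) \<xi> :: real) = (\<Sum>T\<in>?\<T>. if T = T0 then 1 else 0)"
      using z by (intro sum.cong) auto
    also have "\<dots> = (if T0 \<in> ?\<T> then 1 else 0)" using H by (simp add: sum.delta)
    also have "\<dots> = indicator (cylinder E J S) \<xi>"
    proof -
      have "T0 \<in> ?\<T> \<longleftrightarrow> \<xi> \<in> cylinder E J S"
        using H \<xi> by (auto simp: T0_def cylinder_def)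
      then show ?thesis by (simp add: indicator_def)
    qed
    finally show ?thesis by simp
  qed
  have "gibbs_expect (ball_edges n) all_open (indicator (cylinder E J S)) =
      (\<Sum>T\<in>?\<T>. 1 * gibbs_expect (ball_edges n) all_open (indicator (cylinder E H T)))" for n
    unfolding gibbs_expect_sum[symmetric]
    by (rule gibbs_expect_cong[OF all_open_in ball_edges(2)]) (rule ind)
  then have "(\<lambda>n. \<Sum>T\<in>?\<T>. 1 * gibbs_expect (ball_edges n) all_open (indicator (cylinder E H T)))
      \<longlonglongrightarrow> gibbs_limit (indicator (cylinder E J S))"
    using gibbs_limit_cylinder(2)[OF J, of S] by simp
  moreover have "(\<lambda>n. \<Sum>T\<in>?\<T>. 1 * gibbs_expect (ball_edges n) all_open (indicator (cylinder E H T)))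
      \<longlonglongrightarrow> (\<Sum>T\<in>?\<T>. 1 * gibbs_limit (indicator (cylinder E H T)))"
    by (intro tendsto_sum tendsto_mult tendsto_const gibbs_limit_cylinder(2) H)
  ultimately show "gibbs_limit (indicator (cylinder E J S)) = (\<Sum>T\<in>?\<T>. gibbs_limit (indicator (cylinder E H T)))"
    using LIMSEQ_unique by fastforce
qed (use that in blast)

end

lemma sets_sigma_off_cylinder:
  "sets (sigma_off E e) = sigma_sets (configs E) {cylinder E F S | F S. finite F \<and> F \<subseteq> E - {e}}"
proof -
  have "{{\<omega> \<in> configs E. \<forall>f\<in>F. \<omega> f = \<eta> f} | F \<eta>. finite F \<and> F \<subseteq> E - {e}} =
      {cylinder E F S | F S. finite F \<and> F \<subseteq> E - {e}}" (is "?A = ?B")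
  proof
    show "?A \<subseteq> ?B" unfolding sigma_off_generator_eq_cylinder by blast
    show "?B \<subseteq> ?A"
    proof
      fix x assume "x \<in> ?B"
      then obtain F S where F: "x = cylinder E F S" "finite F" "F \<subseteq> E - {e}" by blast
      then have "x = {\<omega> \<in> configs E. \<forall>f\<in>F. \<omega> f = (f \<in> S)}" by (simp add: cylinder_def)
      with F show "x \<in> ?A" by (intro CollectI exI[of _ F] exI[of _ "\<lambda>f. f \<in> S"]) simp
    qed
  qed
  then show ?thesis unfolding sets_sigma_off by simp
qed

text \<open>Cylinders that prescribe different states for an edge are disjoint, so the empty set has
  to be adjoined.\<close>

lemma Int_stable_cylinders: "Int_stable (insert {} {cylinder E F S | F S. finite F \<and> F \<subseteq> A})"
proof (rule Int_stableI)
  let ?G = "{cylinder E F S | F S. finite F \<and> F \<subseteq> A}"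
  fix a b assume "a \<in> insert {} ?G" "b \<in> insert {} ?G"
  then consider "a \<inter> b = {}" | "a \<in> ?G" "b \<in> ?G" "a \<inter> b \<noteq> {}" by fastforce
  then show "a \<inter> b \<in> insert {} ?G"
  proof cases
    case 2
    from 2(1) obtain F S where a: "a = cylinder E F S" "finite F" "F \<subseteq> A" by (elim CollectE exE conjE)
    from 2(2) obtain F' S' where b: "b = cylinder E F' S'" "finite F'" "F' \<subseteq> A" by (elim CollectE exE conjE)
    from 2(3) obtain \<omega> where \<omega>: "\<omega> \<in> a" "\<omega> \<in> b" by blast
    \<comment> \<open>Any common element \<omega> supplies the states prescribed on the union of the
      two bases.\<close>
    have "a \<inter> b = cylinder E (F \<union> F') {f. \<omega> f}"
      using \<omega> unfolding a(1) b(1) by (auto simp: cylinder_def)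
    then show ?thesis using a(2,3) b(2,3)
      by (intro insertI2 CollectI exI[of _ "F \<union> F'"] exI[of _ "{f. \<omega> f}"]) simp
  qed simp
qed

context separating_rc_graph begin

definition limit_measure :: "('e \<Rightarrow> bool) measure \<Rightarrow> bool" where
  "limit_measure \<phi> \<longleftrightarrow> prob_space \<phi> \<and> sets \<phi> = sets (config_space E) \<and>
     (\<forall>J S. finite J \<longrightarrow> J \<subseteq> E \<longrightarrow> S \<subseteq> J \<longrightarrow>
        measure \<phi> (cylinder E J S) = gibbs_limit (indicator (cylinder E J S)))"

lemma limit_measureD:
  assumes "limit_measure \<phi>"
  shows "prob_space \<phi>" "sets \<phi> = sets (config_space E)"
    "\<And>J S. finite J \<Longrightarrow> J \<subseteq> E \<Longrightarrow> S \<subseteq> J \<Longrightarrow> measure \<phi> (cylinder E J S) = gibbs_limit (indicator (cylinder E J S))"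
  using assms by (auto simp: limit_measure_def)

lemma ex_limit_measure: "\<exists>\<phi>. limit_measure \<phi>"
  by (rule limit_measure_exists) (auto simp: limit_measure_def)

lemma tendsto_integral_limit_measure:
  assumes \<phi>: "limit_measure \<phi>" and J: "finite J" "J \<subseteq> E" "depends_on E J f"
  shows "(\<lambda>n. gibbs_expect (ball_edges n) all_open f) \<longlonglongrightarrow> (\<integral>\<omega>. f \<omega> \<partial>\<phi>)"
proof -
  note \<phi> = limit_measureD[OF \<phi>]
  have fin: "finite_measure \<phi>" using \<phi>(1) by (simp add: prob_space_def)
  have "gibbs_expect (ball_edges n) all_open f =
      (\<Sum>S\<in>Pow J. f (patch all_open J S) * gibbs_expect (ball_edges n) all_open (indicator (cylinder E J S)))" for n
    unfolding gibbs_expect_sum[symmetric]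
    by (rule gibbs_expect_cong[OF all_open_in ball_edges(2)])
      (rule depends_on_sum_cylinder[OF J all_open_in])
  moreover have "(\<lambda>n. \<Sum>S\<in>Pow J. f (patch all_open J S) * gibbs_expect (ball_edges n) all_open (indicator (cylinder E J S)))
      \<longlonglongrightarrow> (\<Sum>S\<in>Pow J. f (patch all_open J S) * gibbs_limit (indicator (cylinder E J S)))"
    by (intro tendsto_sum tendsto_mult tendsto_const gibbs_limit_cylinder(2) J)
  moreover have "(\<integral>\<omega>. f \<omega> \<partial>\<phi>) = (\<Sum>S\<in>Pow J. f (patch all_open J S) * gibbs_limit (indicator (cylinder E J S)))"
    unfolding integral_depends_on[OF fin \<phi>(2) J all_open_in]
    by (intro sum.cong refl) (use \<phi>(3) J in simp)
  ultimately show ?thesis by simp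
qed

lemma eq_limit_measureI:
  assumes \<phi>: "limit_measure \<phi>" and \<psi>: "prob_space \<psi>" "sets \<psi> = sets (config_space E)"
    and eq: "\<And>S. finite S \<Longrightarrow> S \<subseteq> E \<Longrightarrow> (\<integral>\<omega>. indicator (cylinder E S S) \<omega> \<partial>\<psi>) = gibbs_limit (indicator (cylinder E S S))"
  shows "\<psi> = \<phi>"
proof (rule config_measure_eqI[of \<psi> E])
  note \<phi> = limit_measureD[OF \<phi>]
  interpret \<psi>: prob_space \<psi> by (rule \<psi>(1))
  interpret \<phi>: prob_space \<phi> by (rule \<phi>(1))
  show "finite_measure \<psi>" by unfold_locales
  fix S assume S: "finite S" "S \<subseteq> E"
  have "cylinder E S S \<in> sets \<psi>" using sets_cylinder[OF S] \<psi>(2) by simp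
  then have "measure \<psi> (cylinder E S S) = measure \<phi> (cylinder E S S)"
    using eq[OF S] \<phi>(3)[OF S order_refl] by simp
  then show "emeasure \<psi> (cylinder E S S) = emeasure \<phi> (cylinder E S S)"
    by (simp add: \<phi>.emeasure_eq_measure \<psi>.emeasure_eq_measure)
qed (use \<psi> limit_measureD[OF \<phi>] in auto)

text \<open>A DLR measure averages finite volume expectations over boundary conditions, and all of
  these are within \<epsilon> of the limit.\<close>

lemma DLR_eq_limit_measure:
  assumes \<phi>: "limit_measure \<phi>" and \<psi>: "\<psi> \<in> DLR_random_cluster E ends p q"
  shows "\<psi> = \<phi>"
proof (rule eq_limit_measureI[OF \<phi>])
  show "prob_space \<psi>" "sets \<psi> = sets (config_space E)" using \<psi> by (auto simp: DLR_random_cluster_def)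
  fix S assume S: "finite S" "S \<subseteq> E"
  let ?f = "indicator (cylinder E S S) :: ('e \<Rightarrow> bool) \<Rightarrow> real"
  have "\<bar>(\<integral>\<omega>. ?f \<omega> \<partial>\<psi>) - gibbs_limit ?f\<bar> \<le> \<epsilon>" if pos: "0 < \<epsilon>" for \<epsilon>
  proof -
    obtain X where X: "finite X" "X \<subseteq> E" "\<And>G \<omega>. X \<subseteq> G \<Longrightarrow> G \<subseteq> E \<Longrightarrow> finite G \<Longrightarrow> \<omega> \<in> configs E \<Longrightarrow>
        \<bar>gibbs_expect G \<omega> ?f - gibbs_limit ?f\<bar> \<le> \<epsilon>"
      using gibbs_limit_cylinder(1)[OF S pos, of S] by blast
    show ?thesis
      by (rule DLR_integral_approx[OF \<psi> X(1,2) bounded_measurable_indicator[OF sets_cylinder[OF S]]])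
        (rule X(3)[OF order_refl X(2,1)])
  qed
  then have "\<bar>(\<integral>\<omega>. ?f \<omega> \<partial>\<psi>) - gibbs_limit ?f\<bar> \<le> 0" by (rule field_le_epsilon[of _ 0, simplified])
  then show "(\<integral>\<omega>. ?f \<omega> \<partial>\<psi>) = gibbs_limit ?f" by simp
qed

lemma limit_random_cluster_eq_limit_measure:
  assumes \<phi>: "limit_measure \<phi>" and \<psi>: "\<psi> \<in> limit_random_cluster V E ends p q"
  shows "\<psi> = \<phi>"
proof (rule eq_limit_measureI[OF \<phi>])
  show "prob_space \<psi>" "sets \<psi> = sets (config_space E)" using \<psi> by (auto simp: limit_random_cluster_def)
  obtain \<xi> F where \<xi>: "\<And>n. \<xi> n \<in> configs E" and F: "\<And>n. finite (F n)" "incseq F" "(\<Union>n. F n) = E"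
    and conv: "weakly_converges E (\<lambda>n. finite_random_cluster V E ends p q (\<xi> n) (F n)) \<psi>"
    using \<psi> by (auto simp: limit_random_cluster_def)
  have FE: "F n \<subseteq> E" for n using F(3) by auto
  fix S assume S: "finite S" "S \<subseteq> E"
  let ?f = "indicator (cylinder E S S) :: ('e \<Rightarrow> bool) \<Rightarrow> real"
  have dep: "depends_on E S ?f" by (rule depends_on_cylinder)
  have "bounded (?f ` configs E)"
    by (rule bounded_subset[of "{0, 1}"]) (auto simp: indicator_def)
  then have "(\<lambda>n. \<integral>\<omega>. ?f \<omega> \<partial>finite_random_cluster V E ends p q (\<xi> n) (F n)) \<longlonglongrightarrow> (\<integral>\<omega>. ?f \<omega> \<partial>\<psi>)"
    using conv[unfolded weakly_converges_def, rule_format, of ?f] continuous_map_depends_on[OF S dep] by blast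
  then have lim: "(\<lambda>n. gibbs_expect (F n) (\<xi> n) ?f) \<longlonglongrightarrow> (\<integral>\<omega>. ?f \<omega> \<partial>\<psi>)"
    using integral_finite_random_cluster[OF \<xi> F(1) FE measurable_depends_on[OF S dep]] by simp
  \<comment> \<open>The boundary conditions may vary arbitrarily with \<open>n\<close>; uniformity
    in them absorbs this.\<close>
  have "(\<lambda>n. gibbs_expect (F n) (\<xi> n) ?f) \<longlonglongrightarrow> gibbs_limit ?f"
  proof (rule LIMSEQ_I)
    fix r :: real assume "0 < r"
    then have pos: "0 < r / 2" by simp
    obtain X where X: "finite X" "X \<subseteq> E" "\<And>G \<omega>. X \<subseteq> G \<Longrightarrow> G \<subseteq> E \<Longrightarrow> finite G \<Longrightarrow> \<omega> \<in> configs E \<Longrightarrow>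
        \<bar>gibbs_expect G \<omega> ?f - gibbs_limit ?f\<bar> \<le> r / 2"
      using gibbs_limit_cylinder(1)[OF S pos, of S] by blast
    obtain N where N: "\<And>n. n \<ge> N \<Longrightarrow> X \<subseteq> F n"
      using eventually_ball_superset[OF F(2,3) X(1,2)] by (auto simp: eventually_sequentially)
    have "norm (gibbs_expect (F n) (\<xi> n) ?f - gibbs_limit ?f) < r" if "n \<ge> N" for n
      using X(3)[OF N[OF that] FE F(1) \<xi>[of n]] \<open>0 < r\<close> unfolding real_norm_def by linarith
    then show "\<exists>no. \<forall>n\<ge>no. norm (gibbs_expect (F n) (\<xi> n) ?f - gibbs_limit ?f) < r" by blast
  qed
  then show "(\<integral>\<omega>. ?f \<omega> \<partial>\<psi>) = gibbs_limit ?f" using LIMSEQ_unique[OF lim] by blast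
qed

text \<open>A continuous function on the compact configuration space is a uniform limit of functions
  of finitely many edges, for which convergence follows from that of cylinder probabilities.\<close>

lemma limit_measure_in_limit_random_cluster:
  assumes \<phi>: "limit_measure \<phi>"
  shows "\<phi> \<in> limit_random_cluster V E ends p q"
proof -
  note lm = limit_measureD[OF \<phi>]
  interpret prob_space \<phi> by (rule lm(1))
  have space: "space \<phi> = configs E" using sets_eq_imp_space_eq[OF lm(2)] by simp
  have "(\<lambda>n. \<integral>\<omega>. f \<omega> \<partial>finite_random_cluster V E ends p q all_open (ball_edges n)) \<longlonglongrightarrow> (\<integral>\<omega>. f \<omega> \<partial>\<phi>)"
    if cont: "continuous_map (product_topology (\<lambda>_. discrete_topology UNIV) E) euclideanreal f"
      and bdd: "bounded (f ` configs E)" for f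
  proof -
    define Q where "Q \<epsilon> g \<longleftrightarrow> (\<exists>J. finite J \<and> J \<subseteq> E \<and> depends_on E J g) \<and>
      (\<forall>\<omega>\<in>configs E. \<bar>f \<omega> - g \<omega>\<bar> \<le> \<epsilon>)" for \<epsilon> g
    have "\<forall>\<epsilon>\<in>{0<..}. \<exists>g. Q \<epsilon> g"
    proof
      fix \<epsilon> :: real assume "\<epsilon> \<in> {0<..}"
      then have pos: "0 < \<epsilon>" by simp
      show "\<exists>g. Q \<epsilon> g"
      proof (rule continuous_config_uniform[OF cont pos])
      fix J assume J: "finite J" "J \<subseteq> E"
        "\<And>\<omega> \<eta>. \<omega> \<in> configs E \<Longrightarrow> \<eta> \<in> configs E \<Longrightarrow> agree_on J \<omega> \<eta> \<Longrightarrow> \<bar>f \<omega> - f \<eta>\<bar> < \<epsilon>"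
      \<comment> \<open>Setting all edges off \<open>J\<close> open turns \<open>f\<close> into a
        function of the edges of \<open>J\<close>.\<close>
      let ?g = "\<lambda>\<omega>. f (patch all_open J {e \<in> J. \<omega> e})"
      have "depends_on E J ?g"
        unfolding depends_on_def
      proof (intro ballI impI)
        fix \<omega> \<eta> assume "agree_on J \<omega> \<eta>"
        then have "{e \<in> J. \<omega> e} = {e \<in> J. \<eta> e}" by (auto simp: agree_on_def)
        then show "?g \<omega> = ?g \<eta>" by simp
      qed
      moreover have "\<bar>f \<omega> - ?g \<omega>\<bar> \<le> \<epsilon>" if "\<omega> \<in> configs E" for \<omega>
        by (intro less_imp_le J(3) that patch_in_configs all_open_in J(2)) (auto simp: agree_on_def patch_def)
      ultimately have "Q \<epsilon> ?g" unfolding Q_def using J(1,2) by (intro conjI exI[of _ J] ballI)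
      then show "\<exists>g. Q \<epsilon> g" by (rule exI[of "Q \<epsilon>"])
      qed
    qed
    from bchoice[OF this] obtain g where "\<forall>\<epsilon>\<in>{0<..}. Q \<epsilon> (g \<epsilon>)" by (elim exE)
    then have "Q \<epsilon> (g \<epsilon>)" if "0 < \<epsilon>" for \<epsilon> using that by simp
    then have g: "\<exists>J. finite J \<and> J \<subseteq> E \<and> depends_on E J (g \<epsilon>)" "\<omega> \<in> configs E \<Longrightarrow> \<bar>f \<omega> - g \<epsilon> \<omega>\<bar> \<le> \<epsilon>"
      if "0 < \<epsilon>" for \<epsilon> \<omega> using that unfolding Q_def by simp_all
    have gm: "g \<epsilon> \<in> borel_measurable (config_space E)" if "0 < \<epsilon>" for \<epsilon>
      using g(1)[OF that] measurable_depends_on by blast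
    \<comment> \<open>Measurability for the product sigma-algebra is inherited from the approximants
      that depend on finitely many edges.\<close>
    have fm: "f \<in> borel_measurable (config_space E)"
    proof (rule borel_measurable_LIMSEQ_real)
      fix \<omega> assume "\<omega> \<in> space (config_space E)"
      then have \<omega>: "\<omega> \<in> configs E" by simp
      have "(\<lambda>n. g (inverse (real (Suc n))) \<omega> - f \<omega>) \<longlonglongrightarrow> 0"
      proof (rule Lim_null_comparison)
        show "\<forall>\<^sub>F n in sequentially. norm (g (inverse (real (Suc n))) \<omega> - f \<omega>) \<le> inverse (real (Suc n))"
          using g(2)[OF _ \<omega>] by (intro always_eventually allI) (simp add: abs_minus_commute)
        show "(\<lambda>n. inverse (real (Suc n))) \<longlonglongrightarrow> 0" by (rule LIMSEQ_inverse_real_of_nat)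
      qed
      then show "(\<lambda>n. g (inverse (real (Suc n))) \<omega>) \<longlonglongrightarrow> f \<omega>" by (rule LIM_zero_cancel)
    qed (rule gm, simp)
    obtain B where B: "\<forall>\<omega>\<in>configs E. \<bar>f \<omega>\<bar> \<le> B" using bdd by (auto simp: bounded_iff)
    have fb: "bounded_measurable E f" using fm B by (auto simp: bounded_measurable_def)
    have int: "integrable \<phi> h" if "bounded_measurable E h" for h
      by (rule bounded_measurable_integrable[OF finite_measure_axioms lm(2) that])
    have "(\<lambda>n. gibbs_expect (ball_edges n) all_open f) \<longlonglongrightarrow> (\<integral>\<omega>. f \<omega> \<partial>\<phi>)"
    proof (rule LIMSEQ_I)
      fix r :: real assume "0 < r"
      \<comment> \<open>Three errors of \<open>r / 4\<close> stay below \<open>r\<close>: two from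
        replacing \<open>f\<close> by \<open>h\<close>, one from the convergence for
        \<open>h\<close>.\<close>
      then have pos: "0 < r / 4" by simp
      define h where "h = g (r / 4)"
      obtain J where J: "finite J" "J \<subseteq> E" "depends_on E J h" using g(1)[OF pos] unfolding h_def by blast
      have fh: "\<bar>f \<omega> - h \<omega>\<bar> \<le> r / 4" if "\<omega> \<in> configs E" for \<omega> using g(2)[OF pos that] unfolding h_def .
      have "\<bar>h \<omega>\<bar> \<le> B + r / 4" if \<omega>: "\<omega> \<in> configs E" for \<omega>
        using fh[OF \<omega>] B[rule_format, OF \<omega>] by linarith
      then have hb: "bounded_measurable E h"
        using gm[OF pos] by (auto simp: bounded_measurable_def h_def)
      have "\<bar>(\<integral>\<omega>. f \<omega> \<partial>\<phi>) - (\<integral>\<omega>. h \<omega> \<partial>\<phi>)\<bar> = \<bar>\<integral>\<omega>. f \<omega> - h \<omega> \<partial>\<phi>\<bar>"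
        using int[OF fb] int[OF hb] by simp
      also have "\<dots> \<le> (\<integral>\<omega>. r / 4 \<partial>\<phi>)"
        using fh space
        by (intro order_trans[OF integral_abs_bound integral_mono] integrable_abs
            Bochner_Integration.integrable_diff int fb hb bounded_measurable_const) auto
      finally have 1: "\<bar>(\<integral>\<omega>. f \<omega> \<partial>\<phi>) - (\<integral>\<omega>. h \<omega> \<partial>\<phi>)\<bar> \<le> r / 4" by (simp add: prob_space)
      have 2: "\<bar>gibbs_expect (ball_edges n) all_open f - gibbs_expect (ball_edges n) all_open h\<bar> \<le> r / 4" for n
        by (intro gibbs_expect_dist_le ball_edges all_open_in fh)
      obtain N where N: "\<And>n. n \<ge> N \<Longrightarrow> norm (gibbs_expect (ball_edges n) all_open h - (\<integral>\<omega>. h \<omega> \<partial>\<phi>)) < r / 4"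
        using LIMSEQ_D[OF tendsto_integral_limit_measure[OF \<phi> J] pos] by blast
      have "norm (gibbs_expect (ball_edges n) all_open f - (\<integral>\<omega>. f \<omega> \<partial>\<phi>)) < r" if "n \<ge> N" for n
        using 1 2[of n] N[OF that] \<open>0 < r\<close> unfolding real_norm_def by linarith
      then show "\<exists>no. \<forall>n\<ge>no. norm (gibbs_expect (ball_edges n) all_open f - (\<integral>\<omega>. f \<omega> \<partial>\<phi>)) < r" by blast
    qed
    then show ?thesis
      using integral_finite_random_cluster[OF all_open_in ball_edges(1,2) fm] by simp
  qed
  then have "weakly_converges E (\<lambda>n. finite_random_cluster V E ends p q all_open (ball_edges n)) \<phi>"
    unfolding weakly_converges_def by blast
  then show ?thesis
    unfolding limit_random_cluster_def using lm ball_edges all_open_in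
    by (intro CollectI conjI exI[of _ "\<lambda>_. all_open"] exI[of _ ball_edges]) auto
qed

section \<open>The limit measure satisfies the DLR equations\<close>

definition joined_within :: "'e \<Rightarrow> nat \<Rightarrow> ('e \<Rightarrow> bool) set" where
  "joined_within e m = {\<omega> \<in> configs E. \<exists>u v. ends e = {u, v} \<and>
     joined_by ends ((open_edges E \<omega> \<inter> ball_edges m) - {e}) u v}"

lemma joined_within_subset: "joined_within e m \<subseteq> ends_joined_off E ends e"
proof
  fix \<omega> assume "\<omega> \<in> joined_within e m"
  then obtain u v where uv: "\<omega> \<in> configs E" "ends e = {u, v}"
    "joined_by ends ((open_edges E \<omega> \<inter> ball_edges m) - {e}) u v"
    unfolding joined_within_def by blast
  have "joined_by ends (open_edges E \<omega> - {e}) u v" by (rule joined_by_mono[OF uv(3)]) auto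
  then show "\<omega> \<in> ends_joined_off E ends e" using uv(1,2) unfolding ends_joined_off_def by blast
qed

lemma joined_within_eventually:
  assumes "\<omega> \<in> ends_joined_off E ends e"
  shows "\<forall>\<^sub>F m in sequentially. \<omega> \<in> joined_within e m"
proof -
  obtain u v where uv: "\<omega> \<in> configs E" "ends e = {u, v}" "joined_by ends (open_edges E \<omega> - {e}) u v"
    using assms by (auto simp: ends_joined_off_def)
  obtain S where S: "finite S" "S \<subseteq> open_edges E \<omega> - {e}" "joined_by ends S u v"
    by (rule joined_by_finite_subset[OF uv(3)])
  have "S \<subseteq> E" using S by (auto simp: open_edges_def)
  from eventually_ball_superset[OF ball_edges(3,4) S(1) this] show ?thesis
  proof eventually_elim
    case (elim m)
    then have "joined_by ends ((open_edges E \<omega> \<inter> ball_edges m) - {e}) u v"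
      using S by (intro joined_by_mono[OF S(3)]) auto
    then show ?case using uv by (auto simp: joined_within_def)
  qed
qed

lemma depends_on_joined_within: "depends_on E (ball_edges m) (indicator (joined_within e m))"
  unfolding depends_on_def
proof (intro ballI impI)
  fix \<omega> \<eta> assume \<omega>: "\<omega> \<in> configs E" "\<eta> \<in> configs E" "agree_on (ball_edges m) \<omega> \<eta>"
  have "open_edges E \<omega> \<inter> ball_edges m = open_edges E \<eta> \<inter> ball_edges m"
    using \<omega>(3) by (auto simp: open_edges_def agree_on_def)
  then show "indicator (joined_within e m) \<omega> = (indicator (joined_within e m) \<eta> :: real)"
    using \<omega> by (simp add: joined_within_def indicator_def)
qed

text \<open>Behind an open barrier a connection can be rerouted through \<open>H\<close> and its
  outer neighbours, hence within \<open>ball_edges m\<close>, and this remains true in any other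
  configuration that agrees on \<open>H\<close> and has the same open barrier.\<close>

lemma local_pair_joined:
  assumes H: "finite H" "H \<subseteq> E" "link_connected H" and e: "e \<in> H" and F: "F \<subseteq> H"
    and m: "H \<union> outer_nb H \<subseteq> ball_edges m"
  shows "local_pair H (\<lambda>\<omega>. indicator (cylinder E F S) \<omega> * indicator (ends_joined_off E ends e) \<omega>)
    (\<lambda>\<omega>. indicator (cylinder E F S) \<omega> * indicator (joined_within e m) \<omega>)"
  unfolding local_pair_def
proof (intro ballI impI)
  fix \<omega> \<eta> assume \<omega>: "\<omega> \<in> configs E" "\<eta> \<in> configs E" and agree: "agree_on H \<omega> \<eta>"
    and op: "open_on (outer_nb H) \<omega>" "open_on (outer_nb H) \<eta>"
  have C: "\<omega> \<in> cylinder E F S \<longleftrightarrow> \<eta> \<in> cylinder E F S"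
    using \<omega> agree F by (auto simp: cylinder_def agree_on_def subset_iff)
  have "\<eta> \<in> joined_within e m" if "\<omega> \<in> ends_joined_off E ends e"
  proof -
    have "open_edges H \<omega> \<union> outer_nb H \<subseteq> open_edges E \<eta> \<inter> ball_edges m"
      using m H(2) outer_nb_subset[OF H(2)] agree op
      by (auto simp: open_edges_def agree_on_def open_on_def)
    from ends_joined_off_local[OF H e \<omega>(1) that this] show ?thesis
      using \<omega> by (auto simp: joined_within_def)
  qed
  moreover have "\<omega> \<in> ends_joined_off E ends e" if "\<eta> \<in> joined_within e m"
  proof -
    have "open_edges H \<eta> \<union> outer_nb H \<subseteq> open_edges E \<omega>"
      using H(2) outer_nb_subset[OF H(2)] agree op
      by (auto simp: open_edges_def agree_on_def open_on_def)
    from ends_joined_off_local[OF H e \<omega>(2) subsetD[OF joined_within_subset that] this] show ?thesis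
      using \<omega> by (auto simp: ends_joined_off_def)
  qed
  ultimately show "indicator (cylinder E F S) \<omega> * indicator (ends_joined_off E ends e) \<omega> =
      (indicator (cylinder E F S) \<eta> * indicator (joined_within e m) \<eta> :: real)"
    using C by (auto simp: indicator_def)
qed

lemma local_pair_trans:
  assumes "local_pair H f g" shows "local_pair H g g"
  unfolding local_pair_def
proof (intro ballI impI)
  note * = assms[unfolded local_pair_def, rule_format]
  fix \<omega> \<eta> assume a: "\<omega> \<in> configs E" "\<eta> \<in> configs E" "agree_on H \<omega> \<eta>"
    "open_on (outer_nb H) \<omega>" "open_on (outer_nb H) \<eta>"
  have "f \<omega> = g \<omega>" by (rule *[OF a(1,1) _ a(4,4)]) (simp add: agree_on_def)
  moreover have "f \<omega> = g \<eta>" by (rule *[OF a])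
  ultimately show "g \<omega> = g \<eta>" by simp
qed

text \<open>The conditional probability of \<open>e\<close> involves a connection of unbounded range
  and need not be continuous, so weak convergence alone does not yield the equation. The connection
  is replaced by its version within \<open>ball_edges m\<close>; the error is uniform in the volume,
  which permits letting the volume grow before \<open>m\<close>.\<close>

lemma limit_measure_edge_cylinder:
  assumes \<phi>: "limit_measure \<phi>" and e: "e \<in> E" and F: "finite F" "F \<subseteq> E - {e}"
  shows "(\<integral>\<omega>. indicator (cylinder E F S) \<omega> * indicator (edge_open E e) \<omega> \<partial>\<phi>) =
    (\<integral>\<omega>. indicator (cylinder E F S) \<omega> * cond_prob e \<omega> \<partial>\<phi>)"
proof -
  note lm = limit_measureD[OF \<phi>]
  interpret prob_space \<phi> by (rule lm(1))
  have space: "space \<phi> = configs E" using sets_eq_imp_space_eq[OF lm(2)] by simp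
  let ?C = "indicator (cylinder E F S) :: ('e \<Rightarrow> bool) \<Rightarrow> real"
  define k where "k \<omega> = ?C \<omega> * indicator (ends_joined_off E ends e) \<omega>" for \<omega>
  define km where "km m \<omega> = ?C \<omega> * indicator (joined_within e m) \<omega>" for m \<omega>
  define L where "L \<omega> = ?C \<omega> * indicator (edge_open E e) \<omega>" for \<omega>
  define ph where "ph = p_hat p q e"
  define d where "d = p e - ph"
  have d01: "0 \<le> d" "d \<le> 1"
    using p_hat_le[OF e] p_hat_pos[OF e] p_le_1[OF e] by (auto simp: d_def ph_def)
  have FE: "F \<subseteq> E" using F by auto
  have int: "integrable \<phi> h" if "bounded_measurable E h" for h
    by (rule bounded_measurable_integrable[OF finite_measure_axioms lm(2) that])
  have Cb: "bounded_measurable E ?C" by (intro bounded_measurable_indicator sets_cylinder F(1) FE)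
  have kb: "bounded_measurable E k" unfolding k_def
    by (intro bounded_measurable_mult Cb bounded_measurable_indicator sets_ends_joined_off e)
  have cond: "cond_prob e \<omega> = ph + d * indicator (ends_joined_off E ends e) \<omega>" for \<omega>
    by (simp add: cond_prob_def ph_def d_def)
  have depC: "depends_on E F ?C" by (rule depends_on_cylinder)
  have depL: "depends_on E (insert e F) L"
    unfolding L_def depends_on_def
  proof (intro ballI impI)
    fix \<omega> \<eta> assume "\<omega> \<in> configs E" "\<eta> \<in> configs E" "agree_on (insert e F) \<omega> \<eta>"
    then show "?C \<omega> * indicator (edge_open E e) \<omega> = ?C \<eta> * indicator (edge_open E e) \<eta>"
      by (simp add: agree_on_def cylinder_def edge_open_def indicator_def)
  qed
  have depkm: "depends_on E (F \<union> ball_edges m) (km m)" for m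
    unfolding km_def depends_on_def
  proof (intro ballI impI)
    fix \<omega> \<eta> assume a: "\<omega> \<in> configs E" "\<eta> \<in> configs E" "agree_on (F \<union> ball_edges m) \<omega> \<eta>"
    have "?C \<omega> = ?C \<eta>" by (rule depends_onD[OF depC a(1,2)]) (use a(3) in \<open>auto simp: agree_on_def\<close>)
    moreover have "indicator (joined_within e m) \<omega> = (indicator (joined_within e m) \<eta> :: real)"
      by (rule depends_onD[OF depends_on_joined_within a(1,2)]) (use a(3) in \<open>auto simp: agree_on_def\<close>)
    ultimately show "?C \<omega> * indicator (joined_within e m) \<omega> = ?C \<eta> * indicator (joined_within e m) \<eta>" by simp
  qed
  let ?x = "\<lambda>f n. gibbs_expect (ball_edges n) all_open f"
  \<comment> \<open>The DLR equation in finite volume, with \<open>cond_prob e\<close> written as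
    \<open>ph\<close> plus \<open>d\<close> times the indicator of the connection event.\<close>
  have exL: "?x L n = ph * ?x ?C n + d * ?x k n" if "e \<in> ball_edges n" for n
  proof -
    have "invariant_on E {e} ?C" unfolding invariant_on_def
    proof (intro ballI impI)
      fix \<omega> \<eta> assume a: "\<omega> \<in> configs E" "\<eta> \<in> configs E" "agree_on (E - {e}) \<omega> \<eta>"
      show "?C \<omega> = ?C \<eta>" by (rule depends_onD[OF depC a(1,2)]) (use a(3) F in \<open>auto simp: agree_on_def\<close>)
    qed
    then have "?x L n = ?x (\<lambda>\<omega>. ?C \<omega> * cond_prob e \<omega>) n"
      unfolding L_def by (intro gibbs_expect_edge all_open_in ball_edges that)
    also have "\<dots> = ?x (\<lambda>\<omega>. ph * ?C \<omega> + d * k \<omega>) n"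
      by (rule gibbs_expect_cong[OF all_open_in ball_edges(2)]) (simp add: cond k_def algebra_simps)
    finally show ?thesis unfolding gibbs_expect_add .
  qed
  obtain \<Lambda> where \<Lambda>: "finite \<Lambda>" "insert e F \<subseteq> \<Lambda>" "\<Lambda> \<subseteq> E" "link_connected \<Lambda>" and
    unif: "\<And>\<epsilon>. 0 < \<epsilon> \<Longrightarrow> \<exists>X. finite X \<and> X \<subseteq> E \<and> \<Lambda> \<subseteq> X \<and> boundary_insensitive \<Lambda> X \<epsilon>"
    using gibbs_expect_uniform[of "insert e F"] F e FE by (metis finite_insert insert_subset)
  have approx: "\<forall>\<^sub>F m in sequentially. \<bar>(\<integral>\<omega>. L \<omega> \<partial>\<phi>) - (ph * (\<integral>\<omega>. ?C \<omega> \<partial>\<phi>) + d * (\<integral>\<omega>. km m \<omega> \<partial>\<phi>))\<bar> \<le> 2 * \<epsilon>"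
    if pos: "0 < \<epsilon>" for \<epsilon>
  proof -
    obtain X where X: "finite X" "X \<subseteq> E" "\<Lambda> \<subseteq> X" "boundary_insensitive \<Lambda> X \<epsilon>" using unif[OF pos] by blast
    \<comment> \<open>Having the neighbours of \<open>X\<close> in \<open>ball_edges m\<close> as
      well covers the outer neighbours of every \<open>H\<close> inside \<open>X\<close>.\<close>
    have "finite (X \<union> (\<Union>x\<in>X. nb x))" "X \<union> (\<Union>x\<in>X. nb x) \<subseteq> E"
      using X finite_nb nb_subset by blast+
    from eventually_ball_superset[OF ball_edges(3,4) this] show ?thesis
    proof eventually_elim
      case (elim m)
      have k01: "0 \<le> k \<xi> \<and> k \<xi> \<le> 1" "0 \<le> km m \<xi> \<and> km m \<xi> \<le> 1" for \<xi>
        by (auto simp: k_def km_def indicator_def)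
      have local: "local_pair H k (km m)" if "\<Lambda> \<subseteq> H" "H \<subseteq> X" "link_connected H" for H
        unfolding k_def km_def
      proof (rule local_pair_joined)
        show "finite H" "H \<subseteq> E" using that X by (auto intro: finite_subset)
        show "H \<union> outer_nb H \<subseteq> ball_edges m" using that elim unfolding outer_nb_def by blast
      qed (use that \<Lambda> in auto)
      have local': "local_pair H (km m) (km m)" if "\<Lambda> \<subseteq> H" "H \<subseteq> X" "link_connected H" for H
        by (rule local_pair_trans[OF local[OF that]])
      \<comment> \<open>Both terms are compared with the expectation of \<open>km m\<close> in the
        fixed volume \<open>X\<close>, whence the factor 2.\<close>
      have "\<bar>?x k n - ?x (km m) n\<bar> \<le> 2 * \<epsilon>" if "X \<subseteq> ball_edges n" for n
      proof -
        have "\<bar>?x k n - gibbs_expect X all_open (km m)\<bar> \<le> \<epsilon>"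
          by (rule boundary_insensitiveD[OF X(4) order_refl that ball_edges(2,1) all_open_in all_open_in k01 local])
        moreover have "\<bar>?x (km m) n - gibbs_expect X all_open (km m)\<bar> \<le> \<epsilon>"
          by (rule boundary_insensitiveD[OF X(4) order_refl that ball_edges(2,1) all_open_in all_open_in k01(2,2) local'])
        ultimately show ?thesis by linarith
      qed
      then have "\<bar>?x L n - (ph * ?x ?C n + d * ?x (km m) n)\<bar> \<le> 2 * \<epsilon>" if "X \<subseteq> ball_edges n" for n
      proof -
        have "e \<in> ball_edges n" using that X \<Lambda> by auto
        then have "?x L n - (ph * ?x ?C n + d * ?x (km m) n) = d * (?x k n - ?x (km m) n)"
          using exL by (simp add: algebra_simps)
        then have "\<bar>?x L n - (ph * ?x ?C n + d * ?x (km m) n)\<bar> = d * \<bar>?x k n - ?x (km m) n\<bar>"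
          using d01 by (simp add: abs_mult)
        also have "\<dots> \<le> \<bar>?x k n - ?x (km m) n\<bar>" using d01 by (simp add: mult_left_le_one_le)
        finally show ?thesis using \<open>\<And>n. X \<subseteq> ball_edges n \<Longrightarrow> \<bar>?x k n - ?x (km m) n\<bar> \<le> 2 * \<epsilon>\<close>[OF that] by simp
      qed
      then have ev: "\<forall>\<^sub>F n in sequentially. \<bar>?x L n - (ph * ?x ?C n + d * ?x (km m) n)\<bar> \<le> 2 * \<epsilon>"
        using eventually_ball_superset[OF ball_edges(3,4) X(1,2)] by (auto elim: eventually_mono)
      have fin: "finite (insert e F)" "insert e F \<subseteq> E" "finite (F \<union> ball_edges m)" "F \<union> ball_edges m \<subseteq> E"
        using F FE e ball_edges by auto
      show ?case
      proof (rule tendsto_upperbound[OF _ ev])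
        show "(\<lambda>n. \<bar>?x L n - (ph * ?x ?C n + d * ?x (km m) n)\<bar>) \<longlonglongrightarrow>
            \<bar>(\<integral>\<omega>. L \<omega> \<partial>\<phi>) - (ph * (\<integral>\<omega>. ?C \<omega> \<partial>\<phi>) + d * (\<integral>\<omega>. km m \<omega> \<partial>\<phi>))\<bar>"
          by (intro tendsto_rabs tendsto_diff tendsto_add tendsto_mult tendsto_const
              tendsto_integral_limit_measure[OF \<phi> fin(1,2) depL]
              tendsto_integral_limit_measure[OF \<phi> F(1) FE depC]
              tendsto_integral_limit_measure[OF \<phi> fin(3,4) depkm])
      qed simp
    qed
  qed
  have kmb: "bounded_measurable E (km m)" for m
  proof -
    have "km m \<in> borel_measurable (config_space E)"
      using F FE ball_edges by (intro measurable_depends_on[OF _ _ depkm[of m]]) auto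
    moreover have "\<bar>km m \<omega>\<bar> \<le> 1" for \<omega> by (auto simp: km_def indicator_def)
    ultimately show ?thesis by (auto simp: bounded_measurable_def)
  qed
  \<comment> \<open>For each configuration the finite range event eventually coincides with the full
    connection event; dominated convergence removes \<open>m\<close>.\<close>
  have kmlim: "(\<lambda>m. \<integral>\<omega>. km m \<omega> \<partial>\<phi>) \<longlonglongrightarrow> (\<integral>\<omega>. k \<omega> \<partial>\<phi>)"
  proof (rule integral_dominated_convergence[where w = "\<lambda>_. 1"])
    show "k \<in> borel_measurable \<phi>" "\<And>m. km m \<in> borel_measurable \<phi>"
      using kb kmb by (simp_all add: bounded_measurable_def measurable_cong_sets[OF lm(2) refl])
    show "AE \<omega> in \<phi>. (\<lambda>m. km m \<omega>) \<longlonglongrightarrow> k \<omega>"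
    proof (rule AE_I2)
      fix \<omega>
      have "\<forall>\<^sub>F m in sequentially. km m \<omega> = k \<omega>"
      proof (cases "\<omega> \<in> ends_joined_off E ends e")
        case True
        from joined_within_eventually[OF this] show ?thesis
          by eventually_elim (use True in \<open>simp add: km_def k_def\<close>)
      next
        case False
        then show ?thesis using joined_within_subset[of e]
          by (intro always_eventually allI) (auto simp: km_def k_def indicator_def)
      qed
      then show "(\<lambda>m. km m \<omega>) \<longlonglongrightarrow> k \<omega>" by (rule tendsto_eventually)
    qed
    show "AE \<omega> in \<phi>. norm (km m \<omega>) \<le> 1" for m by (auto simp: km_def indicator_def)
  qed simp
  have "\<bar>(\<integral>\<omega>. L \<omega> \<partial>\<phi>) - (ph * (\<integral>\<omega>. ?C \<omega> \<partial>\<phi>) + d * (\<integral>\<omega>. k \<omega> \<partial>\<phi>))\<bar> \<le> \<epsilon>" if "0 < \<epsilon>" for \<epsilon>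
  proof (rule tendsto_upperbound)
    show "(\<lambda>m. \<bar>(\<integral>\<omega>. L \<omega> \<partial>\<phi>) - (ph * (\<integral>\<omega>. ?C \<omega> \<partial>\<phi>) + d * (\<integral>\<omega>. km m \<omega> \<partial>\<phi>))\<bar>) \<longlonglongrightarrow>
        \<bar>(\<integral>\<omega>. L \<omega> \<partial>\<phi>) - (ph * (\<integral>\<omega>. ?C \<omega> \<partial>\<phi>) + d * (\<integral>\<omega>. k \<omega> \<partial>\<phi>))\<bar>"
      by (intro tendsto_rabs tendsto_diff tendsto_add tendsto_mult tendsto_const kmlim)
    show "\<forall>\<^sub>F m in sequentially. \<bar>(\<integral>\<omega>. L \<omega> \<partial>\<phi>) - (ph * (\<integral>\<omega>. ?C \<omega> \<partial>\<phi>) + d * (\<integral>\<omega>. km m \<omega> \<partial>\<phi>))\<bar> \<le> \<epsilon>"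
      using approx[of "\<epsilon> / 2"] that by simp
  qed simp
  then have "\<bar>(\<integral>\<omega>. L \<omega> \<partial>\<phi>) - (ph * (\<integral>\<omega>. ?C \<omega> \<partial>\<phi>) + d * (\<integral>\<omega>. k \<omega> \<partial>\<phi>))\<bar> \<le> 0"
    by (rule field_le_epsilon[of _ 0, simplified])
  then have "(\<integral>\<omega>. L \<omega> \<partial>\<phi>) = ph * (\<integral>\<omega>. ?C \<omega> \<partial>\<phi>) + d * (\<integral>\<omega>. k \<omega> \<partial>\<phi>)" by simp
  also have "\<dots> = (\<integral>\<omega>. ph * ?C \<omega> + d * k \<omega> \<partial>\<phi>)" using int[OF Cb] int[OF kb] by simp
  also have "\<dots> = (\<integral>\<omega>. ?C \<omega> * cond_prob e \<omega> \<partial>\<phi>)"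
    by (simp add: cond k_def algebra_simps)
  finally show ?thesis unfolding L_def .
qed

text \<open>Testing the conditional expectation on cylinders that do not involve \<open>e\<close> is
  enough: Dynkin's lemma extends the equality of integrals to the sigma-algebra that they
  generate.\<close>

lemma limit_measure_in_DLR:
  assumes \<phi>: "limit_measure \<phi>"
  shows "\<phi> \<in> DLR_random_cluster E ends p q"
proof -
  note lm = limit_measureD[OF \<phi>]
  interpret prob_space \<phi> by (rule lm(1))
  have space: "space \<phi> = configs E" using sets_eq_imp_space_eq[OF lm(2)] by simp
  have int: "integrable \<phi> h" if "bounded_measurable E h" for h
    by (rule bounded_measurable_integrable[OF finite_measure_axioms lm(2) that])
  have "AE \<omega> in \<phi>. real_cond_exp \<phi> (sigma_off E e) (indicator (edge_open E e)) \<omega> = cond_prob e \<omega>"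
    if e: "e \<in> E" for e
  proof -
    interpret finite_measure_subalgebra \<phi> "sigma_off E e"
      by unfold_locales (auto simp: subalgebra_def space lm(2) sets_sigma_off_subset)
    let ?L = "indicator (edge_open E e) :: ('e \<Rightarrow> bool) \<Rightarrow> real"
    have Lb: "bounded_measurable E ?L" by (intro bounded_measurable_indicator sets_edge_open e)
    have cb: "bounded_measurable E (cond_prob e)" by (rule bounded_measurable_cond_prob[OF e])
    let ?G = "{cylinder E F S | F S. finite F \<and> F \<subseteq> E - {e}}"
    let ?G' = "insert {} ?G"
    have "?G' \<subseteq> sets \<phi>" unfolding lm(2) using sets_cylinder[of _ E] by blast
    from sets.sigma_sets_subset[OF this] have sub: "sigma_sets (configs E) ?G' \<subseteq> sets \<phi>"
      by (simp only: space)
    have eq: "set_lebesgue_integral \<phi> A ?L = set_lebesgue_integral \<phi> A (cond_prob e)"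
      if "A \<in> sigma_sets (configs E) ?G" for A
    proof -
      note Int_stable_cylinders[of E "E - {e}"]
      moreover have "?G' \<subseteq> Pow (configs E)" by (auto simp: cylinder_def)
      moreover have "A \<in> sigma_sets (configs E) ?G'"
        using that sigma_sets_mono'[of ?G ?G' "configs E"] by blast
      ultimately show ?thesis
      proof (induction rule: sigma_sets_induct_disjoint)
        case (basic a)
        show ?case
        proof (cases "a = {}")
          case False
          with basic have "a \<in> ?G" by simp
          then obtain F S where F: "a = cylinder E F S" "finite F" "F \<subseteq> E - {e}" by (elim CollectE exE conjE)
          show ?thesis
            using limit_measure_edge_cylinder[OF \<phi> e F(2,3), of S] by (simp add: set_lebesgue_integral_def F(1))
        qed (simp add: set_lebesgue_integral_def)
      next
        case empty
        show ?case by (simp add: set_lebesgue_integral_def)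
      next
        case (compl a)
        have a: "a \<in> sets \<phi>" using compl sub by blast
        have c: "set_lebesgue_integral \<phi> (configs E - a) h = (\<integral>\<omega>. h \<omega> \<partial>\<phi>) - set_lebesgue_integral \<phi> a h"
          if h: "bounded_measurable E h" for h
        proof -
          have "integrable \<phi> (\<lambda>\<omega>. indicator a \<omega> * h \<omega>)"
            using a lm(2) by (intro int bounded_measurable_mult h bounded_measurable_indicator) simp
          then have "(\<integral>\<omega>. h \<omega> - indicator a \<omega> * h \<omega> \<partial>\<phi>) = (\<integral>\<omega>. h \<omega> \<partial>\<phi>) - (\<integral>\<omega>. indicator a \<omega> * h \<omega> \<partial>\<phi>)"
            by (rule Bochner_Integration.integral_diff[OF int[OF h]])
          moreover have "(\<integral>\<omega>. h \<omega> - indicator a \<omega> * h \<omega> \<partial>\<phi>) = (\<integral>\<omega>. indicator (configs E - a) \<omega> * h \<omega> \<partial>\<phi>)"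
            using space by (intro Bochner_Integration.integral_cong refl) (auto simp: indicator_def)
          ultimately show ?thesis by (simp add: set_lebesgue_integral_def)
        qed
        \<comment> \<open>The cylinder with empty base is the whole space; it gives the equality of
          total integrals needed for complements.\<close>
        have "(\<integral>\<omega>. indicator (cylinder E {} {}) \<omega> * ?L \<omega> \<partial>\<phi>) =
            (\<integral>\<omega>. indicator (cylinder E {} {}) \<omega> * cond_prob e \<omega> \<partial>\<phi>)"
          by (rule limit_measure_edge_cylinder[OF \<phi> e]) auto
        moreover have "(\<integral>\<omega>. indicator (cylinder E {} {}) \<omega> * h \<omega> \<partial>\<phi>) = (\<integral>\<omega>. h \<omega> \<partial>\<phi>)" for h :: "('e \<Rightarrow> bool) \<Rightarrow> real"
          using space by (intro Bochner_Integration.integral_cong refl) (simp add: cylinder_def)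
        ultimately have "(\<integral>\<omega>. ?L \<omega> \<partial>\<phi>) = (\<integral>\<omega>. cond_prob e \<omega> \<partial>\<phi>)" by simp
        then show ?case using compl unfolding c[OF Lb] c[OF cb] by simp
      next
        case (union A)
        have A: "A i \<in> sets \<phi>" for i using union(2) sub by blast
        have "set_lebesgue_integral \<phi> (\<Union>i. A i) h = suminf (\<lambda>i. set_lebesgue_integral \<phi> (A i) h)"
          if h: "bounded_measurable E h" for h
        proof (rule lebesgue_integral_countable_add[OF A])
          show "A i \<inter> A j = {}" if "i \<noteq> j" for i j
            using union(1) that by (auto simp: disjoint_family_on_def)
          have "(\<Union>i. A i) \<in> sets (config_space E)" using A lm(2) by (metis sets.countable_UN UNIV_I image_subsetI)
          then have "integrable \<phi> (\<lambda>\<omega>. indicator (\<Union>i. A i) \<omega> * h \<omega>)"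
            by (intro int bounded_measurable_mult h bounded_measurable_indicator)
          then show "set_integrable \<phi> (\<Union>i. A i) h" by (simp add: set_integrable_def)
        qed
        then show ?case using union(3) Lb cb by simp
      qed
    qed
    have intL: "integrable \<phi> ?L" and intc: "integrable \<phi> (cond_prob e)" by (rule int[OF Lb], rule int[OF cb])
    have inv: "cond_prob e (fun_upd \<omega> e True) = cond_prob e \<omega>" if "\<omega> \<in> configs E" for \<omega>
      using that e by (intro cond_prob_agree) (auto simp: agree_on_def PiE_iff extensional_def)
    have cm: "cond_prob e \<in> borel_measurable (sigma_off E e)"
      using cb by (intro measurable_sigma_off_if_invariant e inv) (auto simp: bounded_measurable_def)
    show ?thesis
      by (rule real_cond_exp_charact[OF _ intL intc cm]) (use eq in \<open>simp only: sets_sigma_off_cylinder\<close>)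
  qed
  then show ?thesis using lm(1,2) by (simp add: DLR_random_cluster_def cond_prob_def)
qed

lemma DLR_eq_limit_unique:
  "DLR_random_cluster E ends p q = limit_random_cluster V E ends p q \<and>
   (\<exists>!\<phi>. \<phi> \<in> DLR_random_cluster E ends p q)"
proof -
  obtain \<phi> where \<phi>: "limit_measure \<phi>" using ex_limit_measure by blast
  have "DLR_random_cluster E ends p q = {\<phi>}"
    using DLR_eq_limit_measure[OF \<phi>] limit_measure_in_DLR[OF \<phi>] by blast
  moreover have "limit_random_cluster V E ends p q = {\<phi>}"
    using limit_random_cluster_eq_limit_measure[OF \<phi>] limit_measure_in_limit_random_cluster[OF \<phi>] by blast
  ultimately show ?thesis by auto
qed

end

section \<open>Charts of cells and faces of polyhedra\<close>

text \<open>
  The library proves the following facts for linear maps between Euclidean spaces only; here the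
  domain is the space of finitely supported sequences.
\<close>

lemma lookup_scaleR_poly_mapping: "Poly_Mapping.lookup (r *\<^sub>R x) i = r *\<^sub>R Poly_Mapping.lookup x i"
proof -
  have "finite {i. r *\<^sub>R Poly_Mapping.lookup x i \<noteq> 0}"
    by (rule finite_subset[OF _ finite_keys[of x]]) (auto simp: in_keys_iff)
  then show ?thesis by (simp add: scaleR_poly_mapping_def)
qed

lemma affine_hull_linear_image':
  fixes f :: "'a::real_vector \<Rightarrow> 'b::real_vector"
  assumes f: "linear f"
  shows "f ` (affine hull S) = affine hull (f ` S)"
proof (rule equalityI)
  have comb: "f (u *\<^sub>R x + v *\<^sub>R y) = u *\<^sub>R f x + v *\<^sub>R f y" for u v x y
    using f by (simp add: linear_add linear_scale)
  have "affine (f -` (affine hull (f ` S)))"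
    using affine_affine_hull[of "f ` S"] unfolding affine_def by (simp add: comb)
  moreover have "S \<subseteq> f -` (affine hull (f ` S))" by (auto intro: hull_inc)
  ultimately have "affine hull S \<subseteq> f -` (affine hull (f ` S))" by (rule hull_minimal[rotated])
  then show "f ` (affine hull S) \<subseteq> affine hull (f ` S)" by auto
  have "affine (f ` (affine hull S))"
    unfolding affine_def[of "f ` (affine hull S)"]
  proof (intro ballI allI impI)
    fix x y and u v :: real assume "x \<in> f ` (affine hull S)" "y \<in> f ` (affine hull S)" and uv: "u + v = 1"
    then obtain x' y' where xy: "x = f x'" "y = f y'" "x' \<in> affine hull S" "y' \<in> affine hull S" by auto
    have "u *\<^sub>R x' + v *\<^sub>R y' \<in> affine hull S"
      using affine_affine_hull[of S] xy uv unfolding affine_def by blast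
    then show "u *\<^sub>R x + v *\<^sub>R y \<in> f ` (affine hull S)" unfolding xy comb[symmetric] by (rule imageI)
  qed
  with image_mono[OF hull_subset] show "affine hull (f ` S) \<subseteq> f ` (affine hull S)"
    by (rule hull_minimal)
qed

lemma affine_independent_linear_image:
  fixes f :: "'a::real_vector \<Rightarrow> 'b::real_vector"
  assumes f: "linear f" "inj_on f (affine hull S)" and S: "\<not> affine_dependent S"
  shows "\<not> affine_dependent (f ` S)"
proof
  assume "affine_dependent (f ` S)"
  then obtain x where x: "x \<in> S" "f x \<in> affine hull (f ` S - {f x})"
    unfolding affine_dependent_def by auto
  have xS: "x \<in> affine hull S" by (rule hull_inc[OF x(1)])
  have "f ` S - {f x} = f ` (S - {x})"
    using inj_on_subset[OF f(2) hull_subset] x(1) by (auto simp: inj_on_def)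
  then have "f x \<in> f ` (affine hull (S - {x}))"
    using x(2) affine_hull_linear_image'[OF f(1)] by metis
  then obtain z where z: "z \<in> affine hull (S - {x})" "f x = f z" by auto
  have "z \<in> affine hull S" using z(1) hull_mono[of "S - {x}" S] by blast
  then have "z = x" using z(2) xS f(2) by (auto simp: inj_on_def)
  then show False using z(1) x(1) S unfolding affine_dependent_def by blast
qed

text \<open>As \<open>C\<close> is convex, the nonnegative multiples of differences of its points
  already form a subspace \<open>D\<close>, and the affine hull lies in a translate of it. A vector
  of \<open>D\<close> killed by \<open>f\<close> is a multiple of a difference of two points of
  \<open>C\<close> with the same image, hence zero.\<close>

lemma inj_on_affine_hull_convex:
  fixes f :: "'a::real_vector \<Rightarrow> 'b::real_vector"
  assumes f: "linear f" "inj_on f C" and C: "convex C"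
  shows "inj_on f (affine hull C)"
proof (cases "C = {}")
  case False
  then obtain a where a: "a \<in> C" by auto
  define D where "D = {s *\<^sub>R (p - q) | s p q. 0 \<le> s \<and> p \<in> C \<and> q \<in> C}"
  have D: "subspace D"
    unfolding subspace_def
  proof (intro conjI ballI allI)
    show "0 \<in> D" unfolding D_def using a by (intro CollectI exI[of _ 0] exI[of _ a]) auto
  next
    fix x y assume "x \<in> D" "y \<in> D"
    then obtain s p q s' p' q' where x: "x = s *\<^sub>R (p - q)" "0 \<le> s" "p \<in> C" "q \<in> C"
      and y: "y = s' *\<^sub>R (p' - q')" "0 \<le> s'" "p' \<in> C" "q' \<in> C" unfolding D_def by blast
    show "x + y \<in> D"
    proof (cases "s + s' = 0")
      case True
      then have "x = 0" "y = 0" using x y by auto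
      then show ?thesis unfolding D_def using a by (intro CollectI exI[of _ 0] exI[of _ a]) auto
    next
      case False
      then have pos: "0 < s + s'" using x y by auto
      \<comment> \<open>The two differences are combined with weights proportional to
        \<open>s\<close> and \<open>s'\<close>, so that convexity keeps both end points in
        \<open>C\<close>.\<close>
      let ?u = "s / (s + s')" and ?v = "s' / (s + s')"
      have uv: "0 \<le> ?u" "0 \<le> ?v" "?u + ?v = 1" using x y pos by (auto simp flip: add_divide_distrib)
      have "?u *\<^sub>R p + ?v *\<^sub>R p' \<in> C" "?u *\<^sub>R q + ?v *\<^sub>R q' \<in> C"
        using C x y uv by (auto intro!: convexD)
      moreover have "x + y = (s + s') *\<^sub>R ((?u *\<^sub>R p + ?v *\<^sub>R p') - (?u *\<^sub>R q + ?v *\<^sub>R q'))"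
        using pos unfolding x y by (simp add: scaleR_diff_right scaleR_add_right)
      ultimately show ?thesis unfolding D_def using pos by fastforce
    qed
  next
    fix c :: real and x assume "x \<in> D"
    then obtain s p q where x: "x = s *\<^sub>R (p - q)" "0 \<le> s" "p \<in> C" "q \<in> C" unfolding D_def by blast
    show "c *\<^sub>R x \<in> D"
    proof (cases "0 \<le> c")
      case True
      then have "c *\<^sub>R x = (c * s) *\<^sub>R (p - q)" "0 \<le> c * s" using x by auto
      then show ?thesis unfolding D_def using x by blast
    next
      case False
      then have "c *\<^sub>R x = (- c * s) *\<^sub>R (q - p)" "0 \<le> - c * s"
        using x by (auto simp: scaleR_diff_right mult_nonpos_nonneg)
      then show ?thesis unfolding D_def using x by blast
    qed
  qed
  have "affine {x. x - a \<in> D}"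
    unfolding affine_def
  proof (intro ballI allI impI)
    fix x y and u v :: real assume xy: "x \<in> {x. x - a \<in> D}" "y \<in> {x. x - a \<in> D}" and uv: "u + v = 1"
    have "u *\<^sub>R x + v *\<^sub>R y - a = u *\<^sub>R x + v *\<^sub>R y - (u + v) *\<^sub>R a" using uv by simp
    also have "\<dots> = u *\<^sub>R (x - a) + v *\<^sub>R (y - a)" by (simp add: algebra_simps)
    finally show "u *\<^sub>R x + v *\<^sub>R y \<in> {x. x - a \<in> D}"
      using xy D by (auto intro: subspace_add subspace_scale)
  qed
  moreover have "C \<subseteq> {x. x - a \<in> D}"
  proof
    fix x assume "x \<in> C"
    then show "x \<in> {x. x - a \<in> D}"
      unfolding D_def using a by (intro CollectI exI[of _ 1] exI[of _ x] exI[of _ a]) auto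
  qed
  ultimately have hull: "affine hull C \<subseteq> {x. x - a \<in> D}" by (rule hull_minimal[rotated])
  show ?thesis
  proof (rule inj_onI)
    fix x y assume xy: "x \<in> affine hull C" "y \<in> affine hull C" "f x = f y"
    have "(x - a) - (y - a) \<in> D" using hull xy D by (blast intro: subspace_diff)
    then have "x - y \<in> D" by simp
    then obtain s p q where d: "x - y = s *\<^sub>R (p - q)" "p \<in> C" "q \<in> C" unfolding D_def by blast
    have "f (x - y) = s *\<^sub>R (f p - f q)"
      unfolding d(1) using f(1) by (simp add: linear_diff linear_scale)
    moreover have "f (x - y) = 0" using xy(3) f(1) by (simp add: linear_diff)
    ultimately have "s = 0 \<or> f p = f q" by auto
    then have "s = 0 \<or> p = q" using f(2) d by (auto simp: inj_on_def)
    then have "s *\<^sub>R (p - q) = 0" by auto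
    then have "x - y = 0" unfolding d(1) .
    then show "x = y" by simp
  qed
qed simp

lemma linear_image_affine_inverse:
  fixes f :: "'a::real_vector \<Rightarrow> 'b::real_vector"
  assumes f: "linear f" "inj_on f (affine hull S)"
  shows "\<exists>g b. linear g \<and> (\<forall>x\<in>affine hull S. g (f x) + b = x)"
proof (cases "S = {}")
  case True
  then show ?thesis by (intro exI[of _ "\<lambda>_. 0"]) (simp add: linear_zero)
next
  case False
  then obtain a where a: "a \<in> affine hull S" using hull_subset[of S affine] by fastforce
  let ?V = "(\<lambda>x. x - a) ` (affine hull S)"
  have V: "subspace ?V" by (rule affine_diffs_subspace_subtract[OF affine_affine_hull a])
  have "inj_on f ?V"
    using f by (auto simp: inj_on_def linear_diff)
  from linear_exists_left_inverse_on[OF f(1) V this]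
  obtain g where g: "linear g" "\<And>v. v \<in> ?V \<Longrightarrow> g (f v) = v" by auto
  show ?thesis
  proof (intro exI[of _ g] exI[of _ "a - g (f a)"] conjI ballI g(1))
    fix x assume "x \<in> affine hull S"
    then have "g (f (x - a)) = x - a" by (intro g(2)) auto
    then show "g (f x) + (a - g (f a)) = x" using f(1) g(1) by (simp add: linear_diff algebra_simps)
  qed
qed

text \<open>If \<open>A\<close> lies neither in \<open>T\<close> nor in the union of the others,
  take a segment in \<open>A\<close> from a point outside \<open>T\<close> to a point outside that
  union. An affine set with two points of the segment contains both ends, so each set meets it in at
  most one point, and finitely many points do not fill it.\<close>

lemma convex_subset_finite_Union_affine:
  fixes A :: "'a::real_vector set"
  assumes "finite \<T>" "\<And>T. T \<in> \<T> \<Longrightarrow> affine T" "convex A" "A \<noteq> {}" "A \<subseteq> \<Union>\<T>"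
  shows "\<exists>T\<in>\<T>. A \<subseteq> T"
  using assms(1,2,5)
proof (induction \<T> rule: finite_induct)
  case empty
  then show ?case using assms(4) by auto
next
  case (insert T \<T>)
  show ?case
  proof (cases "A \<subseteq> T \<or> A \<subseteq> \<Union>\<T>")
    case True
    then show ?thesis using insert by auto
  next
    case False
    then obtain x y where x: "x \<in> A" "x \<notin> T" and y: "y \<in> A" "y \<notin> \<Union>\<T>" by blast
    define z where "z t = (1 - t) *\<^sub>R x + t *\<^sub>R y" for t
    have zz: "a *\<^sub>R z s + b *\<^sub>R z t = (a * (1 - s) + b * (1 - t)) *\<^sub>R x + (a * s + b * t) *\<^sub>R y" for a b s t
      unfolding z_def by (simp add: algebra_simps)
    have line: "x \<in> U \<and> y \<in> U" if U: "affine U" and s: "z s \<in> U" "z t \<in> U" "s \<noteq> t" for U s t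
    proof -
      obtain k where k: "t = s + k" "k \<noteq> 0"
        using s(3) by (metis add.right_neutral add_diff_cancel_left' diff_add_cancel add.commute)
      have "t / (t - s) + - s / (t - s) = 1" "(t - 1) / (t - s) + (1 - s) / (t - s) = 1"
        using k(2) unfolding k(1) by (simp_all add: field_simps)
      \<comment> \<open>These coefficients express \<open>x\<close> and \<open>y\<close> as affine
        combinations of \<open>z s\<close> and \<open>z t\<close>.\<close>
      then have "(t / (t - s)) *\<^sub>R z s + (- s / (t - s)) *\<^sub>R z t \<in> U"
        "((t - 1) / (t - s)) *\<^sub>R z s + ((1 - s) / (t - s)) *\<^sub>R z t \<in> U"
        using U s unfolding affine_def by blast+
      moreover have "(t / (t - s)) *\<^sub>R z s + (- s / (t - s)) *\<^sub>R z t = x"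
      proof -
        have "(t / (t - s)) *\<^sub>R z s + (- s / (t - s)) *\<^sub>R z t =
            (t / (t - s) * (1 - s) + - s / (t - s) * (1 - t)) *\<^sub>R x + (t / (t - s) * s + - s / (t - s) * t) *\<^sub>R y"
          by (rule zz)
        moreover have "t / (t - s) * (1 - s) + - s / (t - s) * (1 - t) = 1"
          using k(2) unfolding k(1) by (simp add: field_simps)
        moreover have "t / (t - s) * s + - s / (t - s) * t = 0" by simp
        ultimately show ?thesis by simp
      qed
      moreover have "((t - 1) / (t - s)) *\<^sub>R z s + ((1 - s) / (t - s)) *\<^sub>R z t = y"
      proof -
        have "((t - 1) / (t - s)) *\<^sub>R z s + ((1 - s) / (t - s)) *\<^sub>R z t =
            ((t - 1) / (t - s) * (1 - s) + (1 - s) / (t - s) * (1 - t)) *\<^sub>R x +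
            ((t - 1) / (t - s) * s + (1 - s) / (t - s) * t) *\<^sub>R y"
          by (rule zz)
        moreover have "(t - 1) / (t - s) * (1 - s) + (1 - s) / (t - s) * (1 - t) = 0"
          using k(2) unfolding k(1) by (simp add: field_simps)
        moreover have "(t - 1) / (t - s) * s + (1 - s) / (t - s) * t = 1"
          using k(2) unfolding k(1) by (simp add: field_simps)
        ultimately show ?thesis by simp
      qed
      ultimately show ?thesis by simp
    qed
    have "finite {t \<in> {0..1}. z t \<in> U}" if U: "U \<in> insert T \<T>" for U
    proof -
      have "\<not> (x \<in> U \<and> y \<in> U)" using x y U by auto
      then have "s = t" if "z s \<in> U" "z t \<in> U" for s t
        using line[of U s t] insert.prems(1)[OF U] that by blast
      then have eq: "s = t" if "s \<in> {t \<in> {0..1}. z t \<in> U}" "t \<in> {t \<in> {0..1}. z t \<in> U}" for s t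
        using that by simp
      show ?thesis
      proof (cases "{t \<in> {0..1}. z t \<in> U} = {}")
        case False
        then obtain s where s: "s \<in> {t \<in> {0..1}. z t \<in> U}" by blast
        have "{t \<in> {0..1}. z t \<in> U} \<subseteq> {s}"
        proof
          fix t assume "t \<in> {t \<in> {0..1}. z t \<in> U}"
          then show "t \<in> {s}" using eq[OF _ s] by blast
        qed
        then show ?thesis by (rule finite_subset) simp
      qed (simp only: finite.emptyI)
    qed
    then have "finite (\<Union>U\<in>insert T \<T>. {t \<in> {0..1}. z t \<in> U})" using insert.hyps by blast
    moreover have "{0..1} \<subseteq> (\<Union>U\<in>insert T \<T>. {t \<in> {0..1}. z t \<in> U})"
    proof
      fix t :: real assume t: "t \<in> {0..1}"
      then have "z t \<in> A" unfolding z_def using x y assms(3) by (auto intro: convexD_alt)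
      then show "t \<in> (\<Union>U\<in>insert T \<T>. {t \<in> {0..1}. z t \<in> U})" using t insert.prems(2) by auto
    qed
    ultimately have "finite {0..1::real}" by (rule finite_subset[rotated])
    then show ?thesis by (simp add: infinite_Icc)
  qed
qed

section \<open>Convex cells as polyhedra in Euclidean space\<close>

lemma coord_space_combine:
  assumes "x \<in> coord_space l" "y \<in> coord_space l"
  shows "u *\<^sub>R x + v *\<^sub>R y \<in> coord_space l"
proof -
  have "Poly_Mapping.keys (u *\<^sub>R x + v *\<^sub>R y) \<subseteq> Poly_Mapping.keys x \<union> Poly_Mapping.keys y"
    by (auto simp: in_keys_iff lookup_add lookup_scaleR_poly_mapping)
  then show ?thesis using assms unfolding coord_space_def by blast
qed

lemma convex_cell_convex: assumes "convex_cell A" shows "convex A"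
proof -
  obtain l \<H> where A: "\<And>H. H \<in> \<H> \<Longrightarrow> closed_halfspace l H" "A = coord_space l \<inter> \<Inter>\<H>"
    using assms unfolding convex_cell_def by blast
  have "convex H" if HH: "H \<in> \<H>" for H
  proof -
    obtain a :: "nat \<Rightarrow> real" and b where H: "H = {x \<in> coord_space l. (\<Sum>i<l. a i * Poly_Mapping.lookup x i) \<le> b}"
      using A(1)[OF HH] unfolding closed_halfspace_def by blast
    show ?thesis
      unfolding convex_def
    proof (intro ballI allI impI)
      fix x y and u v :: real assume xy: "x \<in> H" "y \<in> H" and uv: "0 \<le> u" "0 \<le> v" "u + v = 1"
      have "(\<Sum>i<l. a i * Poly_Mapping.lookup (u *\<^sub>R x + v *\<^sub>R y) i) =
          u * (\<Sum>i<l. a i * Poly_Mapping.lookup x i) + v * (\<Sum>i<l. a i * Poly_Mapping.lookup y i)"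
        by (simp add: lookup_add lookup_scaleR_poly_mapping algebra_simps sum.distrib sum_distrib_left)
      also have "\<dots> \<le> b" using xy uv unfolding H by (intro convex_bound_le) auto
      finally show "u *\<^sub>R x + v *\<^sub>R y \<in> H" using xy coord_space_combine unfolding H by auto
    qed
  qed
  moreover have "convex (coord_space l)" unfolding convex_def using coord_space_combine by blast
  ultimately show ?thesis unfolding A(2) by (intro convex_Int convex_Inter) auto
qed

text \<open>The affine inverse of \<open>L\<close> on the affine hull carries each half-space of the
  cell to the image side, where its functional becomes an inner product with a vector
  \<open>w\<close>. Intersecting with the affine hull of the image then gives exactly the
  image.\<close>

lemma polyhedron_linear_image_convex_cell:
  fixes L :: "fin_seq \<Rightarrow> 'b::euclidean_space"
  assumes C: "convex_cell C" and L: "linear L" "inj_on L C"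
  shows "polyhedron (L ` C)"
proof -
  obtain l \<H> where fin: "finite \<H>" and A: "\<And>H. H \<in> \<H> \<Longrightarrow> closed_halfspace l H" "C = coord_space l \<inter> \<Inter>\<H>"
    using C unfolding convex_cell_def by blast
  have inj: "inj_on L (affine hull C)" by (rule inj_on_affine_hull_convex[OF L convex_cell_convex[OF C]])
  obtain g b where g: "linear g" "\<forall>x\<in>affine hull C. g (L x) + b = x"
    using linear_image_affine_inverse[OF L(1) inj] by (elim exE conjE)
  have "affine (coord_space l)" unfolding affine_def using coord_space_combine by blast
  then have hull_coord: "affine hull C \<subseteq> coord_space l" using A(2) by (intro hull_minimal) auto
  have "\<exists>P. polyhedron P \<and> (\<forall>x\<in>affine hull C. L x \<in> P \<longleftrightarrow> x \<in> H)" if H: "H \<in> \<H>" for H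
  proof -
    obtain a :: "nat \<Rightarrow> real" and r where Ha: "H = {x \<in> coord_space l. (\<Sum>i<l. a i * Poly_Mapping.lookup x i) \<le> r}"
      using A(1)[OF H] unfolding closed_halfspace_def by blast
    define F where "F x = (\<Sum>i<l. a i * Poly_Mapping.lookup x i)" for x :: fin_seq
    have F: "linear F"
      unfolding F_def by (rule linearI) (simp_all add: lookup_add lookup_scaleR_poly_mapping algebra_simps sum.distrib sum_distrib_left)
    have Fg: "linear (\<lambda>y. F (g y))" using linear_compose[OF g(1) F] by (simp add: o_def)
    define w where "w = adjoint (\<lambda>y. F (g y)) 1"
    have w: "F (g y) = w \<bullet> y" for y
      using adjoint_works[OF Fg, of y 1] by (simp add: w_def inner_commute)
    have "L x \<in> {y. w \<bullet> y \<le> r - F b} \<longleftrightarrow> x \<in> H" if x: "x \<in> affine hull C" for x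
    proof -
      have "F x = F (g (L x) + b)" using g(2) x by simp
      also have "\<dots> = w \<bullet> L x + F b" using F w by (simp add: linear_add)
      finally show ?thesis using x hull_coord unfolding Ha F_def[symmetric] by auto
    qed
    then show ?thesis using polyhedron_halfspace_le by blast
  qed
  then have "\<forall>H\<in>\<H>. \<exists>P. polyhedron P \<and> (\<forall>x\<in>affine hull C. L x \<in> P \<longleftrightarrow> x \<in> H)" by (rule ballI)
  from bchoice[OF this] obtain P where
    "\<forall>H\<in>\<H>. polyhedron (P H) \<and> (\<forall>x\<in>affine hull C. L x \<in> P H \<longleftrightarrow> x \<in> H)" by (elim exE)
  then have P: "\<And>H. H \<in> \<H> \<Longrightarrow> polyhedron (P H)"
    "\<And>H x. H \<in> \<H> \<Longrightarrow> x \<in> affine hull C \<Longrightarrow> L x \<in> P H \<longleftrightarrow> x \<in> H" by simp_all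
  have "L ` C = affine hull (L ` C) \<inter> \<Inter>(P ` \<H>)"
  proof (intro equalityI subsetI)
    fix y assume "y \<in> L ` C"
    then obtain x where x: "y = L x" "x \<in> C" by auto
    then have "x \<in> affine hull C" by (simp add: hull_inc)
    then show "y \<in> affine hull (L ` C) \<inter> \<Inter>(P ` \<H>)" using x A(2) P(2) by (auto intro: hull_inc)
  next
    fix y assume y: "y \<in> affine hull (L ` C) \<inter> \<Inter>(P ` \<H>)"
    then obtain x where x: "y = L x" "x \<in> affine hull C" using affine_hull_linear_image'[OF L(1), of C] by blast
    have "x \<in> H" if "H \<in> \<H>" for H using P(2)[OF that x(2)] y x(1) that by blast
    then have "x \<in> C" using x(2) hull_coord by (subst A(2)) blast
    then show "y \<in> L ` C" using x by auto
  qed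
  moreover have "polyhedron (affine hull (L ` C) \<inter> \<Inter>(P ` \<H>))"
    using fin P(1) by (intro polyhedron_Int polyhedron_affine_hull polyhedron_Inter) auto
  ultimately show ?thesis by simp
qed

lemma open_segment_linear_image_inj_on:
  fixes f :: "'a::real_vector \<Rightarrow> 'b::real_vector"
  assumes "linear f" "a \<noteq> b" "f a \<noteq> f b"
  shows "open_segment (f a) (f b) = f ` open_segment a b"
proof -
  have "f ((1 - u) *\<^sub>R a + u *\<^sub>R b) = (1 - u) *\<^sub>R f a + u *\<^sub>R f b" for u
    using assms(1) by (simp add: linear_add linear_scale)
  then have "(1 - u) *\<^sub>R f a + u *\<^sub>R f b = f ((1 - u) *\<^sub>R a + u *\<^sub>R b)" for u by simp
  then show ?thesis
    using assms(2,3) unfolding set_eq_iff image_iff Bex_def in_segment(2) by metis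
qed

text \<open>Injectivity is available on \<open>A\<close> only; convexity keeps all segments in
  question inside \<open>A\<close>.\<close>

lemma face_of_linear_image_inj_on:
  fixes f :: "'a::real_vector \<Rightarrow> 'b::real_vector"
  assumes f: "linear f" "inj_on f A" and A: "convex A" and B: "B \<subseteq> A"
  shows "f ` B face_of f ` A \<longleftrightarrow> B face_of A"
proof -
  have conv: "convex (f ` B) \<longleftrightarrow> convex B"
  proof
    assume c: "convex (f ` B)"
    show "convex B"
      unfolding convex_def
    proof (intro ballI allI impI)
      fix x y and u v :: real assume xy: "x \<in> B" "y \<in> B" and uv: "0 \<le> u" "0 \<le> v" "u + v = 1"
      have "u *\<^sub>R f x + v *\<^sub>R f y \<in> f ` B" using c xy uv by (auto intro!: convexD)
      moreover have "u *\<^sub>R f x + v *\<^sub>R f y = f (u *\<^sub>R x + v *\<^sub>R y)" using f(1) by (simp add: linear_add linear_scale)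
      moreover have "u *\<^sub>R x + v *\<^sub>R y \<in> A" using A xy uv B by (auto intro!: convexD)
      ultimately show "u *\<^sub>R x + v *\<^sub>R y \<in> B" using f(2) B by (auto simp: inj_on_def subset_iff)
    qed
  qed (rule convex_linear_image[OF f(1)])
  have mem: "f x \<in> f ` B \<longleftrightarrow> x \<in> B" if "x \<in> A" for x using that f(2) B by (auto simp: inj_on_def)
  have seg: "(f x \<in> open_segment (f a) (f b)) \<longleftrightarrow> x \<in> open_segment a b" if "a \<in> A" "b \<in> A" "x \<in> A" for a b x
  proof (cases "a = b")
    case False
    then have "f a \<noteq> f b" using f(2) that by (auto simp: inj_on_def)
    then have "open_segment (f a) (f b) = f ` open_segment a b"
      by (rule open_segment_linear_image_inj_on[OF f(1) False])
    moreover have "open_segment a b \<subseteq> A"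
      using closed_segment_subset[OF that(1,2) A] segment_open_subset_closed by blast
    ultimately show ?thesis using f(2) that(3) by (auto simp: inj_on_def)
  qed simp
  show ?thesis
    unfolding face_of_def conv using B mem seg by (auto simp: subset_iff)
qed

lemma has_dimension_linear_image:
  fixes f :: "'a::real_vector \<Rightarrow> 'b::euclidean_space"
  assumes f: "linear f" "inj_on f (affine hull B)" and B: "B \<noteq> {}"
  shows "has_dimension B j \<longleftrightarrow> aff_dim (f ` B) = int j"
proof -
  have *: "aff_dim (f ` B) = int i \<and> finite B'"
    if B': "affine hull B' = affine hull B" "\<not> affine_dependent B'" "card B' = i + 1" for B' i
  proof -
    have fin: "finite B'" using B'(3) by (intro card_ge_0_finite) simp
    have inj: "inj_on f (affine hull B')" using f(2) B'(1) by simp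
    have "card (f ` B') = i + 1"
      using card_image[OF inj_on_subset[OF inj hull_subset]] B'(3) by simp
    moreover have "affine hull (f ` B') = affine hull (f ` B)"
      using B'(1) affine_hull_linear_image'[OF f(1)] by metis
    moreover have "\<not> affine_dependent (f ` B')" by (rule affine_independent_linear_image[OF f(1) inj B'(2)])
    ultimately show ?thesis using fin aff_dim_unique[of "f ` B'" "f ` B"] by simp
  qed
  obtain B0 where B0: "B0 \<subseteq> B" "\<not> affine_dependent B0" "affine hull B = affine hull B0"
    using affine_basis_exists[of B] by blast
  have inj0: "inj_on f (affine hull B0)" using f(2) B0(3) by simp
  have "finite (f ` B0)"
    by (rule aff_independent_finite[OF affine_independent_linear_image[OF f(1) inj0 B0(2)]])
  then have fin0: "finite B0" by (rule finite_imageD) (rule inj_on_subset[OF inj0 hull_subset])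
  have "B0 \<noteq> {}" using B0(3) B by auto
  then obtain i where i: "card B0 = i + 1" using fin0 by (metis Suc_eq_plus1 card_eq_0_iff not0_implies_Suc)
  have dim: "aff_dim (f ` B) = int i" using *[of B0 i] B0 i by auto
  show ?thesis
  proof
    assume "has_dimension B j"
    then show "aff_dim (f ` B) = int j" unfolding has_dimension_def using * by blast
  next
    assume "aff_dim (f ` B) = int j"
    then have "i = j" using dim by simp
    then show "has_dimension B j" unfolding has_dimension_def using B0 i by auto
  qed
qed

text \<open>Among the finitely many affine pieces of \<phi> one spans the affine hull of the whole
  cell, since the affine hulls of the pieces cover a convex set. The linear part of \<phi> on that
  piece is injective there, hence on the hull.\<close>

lemma cell_chart_linear:
  fixes \<phi> :: "fin_seq \<Rightarrow> real^'d"
  assumes "cell_chart m A \<phi>"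
  obtains L :: "fin_seq \<Rightarrow> real^'d" where "linear L" "inj_on L (affine hull A)"
proof -
  have A: "convex_cell A" "has_dimension A m" "inj_on \<phi> A" "piecewise_affine_on A \<phi>"
    using assms by (auto simp: cell_chart_def)
  obtain \<C> where C: "finite \<C>" "\<forall>C\<in>\<C>. convex_cell C" "A = \<Union>\<C>"
    "\<forall>C\<in>\<C>. \<exists>L c. linear L \<and> (\<forall>x\<in>C. \<phi> x = L x + c)"
    using A(4) unfolding piecewise_affine_on_def by blast
  have "A \<noteq> {}"
  proof
    assume "A = {}"
    then obtain B :: "fin_seq set" where "affine hull B = {}" "card B = m + 1" using A(2) by (auto simp: has_dimension_def)
    then show False by simp
  qed
  then have "\<exists>T\<in>(\<lambda>C. affine hull C) ` \<C>. A \<subseteq> T"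
    using C(1,3) by (intro convex_subset_finite_Union_affine convex_cell_convex[OF A(1)]) (auto intro: hull_inc)
  then obtain C where C': "C \<in> \<C>" "A \<subseteq> affine hull C" by auto
  then have hull: "affine hull A = affine hull C"
    using C(3) by (metis Union_upper hull_hull hull_mono subset_antisym)
  obtain L c where L: "linear L" "\<And>x. x \<in> C \<Longrightarrow> \<phi> x = L x + c" using C(4) C'(1) by blast
  have "inj_on L C"
  proof (rule inj_onI)
    fix x y assume xy: "x \<in> C" "y \<in> C" "L x = L y"
    then have "\<phi> x = \<phi> y" using L(2) by simp
    moreover have "x \<in> A" "y \<in> A" using xy C(3) C'(1) by auto
    ultimately show "x = y" using A(3) by (auto dest: inj_onD)
  qed
  then have "inj_on L (affine hull A)"
    unfolding hull using C(2) C'(1) by (intro inj_on_affine_hull_convex L(1) convex_cell_convex) auto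
  with L(1) show ?thesis by (rule that)
qed

text \<open>A linear embedding \<open>L\<close> moves the domain of the chart into the target space.
  It need not agree with \<phi>: \<open>\<psi>\<close> undoes \<open>L\<close> and then applies
  \<phi>, so that the cell and its faces stay the same.\<close>

lemma cell_chart_euclidean:
  fixes \<phi> :: "fin_seq \<Rightarrow> real^'d"
  assumes "cell_chart m A \<phi>"
  shows "\<exists>Q \<psi>. polyhedron (Q :: (real^'d) set) \<and> aff_dim Q = int m \<and> inj_on \<psi> Q \<and> continuous_on Q \<psi> \<and>
    (\<forall>i. (\<lambda>B. \<phi> ` B) ` cell_faces A i = (\<lambda>T. \<psi> ` T) ` {T. T face_of Q \<and> aff_dim T = int i})"
proof -
  have A: "convex_cell A" "has_dimension A m" "inj_on \<phi> A" "continuous_on A \<phi>"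
    using assms by (auto simp: cell_chart_def)
  obtain L :: "fin_seq \<Rightarrow> real^'d" where L: "linear L" "inj_on L (affine hull A)"
    by (rule cell_chart_linear[OF assms])
  have LA: "inj_on L A" by (rule inj_on_subset[OF L(2) hull_subset])
  obtain g b where g: "linear g" "\<forall>x\<in>affine hull A. g (L x) + b = x"
    using linear_image_affine_inverse[OF L] by (elim exE conjE)
  have inv: "g (L x) + b = x" if "x \<in> A" for x using g(2) hull_inc[OF that, of affine] by blast
  define Q where "Q = L ` A"
  define \<psi> where "\<psi> y = \<phi> (g y + b)" for y
  have \<psi>L: "\<psi> (L x) = \<phi> x" if "x \<in> A" for x unfolding \<psi>_def inv[OF that] ..
  have ne: "A \<noteq> {}"
  proof
    assume "A = {}"
    then obtain B :: "fin_seq set" where "affine hull B = {}" "card B = m + 1" using A(2) by (auto simp: has_dimension_def)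
    then show False by simp
  qed
  have dim: "has_dimension B i \<longleftrightarrow> aff_dim (L ` B) = int i" if "B \<subseteq> A" "B \<noteq> {}" for B i
    by (rule has_dimension_linear_image[OF L(1) inj_on_subset[OF L(2) hull_mono[OF that(1)]] that(2)])
  have conv: "convex A" by (rule convex_cell_convex[OF A(1)])
  have "polyhedron Q" unfolding Q_def by (rule polyhedron_linear_image_convex_cell[OF A(1) L(1) LA])
  moreover have "aff_dim Q = int m" unfolding Q_def using dim[of A m] A(2) ne by simp
  moreover have "inj_on \<psi> Q"
    unfolding Q_def inj_on_def using \<psi>L A(3) by (auto dest: inj_onD)
  moreover have "continuous_on Q \<psi>"
  proof -
    have "bounded_linear g" using g(1) by (simp add: linear_conv_bounded_linear)
    then have "continuous_on Q (\<lambda>y. g y + b)"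
      by (intro continuous_intros bounded_linear.continuous_on[of g])
    moreover have "(\<lambda>y. g y + b) ` Q = A" unfolding Q_def using inv by force
    ultimately have "continuous_on Q (\<phi> \<circ> (\<lambda>y. g y + b))"
      using A(4) by (intro continuous_on_compose) auto
    then show ?thesis by (simp add: \<psi>_def[abs_def] o_def)
  qed
  moreover have "(\<lambda>B. \<phi> ` B) ` cell_faces A i = (\<lambda>T. \<psi> ` T) ` {T. T face_of Q \<and> aff_dim T = int i}" for i
  proof (intro equalityI subsetI)
    fix X assume "X \<in> (\<lambda>B. \<phi> ` B) ` cell_faces A i"
    then obtain B where B: "X = \<phi> ` B" "B face_of A" "has_dimension B i" by (auto simp: cell_faces_def)
    have sub: "B \<subseteq> A" using B(2) by (rule face_of_imp_subset)
    have "B \<noteq> {}"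
    proof
      assume "B = {}"
      then obtain B' :: "fin_seq set" where "affine hull B' = {}" "card B' = i + 1" using B(3) by (auto simp: has_dimension_def)
      then show False by simp
    qed
    then have "aff_dim (L ` B) = int i" using dim[OF sub] B(3) by simp
    moreover have "L ` B face_of Q" unfolding Q_def using face_of_linear_image_inj_on[OF L(1) LA conv sub] B(2) by simp
    moreover have "X = \<psi> ` L ` B" unfolding B(1) image_image using \<psi>L sub by (intro image_cong) auto
    ultimately show "X \<in> (\<lambda>T. \<psi> ` T) ` {T. T face_of Q \<and> aff_dim T = int i}" by blast
  next
    fix X assume "X \<in> (\<lambda>T. \<psi> ` T) ` {T. T face_of Q \<and> aff_dim T = int i}"
    then obtain T where T: "X = \<psi> ` T" "T face_of Q" "aff_dim T = int i" by auto
    have "T \<subseteq> L ` A" using face_of_imp_subset[OF T(2)] by (simp add: Q_def)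
    then obtain B where B: "B \<subseteq> A" "T = L ` B" by (auto simp: subset_image_iff)
    have "B \<noteq> {}" using T(3) B(2) by auto
    then have "has_dimension B i" using dim[OF B(1)] T(3) B(2) by simp
    moreover have "B face_of A" using face_of_linear_image_inj_on[OF L(1) LA conv B(1)] T(2) B(2) by (simp add: Q_def)
    moreover have "X = \<phi> ` B" unfolding T(1) B(2) image_image using \<psi>L B(1) by (intro image_cong) auto
    ultimately show "X \<in> (\<lambda>B. \<phi> ` B) ` cell_faces A i" by (auto simp: cell_faces_def)
  qed
  ultimately show ?thesis by blast
qed

text \<open>On each piece \<phi> is, up to a translation, a linear map injective on that piece, so
  the cell is a finite union of closed polyhedra of dimension at most \<open>i\<close>. This covers
  unbounded cells as well.\<close>

lemma is_cell_properties:
  fixes \<sigma> :: "(real^'d) set"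
  assumes "is_cell i \<sigma>"
  shows "closed \<sigma>" "connected \<sigma>" "\<sigma> \<noteq> {}" "i \<le> CARD('d)" "i < CARD('d) \<Longrightarrow> interior \<sigma> = {}"
proof -
  obtain A \<phi> where chart: "cell_chart i A \<phi>" and \<sigma>: "\<sigma> = \<phi> ` A" using assms by (auto simp: is_cell_def)
  have A: "convex_cell A" "has_dimension A i" "inj_on \<phi> A" "continuous_on A \<phi>" "piecewise_affine_on A \<phi>"
    using chart by (auto simp: cell_chart_def)
  obtain \<C> where C: "finite \<C>" "\<forall>C\<in>\<C>. convex_cell C" "A = \<Union>\<C>"
    "\<forall>C\<in>\<C>. \<exists>L c. linear L \<and> (\<forall>x\<in>C. \<phi> x = L x + c)"
    using A(5) unfolding piecewise_affine_on_def by blast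
  obtain B :: "fin_seq set" where B: "affine hull B = affine hull A" "card B = i + 1"
    using A(2) unfolding has_dimension_def by blast
  have finB: "finite B" using B(2) by (intro card_ge_0_finite) simp
  have ne: "A \<noteq> {}" using B by auto
  then show "\<sigma> \<noteq> {}" unfolding \<sigma> by simp
  show "connected \<sigma>" unfolding \<sigma>
    by (rule connected_continuous_image[OF A(4) convex_connected[OF convex_cell_convex[OF A(1)]]])
  have piece: "closed (\<phi> ` C) \<and> aff_dim (\<phi> ` C) \<le> int i" if C': "C \<in> \<C>" for C
  proof -
    obtain L c where L: "linear L" "\<And>x. x \<in> C \<Longrightarrow> \<phi> x = L x + c" using C(4) C' by blast
    have "inj_on L C"
    proof (rule inj_onI)
      fix x y assume xy: "x \<in> C" "y \<in> C" "L x = L y"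
      then have "\<phi> x = \<phi> y" using L(2) by simp
      moreover have "x \<in> A" "y \<in> A" using xy C(3) C' by auto
      ultimately show "x = y" using A(3) by (auto dest: inj_onD)
    qed
    then have "closed (L ` C)"
      using C(2) C' L(1) by (intro polyhedron_imp_closed polyhedron_linear_image_convex_cell) auto
    moreover have eq: "\<phi> ` C = (\<lambda>x. c + x) ` (L ` C)"
      unfolding image_image using L(2) by (intro image_cong) (auto simp: add.commute)
    moreover have "aff_dim (L ` C) \<le> int i"
    proof -
      have "C \<subseteq> affine hull B" using B(1) C(3) C' hull_subset[of A affine] by blast
      then have "L ` C \<subseteq> affine hull (L ` B)" using affine_hull_linear_image'[OF L(1), of B] by blast
      then have "aff_dim (L ` C) \<le> aff_dim (affine hull (L ` B))" by (rule aff_dim_subset)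
      also have "\<dots> \<le> int (card (L ` B)) - 1" using aff_dim_le_card[of "L ` B"] finB by simp
      also have "\<dots> \<le> int i" using card_image_le[OF finB, of L] B(2) by simp
      finally show ?thesis .
    qed
    ultimately show ?thesis by (simp add: closed_translation aff_dim_translation_eq)
  qed
  have \<sigma>_eq: "\<sigma> = \<Union>((\<lambda>C. \<phi> ` C) ` \<C>)" unfolding \<sigma> using C(3) by auto
  show "closed \<sigma>" unfolding \<sigma>_eq using C(1) piece by (intro closed_Union) auto
  show "i \<le> CARD('d)"
  proof -
    obtain Q :: "(real^'d) set" where "aff_dim Q = int i" using cell_chart_euclidean[OF chart] by blast
    then show ?thesis using aff_dim_le_DIM[of Q] by simp
  qed
  assume i: "i < CARD('d)"
  have "interior (\<Union>((\<lambda>C. \<phi> ` C) ` \<D>)) = {}" if "finite \<D>" "\<D> \<subseteq> \<C>" for \<D>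
    using that
  proof (induction \<D> rule: finite_induct)
    case (insert C \<D>)
    have "aff_dim (\<phi> ` C) < DIM(real^'d)" using piece[of C] insert.prems i by simp
    then have "interior (\<phi> ` C) = {}"
      using interior_subset aff_dim_nonempty_interior by force
    moreover have "closed (\<phi> ` C)" using piece insert.prems by blast
    ultimately show ?case
      using interior_closed_Un_empty_interior[of "\<phi> ` C" "\<Union>((\<lambda>C. \<phi> ` C) ` \<D>)"] insert by simp
  qed simp
  then show "interior \<sigma> = {}" unfolding \<sigma>_eq using C(1) by blast
qed

text \<open>The union of the sets reached from \<open>A\<close> and the union of the others are
  closed and disjoint and cover a connected set, so no set is left unreached.\<close>

lemma connected_Union_chain:
  fixes \<A> :: "'a::topological_space set set"
  assumes closed: "\<And>\<U>. \<U> \<subseteq> \<A> \<Longrightarrow> closed (\<Union>\<U>)" and conn: "connected (\<Union>\<A>)"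
    and ne: "{} \<notin> \<A>" and AB: "A \<in> \<A>" "B \<in> \<A>"
  shows "(\<lambda>X Y. X \<in> \<A> \<and> Y \<in> \<A> \<and> X \<inter> Y \<noteq> {})\<^sup>*\<^sup>* A B"
proof (rule ccontr)
  let ?R = "\<lambda>X Y. X \<in> \<A> \<and> Y \<in> \<A> \<and> X \<inter> Y \<noteq> {}"
  assume nB: "\<not> ?R\<^sup>*\<^sup>* A B"
  let ?U = "{X \<in> \<A>. ?R\<^sup>*\<^sup>* A X}"
  have disj: "\<Union>?U \<inter> \<Union>(\<A> - ?U) = {}"
  proof (rule ccontr)
    assume "\<Union>?U \<inter> \<Union>(\<A> - ?U) \<noteq> {}"
    then obtain X Y where XY: "X \<in> \<A>" "?R\<^sup>*\<^sup>* A X" "Y \<in> \<A>" "Y \<notin> ?U" "X \<inter> Y \<noteq> {}" by blast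
    then have "?R X Y" by blast
    with XY(2) have "?R\<^sup>*\<^sup>* A Y" by (rule rtranclp.rtrancl_into_rtrancl)
    then show False using XY by blast
  qed
  have "closed (\<Union>?U)" "closed (\<Union>(\<A> - ?U))" by (rule closed, blast)+
  moreover have "\<Union>\<A> \<subseteq> \<Union>?U \<union> \<Union>(\<A> - ?U)" by blast
  ultimately have "\<Union>?U \<inter> \<Union>\<A> = {} \<or> \<Union>(\<A> - ?U) \<inter> \<Union>\<A> = {}"
    using conn disj unfolding connected_closed by blast
  moreover have "A \<subseteq> \<Union>?U \<inter> \<Union>\<A>" "B \<subseteq> \<Union>(\<A> - ?U) \<inter> \<Union>\<A>" using AB nB by blast+
  moreover have "A \<noteq> {}" "B \<noteq> {}" using ne AB by blast+
  ultimately show False by blast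
qed

lemma connected_Union_chainI:
  assumes conn: "\<And>X. X \<in> \<A> \<Longrightarrow> connected X" and ne: "{} \<notin> \<A>" and A: "A \<in> \<A>"
    and chain: "\<And>X. X \<in> \<A> \<Longrightarrow> (\<lambda>X Y. X \<in> \<A> \<and> Y \<in> \<A> \<and> X \<inter> Y \<noteq> {})\<^sup>*\<^sup>* A X"
  shows "connected (\<Union>\<A>)"
proof -
  obtain a where a: "a \<in> A" using ne A by (metis all_not_in_conv)
  have sub: "X \<subseteq> connected_component_set (\<Union>\<A>) a"
    if "(\<lambda>X Y. X \<in> \<A> \<and> Y \<in> \<A> \<and> X \<inter> Y \<noteq> {})\<^sup>*\<^sup>* A X" for X
    using that
  proof (induction rule: rtranclp_induct)
    case base
    show ?case by (rule connected_component_maximal[OF a conn[OF A]]) (use A in blast)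
  next
    case (step X Y)
    then obtain y where y: "y \<in> X" "y \<in> Y" by blast
    have "Y \<subseteq> connected_component_set (\<Union>\<A>) y"
      by (rule connected_component_maximal[OF y(2)]) (use step conn in blast)+
    moreover have "connected_component_set (\<Union>\<A>) y = connected_component_set (\<Union>\<A>) a"
      using step.IH y(1) by (metis connected_component_eq subsetD)
    ultimately show ?case by simp
  qed
  have "\<Union>\<A> = connected_component_set (\<Union>\<A>) a"
    using sub[OF chain] connected_component_subset[of "\<Union>\<A>" a] by blast
  then show ?thesis by (metis connected_connected_component)
qed

text \<open>In a closed convex set the direction of a line through one point is the direction of a
  line through every point; an extreme point allows no such direction except zero.\<close>

lemma no_line_if_extreme_point:
  fixes Q :: "'a::euclidean_space set"
  assumes Q: "closed Q" "convex Q" and v: "v extreme_point_of Q"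
    and line: "\<And>t::real. x + t *\<^sub>R n \<in> Q"
  shows "n = 0"
proof (rule ccontr)
  assume n: "n \<noteq> 0"
  have vQ: "v \<in> Q" using v by (simp add: extreme_point_of_def)
  have *: "v + s *\<^sub>R n \<in> Q" for s :: real
  proof -
    \<comment> \<open>Points \<open>x + s (k + 1) n\<close> of the given line, taken with weight
      \<open>1 / (k + 1)\<close> against \<open>v\<close>, converge to
      \<open>v + s n\<close>.\<close>
    have lim: "(\<lambda>k. v + s *\<^sub>R n + inverse (real (Suc k)) *\<^sub>R (x - v)) \<longlonglongrightarrow> v + s *\<^sub>R n + 0 *\<^sub>R (x - v)"
      by (intro tendsto_intros LIMSEQ_inverse_real_of_nat)
    have mem: "v + s *\<^sub>R n + inverse (real (Suc k)) *\<^sub>R (x - v) \<in> Q" for k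
    proof -
      let ?i = "inverse (real (Suc k))"
      have i: "0 \<le> ?i" "?i \<le> 1" "?i * real (Suc k) = 1" by (simp_all add: field_simps)
      have "(1 - ?i) *\<^sub>R v + ?i *\<^sub>R (x + (s * real (Suc k)) *\<^sub>R n) \<in> Q"
        by (rule convexD_alt[OF Q(2) vQ line i(1,2)])
      moreover have "(1 - ?i) *\<^sub>R v + ?i *\<^sub>R (x + (s * real (Suc k)) *\<^sub>R n) =
          v + (?i * real (Suc k) * s) *\<^sub>R n + ?i *\<^sub>R (x - v)"
        by (simp add: algebra_simps)
      ultimately show ?thesis using i(3) by simp
    qed
    have "v + s *\<^sub>R n + 0 *\<^sub>R (x - v) \<in> Q" by (rule closed_sequentially[OF Q(1) mem lim])
    then show ?thesis by simp
  qed
  have "v \<in> open_segment (v + (-1) *\<^sub>R n) (v + 1 *\<^sub>R n)"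
    unfolding in_segment(2)
  proof (intro conjI exI[of _ "1/2"])
    have "2 *\<^sub>R n \<noteq> 0" using n by simp
    then have "- n \<noteq> n" by (metis add.right_inverse scaleR_2)
    then show "v + - 1 *\<^sub>R n \<noteq> v + 1 *\<^sub>R n" by simp
    have "v = (1/2) *\<^sub>R v + (1/2) *\<^sub>R v" by (simp flip: scaleR_add_left)
    then show "v = (1 - 1 / 2) *\<^sub>R (v + - 1 *\<^sub>R n) + (1 / 2) *\<^sub>R (v + 1 *\<^sub>R n)"
      by (simp add: scaleR_add_right scaleR_diff_right)
  qed auto
  then show False using v *[of "-1"] *[of 1] unfolding extreme_point_of_def by blast
qed

text \<open>Induction over facets: a polyhedron without relative frontier is affine, and if it
  contains no line it is a point.\<close>

lemma polyhedron_extreme_point_exists: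
  fixes Q :: "'a::euclidean_space set"
  assumes "polyhedron Q" "Q \<noteq> {}" "\<And>x n. (\<And>t::real. x + t *\<^sub>R n \<in> Q) \<Longrightarrow> n = 0"
  shows "\<exists>v. v extreme_point_of Q"
  using assms
proof (induction "nat (aff_dim Q)" arbitrary: Q rule: less_induct)
  case less
  note cl = polyhedron_imp_closed[OF less.prems(1)] polyhedron_imp_convex[OF less.prems(1)]
  show ?case
  proof (cases "rel_frontier Q = {}")
    case True
    then have aff: "affine Q" using cl by (simp add: rel_frontier_eq_empty)
    obtain a where a: "a \<in> Q" using less.prems by blast
    have "Q = {a}"
    proof (rule ccontr)
      assume "Q \<noteq> {a}"
      then obtain b where b: "b \<in> Q" "b \<noteq> a" using a by blast
      have "a + t *\<^sub>R (b - a) \<in> Q" for t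
      proof -
        have "(1 - t) *\<^sub>R a + t *\<^sub>R b \<in> Q" using aff a b unfolding affine_alt by blast
        then show ?thesis by (simp add: algebra_simps)
      qed
      then have "b - a = 0" by (rule less.prems(3))
      then show False using b by simp
    qed
    then show ?thesis by auto
  next
    case False
    then obtain F where F: "F facet_of Q" using rel_frontier_of_polyhedron[OF less.prems(1)] by auto
    then have F': "F face_of Q" "F \<noteq> {}" "aff_dim F = aff_dim Q - 1" by (auto simp: facet_of_def)
    have "0 \<le> aff_dim F" using F'(2) aff_dim_geq[of F] aff_dim_empty[of F] by linarith
    then have lt: "nat (aff_dim F) < nat (aff_dim Q)" using F'(3) by linarith
    have sub: "F \<subseteq> Q" using F'(1) by (rule face_of_imp_subset)
    have "\<exists>v. v extreme_point_of F"
    proof (rule less.hyps[OF lt face_of_polyhedron_polyhedron[OF less.prems(1) F'(1)] F'(2)])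
      fix x n assume "\<And>t::real. x + t *\<^sub>R n \<in> F"
      then show "n = 0" using sub by (intro less.prems(3)) blast
    qed
    then show ?thesis using extreme_point_of_face[OF F'(1)] by blast
  qed
qed

text \<open>Away from the relative frontier, \<open>Q\<close> coincides with its relative interior,
  so the part of \<open>C\<close> in \<open>Q\<close> is both open and closed in
  \<open>C\<close>.\<close>

lemma connected_subset_if_disjoint_rel_frontier:
  fixes Q :: "'a::euclidean_space set"
  assumes C: "connected C" "C \<subseteq> affine hull Q" and Q: "closed Q"
    and disj: "C \<inter> rel_frontier Q = {}" and meets: "C \<inter> Q \<noteq> {}"
  shows "C \<subseteq> Q"
proof (rule ccontr)
  assume "\<not> C \<subseteq> Q"
  obtain U where U: "open U" "rel_interior Q = affine hull Q \<inter> U"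
    using openin_rel_interior[of Q] unfolding openin_open by blast
  have int: "C \<inter> Q \<subseteq> rel_interior Q"
    using disj Q by (auto simp: rel_frontier_def)
  have "C \<inter> U \<subseteq> Q" using C(2) U(2) rel_interior_subset[of Q] by blast
  moreover have "C \<subseteq> U \<union> - Q" using int U(2) by blast
  moreover have "U \<inter> C \<noteq> {}" using meets int U(2) by blast
  moreover have "- Q \<inter> C \<noteq> {}" using \<open>\<not> C \<subseteq> Q\<close> by blast
  moreover have "open (- Q)" using Q by (simp add: open_Compl)
  ultimately show False using C(1) U(1) unfolding connected_def by blast
qed

text \<open>By induction the facets are bounded, so the relative frontier lies in a ball around
  \<open>v\<close>. Through a point of \<open>Q\<close> outside the ball runs a line that avoids the
  ball and thus stays in \<open>Q\<close>, which an extreme point excludes.\<close>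

lemma polyhedron_bounded_if_edges_bounded:
  fixes Q :: "'a::euclidean_space set"
  assumes "polyhedron Q" "v extreme_point_of Q" "\<And>T. T face_of Q \<Longrightarrow> aff_dim T = 1 \<Longrightarrow> bounded T"
  shows "bounded Q"
  using assms
proof (induction "nat (aff_dim Q)" arbitrary: Q v rule: less_induct)
  case less
  note cl = polyhedron_imp_closed[OF less.prems(1)] polyhedron_imp_convex[OF less.prems(1)]
  have vQ: "v \<in> Q" using less.prems(2) by (simp add: extreme_point_of_def)
  have noline: "n = 0" if "\<And>t::real. x + t *\<^sub>R n \<in> Q" for x n
    by (rule no_line_if_extreme_point[OF cl less.prems(2) that])
  have dim0: "0 \<le> aff_dim Q" using vQ aff_dim_geq[of Q] aff_dim_empty[of Q] by fastforce
  consider "aff_dim Q = 0" | "aff_dim Q = 1" | "2 \<le> aff_dim Q" using dim0 by linarith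
  then show ?case
  proof cases
    case 1
    then show ?thesis by (auto simp: aff_dim_eq_0)
  next
    case 2
    then show ?thesis using less.prems(3) face_of_refl[OF cl(2)] by blast
  next
    case 3
    have "bounded F" if F: "F facet_of Q" for F
    proof -
      have F': "F face_of Q" "F \<noteq> {}" "aff_dim F = aff_dim Q - 1" using F by (auto simp: facet_of_def)
      have lt: "nat (aff_dim F) < nat (aff_dim Q)" using F'(3) 3 by linarith
      have poly: "polyhedron F" by (rule face_of_polyhedron_polyhedron[OF less.prems(1) F'(1)])
      have sub: "F \<subseteq> Q" using F'(1) by (rule face_of_imp_subset)
      obtain w where w: "w extreme_point_of F"
        using polyhedron_extreme_point_exists[OF poly F'(2)] noline sub by (meson subsetD)
      show ?thesis
      proof (rule less.hyps[OF lt poly w])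
        fix T assume "T face_of F" "aff_dim T = 1"
        then show "bounded T" using less.prems(3) face_of_trans[OF _ F'(1)] by blast
      qed
    qed
    then have "bounded (rel_frontier Q)"
      unfolding rel_frontier_of_polyhedron[OF less.prems(1)]
      using finite_polyhedron_facets[OF less.prems(1)] by (intro bounded_Union) auto
    then obtain r where r: "0 < r" "rel_frontier Q \<subseteq> ball v r" using bounded_subset_ballD by blast
    show ?thesis
    proof (rule ccontr)
      assume "\<not> bounded Q"
      then obtain x where x: "x \<in> Q" "r \<le> dist v x"
        by (metis bounded_ball bounded_subset mem_ball not_le subsetI)
      let ?T = "(+) (- v) ` Q"
      have dimT: "2 \<le> dim ?T"
        using 3 aff_dim_eq_dim[of v Q] hull_inc[OF vQ] by simp
      have xT: "x - v \<in> ?T" using x by auto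
      \<comment> \<open>Dimension at least 2 leaves a direction \<open>n\<close> of the affine hull
        orthogonal to \<open>x - v\<close>; moving along it from \<open>x\<close> never comes closer
        to \<open>v\<close>.\<close>
      have "span {x - v} \<subset> span ?T"
      proof
        show "span {x - v} \<subseteq> span ?T" using xT by (intro span_mono) auto
        show "span {x - v} \<noteq> span ?T"
        proof
          assume "span {x - v} = span ?T"
          then have "dim {x - v} = dim ?T" by (metis dim_span)
          moreover have "dim {x - v} \<le> 1" using dim_le_card[of "{x - v}" "{x - v}"] by (simp add: span_base)
          ultimately show False using dimT by simp
        qed
      qed
      then obtain n where n: "n \<noteq> 0" "n \<in> span ?T" "\<And>y. y \<in> span {x - v} \<Longrightarrow> orthogonal n y"
        using orthogonal_to_subspace_exists_gen by blast
      have orth: "(x - v) \<bullet> n = 0" using n(3)[of "x - v"] by (simp add: orthogonal_def inner_commute span_base)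
      let ?L = "range (\<lambda>t. x + t *\<^sub>R n)"
      have hull: "affine hull Q = (+) v ` span ?T" by (rule affine_hull_span_gen[OF hull_inc[OF vQ]])
      have "x + t *\<^sub>R n \<in> affine hull Q" for t
      proof -
        have "(x - v) + t *\<^sub>R n \<in> span ?T" by (intro span_add span_scale n(2) span_base[OF xT])
        then have "v + ((x - v) + t *\<^sub>R n) \<in> affine hull Q" unfolding hull by blast
        then show ?thesis by simp
      qed
      then have LA: "?L \<subseteq> affine hull Q" by auto
      have Lconn: "connected ?L" by (intro connected_continuous_image continuous_intros connected_UNIV)
      have far: "r \<le> dist v (x + t *\<^sub>R n)" for t
      proof -
        have "(norm (x - v))\<^sup>2 \<le> (norm ((x - v) + t *\<^sub>R n))\<^sup>2"
          unfolding power2_norm_eq_inner using orth zero_le_square[of t]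
          by (simp add: inner_add_left inner_add_right inner_commute mult.assoc[symmetric])
        then have "norm (x - v) \<le> norm ((x - v) + t *\<^sub>R n)" by (rule power2_le_imp_le) simp
        then show ?thesis using x(2) by (simp add: dist_norm norm_minus_commute add_diff_eq diff_add_eq)
      qed
      have "?L \<inter> rel_frontier Q = {}"
      proof (rule ccontr)
        assume "?L \<inter> rel_frontier Q \<noteq> {}"
        then obtain t where "x + t *\<^sub>R n \<in> rel_frontier Q" by blast
        then have "dist v (x + t *\<^sub>R n) < r" using r(2) by auto
        then show False using far[of t] by simp
      qed
      moreover have "?L \<inter> Q \<noteq> {}"
      proof -
        have "x + 0 *\<^sub>R n \<in> ?L" by (rule rangeI)
        then show ?thesis using x by auto
      qed
      ultimately have "?L \<subseteq> Q"
        by (intro connected_subset_if_disjoint_rel_frontier[OF Lconn LA cl(1)])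
      then have "n = 0" by (intro noline) blast
      then show False using n by simp
    qed
  qed
qed

section \<open>The edge graph of a polytope\<close>

definition polytope_edge :: "'a::euclidean_space set \<Rightarrow> 'a \<Rightarrow> 'a \<Rightarrow> bool" where
  "polytope_edge Q x y \<longleftrightarrow> x \<noteq> y \<and> x extreme_point_of Q \<and> y extreme_point_of Q \<and>
     (\<exists>T. T face_of Q \<and> aff_dim T = 1 \<and> x \<in> T \<and> y \<in> T)"

lemma polytope_edge_face:
  assumes "F face_of Q" "polytope_edge F x y" shows "polytope_edge Q x y"
  using assms extreme_point_of_face[OF assms(1)] face_of_trans[OF _ assms(1)]
  unfolding polytope_edge_def by blast

lemma polytope_extreme_point_exists:
  fixes Q :: "'a::euclidean_space set"
  assumes "polytope Q" "Q \<noteq> {}" shows "\<exists>v. v extreme_point_of Q"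
  using extreme_point_exists_convex[OF polytope_imp_compact polytope_imp_convex] assms by blast

text \<open>In dimension at least 2 the relative frontier is connected, so facets can be traversed
  through nonempty intersections. Such an intersection is a face and has an extreme point, where the
  paths that the induction provides inside the facets are joined.\<close>

lemma polytope_vertices_joined:
  fixes Q :: "'a::euclidean_space set"
  assumes "polytope Q" "a extreme_point_of Q" "b extreme_point_of Q"
  shows "(polytope_edge Q)\<^sup>*\<^sup>* a b"
  using assms
proof (induction "nat (aff_dim Q)" arbitrary: Q a b rule: less_induct)
  case less
  have aQ: "a \<in> Q" "b \<in> Q" using less.prems by (auto simp: extreme_point_of_def)
  have poly: "polyhedron Q" by (rule polytope_imp_polyhedron[OF less.prems(1)])
  have dim0: "0 \<le> aff_dim Q" using aQ aff_dim_geq[of Q] aff_dim_empty[of Q] by fastforce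
  consider "a = b" | "aff_dim Q = 1" "a \<noteq> b" | "aff_dim Q = 0" "a \<noteq> b" | "2 \<le> aff_dim Q"
    using dim0 by linarith
  then show ?case
  proof cases
    case 2
    then have "polytope_edge Q a b"
      unfolding polytope_edge_def using less.prems aQ face_of_refl[OF polytope_imp_convex[OF less.prems(1)]] by blast
    then show ?thesis by (rule r_into_rtranclp)
  next
    case 3
    then show ?thesis using aQ by (auto simp: aff_dim_eq_0)
  next
    case 4
    let ?\<F> = "{F. F facet_of Q}"
    have fin: "finite ?\<F>" by (rule finite_polyhedron_facets[OF poly])
    have F: "F face_of Q" "polytope F" "F \<noteq> {}" "nat (aff_dim F) < nat (aff_dim Q)" if "F \<in> ?\<F>" for F
      using that 4 face_of_polytope_polytope[OF less.prems(1)] by (auto simp: facet_of_def)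
    have facet: "\<exists>F\<in>?\<F>. x \<in> F" if "x extreme_point_of Q" for x
    proof -
      have "{x} face_of Q" using that by (simp add: face_of_singleton)
      moreover have "{x} \<noteq> Q" using 4 by auto
      ultimately obtain F where "F facet_of Q" "{x} \<subseteq> F"
        using face_of_polyhedron_subset_facet[OF poly, of "{x}"] by auto
      then show ?thesis by auto
    qed
    obtain A B where AB: "A \<in> ?\<F>" "a \<in> A" "B \<in> ?\<F>" "b \<in> B" using facet less.prems by blast
    have "connected (\<Union>?\<F>)"
      unfolding rel_frontier_of_polyhedron[OF poly, symmetric]
      using 4 less.prems(1) by (intro connected_sphere_gen polytope_imp_convex polytope_imp_bounded) auto
    moreover have "closed (\<Union>\<U>)" if "\<U> \<subseteq> ?\<F>" for \<U>
      using that fin F(2) by (intro closed_Union) (auto intro: finite_subset polytope_imp_closed)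
    ultimately have chain: "(\<lambda>X Y. X \<in> ?\<F> \<and> Y \<in> ?\<F> \<and> X \<inter> Y \<noteq> {})\<^sup>*\<^sup>* A B"
      using F(3) AB by (intro connected_Union_chain) auto
    have mono: "(polytope_edge Q)\<^sup>*\<^sup>* x y" if XF: "X \<in> ?\<F>" and xy: "x \<in> X" "y \<in> X" "x extreme_point_of Q" "y extreme_point_of Q" for X x y
    proof -
      have "x extreme_point_of X" "y extreme_point_of X"
        using extreme_point_of_face[OF F(1)[OF XF]] xy by auto
      then have "(polytope_edge X)\<^sup>*\<^sup>* x y" by (intro less.hyps F[OF XF])
      then show ?thesis
        by (rule rtranclp_mono[THEN predicate2D, rotated]) (use polytope_edge_face[OF F(1)[OF XF]] in blast)
    qed
    have "\<forall>y\<in>Y. y extreme_point_of Q \<longrightarrow> (polytope_edge Q)\<^sup>*\<^sup>* a y"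
      if "(\<lambda>X Y. X \<in> ?\<F> \<and> Y \<in> ?\<F> \<and> X \<inter> Y \<noteq> {})\<^sup>*\<^sup>* A Y" for Y
      using that
    proof (induction rule: rtranclp_induct)
      case base
      show ?case using mono[OF AB(1,2)] less.prems(2) by blast
    next
      case (step X Y)
      have XY: "X \<in> ?\<F>" "Y \<in> ?\<F>" "X \<inter> Y \<noteq> {}" using step by auto
      have "(X \<inter> Y) face_of Q" by (rule face_of_Int[OF F(1)[OF XY(1)] F(1)[OF XY(2)]])
      moreover obtain z where "z extreme_point_of (X \<inter> Y)"
        using polytope_extreme_point_exists[OF face_of_polytope_polytope[OF less.prems(1) calculation] XY(3)] by blast
      ultimately have z: "z extreme_point_of Q" "z \<in> X" "z \<in> Y"
        using extreme_point_of_face[of "X \<inter> Y" Q z] by auto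
      then have "(polytope_edge Q)\<^sup>*\<^sup>* a z" using step.IH by blast
      moreover have "(polytope_edge Q)\<^sup>*\<^sup>* z y" if "y \<in> Y" "y extreme_point_of Q" for y
        using mono[OF XY(2) z(3) that(1) z(1) that(2)] .
      ultimately show ?case by (meson rtranclp_trans)
    qed
    then show ?thesis using chain AB less.prems by blast
  qed simp
qed

text \<open>One of three collinear points lies between the other two, and an extreme point does so
  only if it coincides with one of them.\<close>

lemma convex_segment_if_extreme_points:
  fixes Q :: "'a::euclidean_space set"
  assumes "convex Q" "aff_dim Q = 1" "a extreme_point_of Q" "b extreme_point_of Q" "a \<noteq> b"
  shows "Q = closed_segment a b"
proof
  have ab: "a \<in> Q" "b \<in> Q" using assms by (auto simp: extreme_point_of_def)
  show "closed_segment a b \<subseteq> Q" using ab assms(1) by (rule closed_segment_subset)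
  show "Q \<subseteq> closed_segment a b"
  proof
    fix x assume x: "x \<in> Q"
    have ext: "z = y \<or> z = y'" if "z extreme_point_of Q" "z \<in> closed_segment y y'" "y \<in> Q" "y' \<in> Q" for z y y'
      using that unfolding extreme_point_of_def open_segment_def by blast
    have "aff_dim {a, b, x} \<le> 1" using aff_dim_subset[of "{a, b, x}" Q] ab x assms(2) by auto
    then have "collinear {a, b, x}" by (simp add: collinear_aff_dim)
    then consider "a \<in> closed_segment b x" | "b \<in> closed_segment x a" | "x \<in> closed_segment a b"
      by (auto simp: collinear_between_cases between_mem_segment)
    then show "x \<in> closed_segment a b"
    proof cases
      case 1
      then have "a = x" using ext[OF assms(3) 1 ab(2) x] assms(5) by auto
      then show ?thesis by simp
    next
      case 2
      then have "b = x" using ext[OF assms(4) 2 x ab(1)] assms(5) by auto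
      then show ?thesis by simp
    qed
  qed
qed

section \<open>Polyhedral tessellations\<close>

abbreviation meets_in :: "'a set set \<Rightarrow> 'a set \<Rightarrow> 'a set \<Rightarrow> bool" where
  "meets_in \<A> \<equiv> \<lambda>X Y. X \<in> \<A> \<and> Y \<in> \<A> \<and> X \<inter> Y \<noteq> {}"

text \<open>Two end vertexes per edge make the cells of dimension 1 edges of a graph; rays and lines
  are thereby excluded as edges.\<close>

locale tessellation_graph =
  fixes P :: "nat \<Rightarrow> (real^'d) set set" and m :: nat
  assumes polytope: "is_cell_polytope m P" and cover: "(\<Union>i\<le>m. \<Union>(P i)) = UNIV"
    and two_end_vertexes: "e \<in> P 1 \<Longrightarrow> card (end_vertexes P e) = 2"
begin

section \<open>Local finiteness and cells of full dimension\<close>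

lemma cell: "i \<le> m \<Longrightarrow> \<sigma> \<in> P i \<Longrightarrow> is_cell i \<sigma>"
  using polytope by (auto simp: is_cell_polytope_def)

lemma finite_meeting: "i \<le> m \<Longrightarrow> bounded B \<Longrightarrow> finite {\<sigma> \<in> P i. \<sigma> \<inter> B \<noteq> {}}"
  using polytope by (auto simp: is_cell_polytope_def)

lemma cell_Int:
  assumes "i \<le> m" "j \<le> m" "\<sigma> \<in> P i" "\<tau> \<in> P j" "x \<in> \<sigma>" "x \<in> \<tau>"
  obtains \<rho> k l where "x \<in> \<rho>" "\<rho> \<subseteq> \<sigma>" "\<rho> \<subseteq> \<tau>" "k \<le> i" "\<rho> \<in> P k" "l \<le> j" "\<rho> \<in> P l"
proof -
  have "\<sigma> \<inter> \<tau> = {} \<or> (\<exists>\<C>. \<C> \<subseteq> (\<Union>k\<le>i. faces_in P \<sigma> k) \<inter> (\<Union>k\<le>j. faces_in P \<tau> k) \<and> \<sigma> \<inter> \<tau> = \<Union>\<C>)"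
    using polytope assms(1-4) unfolding is_cell_polytope_def by blast
  then obtain \<C> where C: "\<C> \<subseteq> (\<Union>k\<le>i. faces_in P \<sigma> k) \<inter> (\<Union>k\<le>j. faces_in P \<tau> k)" "\<sigma> \<inter> \<tau> = \<Union>\<C>"
    using assms(5,6) by blast
  then obtain \<rho> where \<rho>: "\<rho> \<in> \<C>" "x \<in> \<rho>" using assms(5,6) by blast
  then obtain k l where "k \<le> i" "\<rho> \<in> faces_in P \<sigma> k" "l \<le> j" "\<rho> \<in> faces_in P \<tau> l" using C(1) by blast
  then show ?thesis using \<rho> by (intro that[of \<rho> k l]) (auto simp: faces_in_def)
qed

lemma closed_Union_cells:
  assumes "i \<le> m" "\<U> \<subseteq> P i" shows "closed (\<Union>\<U>)"
proof -
  have "\<exists>T. open T \<and> x \<in> T \<and> T \<subseteq> - \<Union>\<U>" if x: "x \<notin> \<Union>\<U>" for x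
  proof -
    let ?F = "{\<sigma> \<in> \<U>. \<sigma> \<inter> ball x 1 \<noteq> {}}"
    have "finite ?F" by (rule finite_subset[OF _ finite_meeting[OF assms(1) bounded_ball[of x 1]]]) (use assms(2) in blast)
    then have "closed (\<Union>?F)"
      using is_cell_properties(1)[OF cell[OF assms(1)]] assms(2) by (intro closed_Union) blast+
    then have "open (ball x 1 \<inter> - \<Union>?F)" by auto
    moreover have "x \<in> ball x 1 \<inter> - \<Union>?F" using x by auto
    moreover have "ball x 1 \<inter> - \<Union>?F \<subseteq> - \<Union>\<U>" by blast
    ultimately show ?thesis by blast
  qed
  then have "open (- \<Union>\<U>)" by (subst open_subopen) auto
  then show ?thesis by (simp add: closed_def)
qed

text \<open>If the cells of full dimension left a point uncovered, a ball around it would be covered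
  by finitely many closed cells of lower dimension, whose union has empty interior.\<close>

lemma top_cells: "CARD('d) \<le> m" "\<Union>(P CARD('d)) = UNIV"
proof -
  \<comment> \<open>The collections \<open>P i\<close> with \<open>i\<close> above \<open>m\<close>
    are unconstrained, so the empty set stands in until the dimension is known to be at most
    \<open>m\<close>.\<close>
  define T where "T = (if CARD('d) \<le> m then P CARD('d) else {})"
  have "\<Union>T = UNIV"
  proof (rule ccontr)
    assume "\<Union>T \<noteq> UNIV"
    have "closed (\<Union>T)" unfolding T_def by (auto intro: closed_Union_cells)
    then have op: "open (- \<Union>T)" by (simp add: closed_def)
    obtain x where "x \<in> - \<Union>T" using \<open>\<Union>T \<noteq> UNIV\<close> by blast
    then obtain r where r: "0 < r" "ball x r \<subseteq> - \<Union>T" using op unfolding open_contains_ball by blast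
    define \<F> where "\<F> = (\<Union>i\<in>{i. i \<le> m \<and> i < CARD('d)}. {\<sigma> \<in> P i. \<sigma> \<inter> ball x r \<noteq> {}})"
    have fin: "finite \<F>" unfolding \<F>_def using finite_meeting by (intro finite_UN_I) auto
    have "ball x r \<subseteq> \<Union>\<F>"
    proof
      fix y assume y: "y \<in> ball x r"
      obtain i \<sigma> where \<sigma>: "i \<le> m" "\<sigma> \<in> P i" "y \<in> \<sigma>" using cover by blast
      have "i \<le> CARD('d)" by (rule is_cell_properties(4)[OF cell[OF \<sigma>(1,2)]])
      moreover have "i \<noteq> CARD('d)" using \<sigma> y r(2) unfolding T_def by auto
      ultimately show "y \<in> \<Union>\<F>" unfolding \<F>_def using \<sigma> y by fastforce
    qed
    moreover have "interior (\<Union>\<D>) = {}" if "finite \<D>" "\<D> \<subseteq> \<F>" for \<D>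
      using that
    proof (induction \<D> rule: finite_induct)
      case (insert \<sigma> \<D>)
      then obtain i where i: "i \<le> m" "i < CARD('d)" "\<sigma> \<in> P i" unfolding \<F>_def by auto
      note c = is_cell_properties[OF cell[OF i(1,3)]]
      show ?case using interior_closed_Un_empty_interior[OF c(1), of "\<Union>\<D>"] c(5)[OF i(2)] insert by simp
    qed simp
    ultimately have "interior (ball x r) = {}" using interior_mono[of "ball x r" "\<Union>\<F>"] fin by blast
    then show False using r(1) by simp
  qed
  then show "CARD('d) \<le> m" "\<Union>(P CARD('d)) = UNIV" unfolding T_def by (auto split: if_splits)
qed

lemma d_pos: "1 \<le> CARD('d)"
  using zero_less_card_finite[where 'a = 'd] by linarith

section \<open>Euclidean charts and cells that contain a vertex\<close>

definition chart_of :: "nat \<Rightarrow> (real^'d) set \<Rightarrow> (real^'d) set \<Rightarrow> (real^'d \<Rightarrow> real^'d) \<Rightarrow> bool" where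
  "chart_of i \<sigma> Q \<psi> \<longleftrightarrow> polyhedron Q \<and> aff_dim Q = int i \<and> inj_on \<psi> Q \<and> continuous_on Q \<psi> \<and> \<sigma> = \<psi> ` Q \<and>
     (\<forall>j\<le>i. \<forall>X. X \<in> P j \<and> X \<subseteq> \<sigma> \<longleftrightarrow> (\<exists>T. T face_of Q \<and> aff_dim T = int j \<and> X = \<psi> ` T))"

lemma chart_ofD:
  assumes "chart_of i \<sigma> Q \<psi>"
  shows "polyhedron Q" "aff_dim Q = int i" "inj_on \<psi> Q" "continuous_on Q \<psi>" "\<sigma> = \<psi> ` Q"
    "\<And>j X. j \<le> i \<Longrightarrow> X \<in> P j \<and> X \<subseteq> \<sigma> \<longleftrightarrow> (\<exists>T. T face_of Q \<and> aff_dim T = int j \<and> X = \<psi> ` T)"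
  using assms unfolding chart_of_def by blast+

lemma chart_faceI:
  assumes "chart_of i \<sigma> Q \<psi>" "T face_of Q" "aff_dim T = int j" "j \<le> i"
  shows "\<psi> ` T \<in> P j" "\<psi> ` T \<subseteq> \<sigma>"
  using chart_ofD(6)[OF assms(1,4), of "\<psi> ` T"] assms(2,3) by blast+

lemma chart_faceE:
  assumes "chart_of i \<sigma> Q \<psi>" "X \<in> P j" "X \<subseteq> \<sigma>" "j \<le> i"
  obtains T where "T face_of Q" "aff_dim T = int j" "X = \<psi> ` T"
  using chart_ofD(6)[OF assms(1,4), of X] assms(2,3) by blast

lemma chart_vertex:
  assumes "chart_of i \<sigma> Q \<psi>"
  shows "X \<in> P 0 \<and> X \<subseteq> \<sigma> \<longleftrightarrow> (\<exists>x. x extreme_point_of Q \<and> X = {\<psi> x})"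
proof -
  have "X \<in> P 0 \<and> X \<subseteq> \<sigma> \<longleftrightarrow> (\<exists>T. T face_of Q \<and> aff_dim T = int 0 \<and> X = \<psi> ` T)"
    by (rule chart_ofD(6)[OF assms]) simp
  also have "\<dots> \<longleftrightarrow> (\<exists>x. x extreme_point_of Q \<and> X = {\<psi> x})"
  proof
    assume "\<exists>x. x extreme_point_of Q \<and> X = {\<psi> x}"
    then obtain x where "x extreme_point_of Q" "X = {\<psi> x}" by blast
    then show "\<exists>T. T face_of Q \<and> aff_dim T = int 0 \<and> X = \<psi> ` T"
      by (intro exI[of _ "{x}"]) (simp add: face_of_singleton)
  qed (auto simp: aff_dim_eq_0 face_of_singleton)
  finally show ?thesis .
qed

lemma chart_vertexI:
  assumes "chart_of i \<sigma> Q \<psi>" "x extreme_point_of Q" shows "{\<psi> x} \<in> P 0" "{\<psi> x} \<subseteq> \<sigma>"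
  using chart_vertex[OF assms(1), of "{\<psi> x}"] assms(2) by blast+

lemma chart_vertexE:
  assumes "chart_of i \<sigma> Q \<psi>" "X \<in> P 0" "X \<subseteq> \<sigma>"
  obtains x where "x extreme_point_of Q" "x \<in> Q" "X = {\<psi> x}"
  using chart_vertex[OF assms(1), of X] assms(2,3) by (auto simp: extreme_point_of_def)

lemma ex_chart_of:
  assumes "i \<le> m" "\<sigma> \<in> P i"
  shows "\<exists>Q \<psi>. chart_of i \<sigma> Q \<psi>"
proof -
  have "is_cell_polyhedron i (faces_in P \<sigma>)" using polytope assms unfolding is_cell_polytope_def by blast
  then obtain A \<phi> where A: "cell_chart i A \<phi>" "\<forall>j\<le>i. faces_in P \<sigma> j = (\<lambda>B. \<phi> ` B) ` cell_faces A j"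
    unfolding is_cell_polyhedron_def by blast
  obtain Q :: "(real^'d) set" and \<psi> where Q: "polyhedron Q" "aff_dim Q = int i" "inj_on \<psi> Q" "continuous_on Q \<psi>"
    "\<forall>i. (\<lambda>B. \<phi> ` B) ` cell_faces A i = (\<lambda>T. \<psi> ` T) ` {T. T face_of Q \<and> aff_dim T = int i}"
    using cell_chart_euclidean[OF A(1)] by (elim exE conjE)
  have faces: "X \<in> P j \<and> X \<subseteq> \<sigma> \<longleftrightarrow> (\<exists>T. T face_of Q \<and> aff_dim T = int j \<and> X = \<psi> ` T)" if "j \<le> i" for j X
  proof -
    have "faces_in P \<sigma> j = (\<lambda>T. \<psi> ` T) ` {T. T face_of Q \<and> aff_dim T = int j}" using A(2) Q(5) that by simp
    moreover have "X \<in> P j \<and> X \<subseteq> \<sigma> \<longleftrightarrow> X \<in> faces_in P \<sigma> j" by (simp add: faces_in_def)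
    ultimately show ?thesis by auto
  qed
  obtain T where T: "T face_of Q" "aff_dim T = int i" "\<sigma> = \<psi> ` T" using faces[of i \<sigma>] assms(2) by auto
  have "T = Q" using face_of_aff_dim_lt[OF polyhedron_imp_convex[OF Q(1)] T(1)] T(2) Q(2) by auto
  then have "\<sigma> = \<psi> ` Q" using T(3) by simp
  with Q(1-4) faces have "chart_of i \<sigma> Q \<psi>" unfolding chart_of_def by simp
  then show ?thesis by (intro exI)
qed

lemma vertex_singleton:
  assumes "v \<in> P 0" shows "\<exists>x. v = {x}"
proof -
  obtain Q \<psi> where "chart_of 0 v Q \<psi>" using ex_chart_of[OF le0 assms] by (elim exE)
  then have "aff_dim Q = int 0" "v = \<psi> ` Q" by (rule chart_ofD)+
  then show ?thesis by (auto simp: aff_dim_eq_0)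
qed

lemma edge_two_vertexes:
  assumes "e \<in> P 1"
  obtains u v where "u \<noteq> v" "u \<in> P 0" "v \<in> P 0" "u \<subseteq> e" "v \<subseteq> e" "end_vertexes P e = {u, v}"
proof -
  obtain u v where uv: "end_vertexes P e = {u, v}" "u \<noteq> v"
    using two_end_vertexes[OF assms] by (auto simp: card_2_iff)
  then have "u \<in> end_vertexes P e" "v \<in> end_vertexes P e" by auto
  then show ?thesis using uv by (intro that[of u v]) (auto simp: end_vertexes_def)
qed

lemma edge_end_vertexes_eq:
  assumes "e \<in> P 1" "u \<in> P 0" "v \<in> P 0" "u \<subseteq> e" "v \<subseteq> e" "u \<noteq> v"
  shows "end_vertexes P e = {u, v}"
proof -
  have "{u, v} \<subseteq> end_vertexes P e" using assms by (auto simp: end_vertexes_def)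
  moreover have "finite (end_vertexes P e)" using two_end_vertexes[OF assms(1)] by (intro card_ge_0_finite) simp
  moreover have "card {u, v} = card (end_vertexes P e)" using two_end_vertexes[OF assms(1)] assms(6) by simp
  ultimately show ?thesis by (metis card_subset_eq)
qed

text \<open>Every edge of the cell has two end vertexes, so in the chart it is a segment, and a
  polyhedron with a vertex and bounded edges is bounded. Cells without vertexes, such as
  half-spaces, may be unbounded.\<close>

lemma vertexed_cell:
  assumes i: "i \<le> m" and \<sigma>: "\<sigma> \<in> P i" and v: "v \<in> P 0" "v \<subseteq> \<sigma>"
  shows "\<exists>Q \<psi>. chart_of i \<sigma> Q \<psi> \<and> polytope Q"
proof -
  obtain Q \<psi> where chart: "chart_of i \<sigma> Q \<psi>" using ex_chart_of[OF i \<sigma>] by (elim exE)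
  note Q = chart_ofD[OF chart]
  obtain x where x: "x extreme_point_of Q" by (rule chart_vertexE[OF chart v])
  have "bounded T" if T: "T face_of Q" "aff_dim T = 1" for T
  proof -
    have "T \<subseteq> Q" using T(1) by (rule face_of_imp_subset)
    then have "1 \<le> i" using aff_dim_subset[of T Q] T(2) Q(2) by simp
    then have e: "\<psi> ` T \<in> P 1" "\<psi> ` T \<subseteq> \<sigma>" using chart_faceI[OF chart T(1), of 1] T(2) by simp_all
    obtain u w where uw: "u \<noteq> w" "u \<in> P 0" "w \<in> P 0" "u \<subseteq> \<psi> ` T" "w \<subseteq> \<psi> ` T"
      by (rule edge_two_vertexes[OF e(1)])
    obtain a where a: "a extreme_point_of Q" "a \<in> Q" "u = {\<psi> a}"
      by (rule chart_vertexE[OF chart uw(2) order_trans[OF uw(4) e(2)]])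
    obtain b where b: "b extreme_point_of Q" "b \<in> Q" "w = {\<psi> b}"
      by (rule chart_vertexE[OF chart uw(3) order_trans[OF uw(5) e(2)]])
    have "\<psi> a \<in> \<psi> ` T" "\<psi> b \<in> \<psi> ` T" using uw(4,5) a(3) b(3) by simp_all
    then have "a \<in> T" "b \<in> T" using inj_on_image_mem_iff[OF Q(3) _ \<open>T \<subseteq> Q\<close>] a(2) b(2) by simp_all
    then have "a extreme_point_of T" "b extreme_point_of T"
      using extreme_point_of_face[OF T(1)] a(1) b(1) by simp_all
    moreover have "a \<noteq> b" using uw(1) a(3) b(3) by blast
    ultimately have "T = closed_segment a b"
      by (intro convex_segment_if_extreme_points T face_of_imp_convex[OF T(1)])
    then show ?thesis by (simp add: bounded_closed_segment)
  qed
  then have "bounded Q" by (rule polyhedron_bounded_if_edges_bounded[OF Q(1) x])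
  then have "polytope Q" using Q(1) by (simp add: polytope_eq_bounded_polyhedron)
  with chart show ?thesis by (intro exI conjI)
qed

lemma vertexed_cell_compact:
  assumes "i \<le> m" "\<sigma> \<in> P i" "v \<in> P 0" "v \<subseteq> \<sigma>" shows "compact \<sigma>"
proof -
  obtain Q \<psi> where chart: "chart_of i \<sigma> Q \<psi>" "polytope Q" using vertexed_cell[OF assms] by (elim exE conjE)
  have "continuous_on Q \<psi>" "\<sigma> = \<psi> ` Q" by (rule chart_ofD[OF chart(1)])+
  with chart(2) show ?thesis using compact_continuous_image polytope_imp_compact by blast
qed

lemma vertexed_cell_face_vertex:
  assumes "i \<le> m" "\<sigma> \<in> P i" "v \<in> P 0" "v \<subseteq> \<sigma>" and \<rho>: "j \<le> i" "\<rho> \<in> P j" "\<rho> \<subseteq> \<sigma>"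
  obtains w where "w \<in> P 0" "w \<subseteq> \<rho>"
proof -
  obtain Q \<psi> where chart: "chart_of i \<sigma> Q \<psi>" "polytope Q" using vertexed_cell[OF assms(1-4)] by (elim exE conjE)
  note Q = chart(2) chart_ofD(2,3)[OF chart(1)]
  obtain T where T: "T face_of Q" "aff_dim T = int j" "\<rho> = \<psi> ` T" by (rule chart_faceE[OF chart(1) \<rho>(2,3,1)])
  have "T \<noteq> {}" using T(2) by auto
  then obtain a where "a extreme_point_of T"
    using polytope_extreme_point_exists[OF face_of_polytope_polytope[OF Q(1) T(1)]] by blast
  then have a: "a extreme_point_of Q" "a \<in> T" using extreme_point_of_face[OF T(1)] by auto
  have "{\<psi> a} \<in> P 0" by (rule chart_vertexI(1)[OF chart(1) a(1)])
  then show ?thesis by (rule that) (use a T in blast)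
qed

text \<open>The edge graph of the chart polytope is connected, and the chart carries its edges to
  edges of the tessellation.\<close>

lemma vertexed_cell_joined:
  assumes "i \<le> m" "\<sigma> \<in> P i" and u: "u \<in> P 0" "u \<subseteq> \<sigma>" and v: "v \<in> P 0" "v \<subseteq> \<sigma>"
  shows "joined_by (end_vertexes P) {e \<in> P 1. e \<subseteq> \<sigma>} u v"
proof -
  obtain Q \<psi> where chart: "chart_of i \<sigma> Q \<psi>" "polytope Q" using vertexed_cell[OF assms(1,2) u] by (elim exE conjE)
  note Q = chart(2) chart_ofD(2,3)[OF chart(1)]
  obtain a where a: "a extreme_point_of Q" "u = {\<psi> a}" by (rule chart_vertexE[OF chart(1) u])
  obtain b where b: "b extreme_point_of Q" "v = {\<psi> b}" by (rule chart_vertexE[OF chart(1) v])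
  note ab = a b
  have "(polytope_edge Q)\<^sup>*\<^sup>* a b" by (rule polytope_vertices_joined[OF Q(1) ab(1,3)])
  then have "joined_by (end_vertexes P) {e \<in> P 1. e \<subseteq> \<sigma>} {\<psi> a} {\<psi> b}"
  proof (induction rule: rtranclp_induct)
    case (step x y)
    then obtain T where T: "x \<noteq> y" "x extreme_point_of Q" "y extreme_point_of Q"
      "T face_of Q" "aff_dim T = 1" "x \<in> T" "y \<in> T" unfolding polytope_edge_def by blast
    have sub: "T \<subseteq> Q" using T(4) by (rule face_of_imp_subset)
    then have "1 \<le> i" using aff_dim_subset[of T Q] T(5) Q(2) by simp
    then have e: "\<psi> ` T \<in> P 1" "\<psi> ` T \<subseteq> \<sigma>" using chart_faceI[OF chart(1) T(4), of 1] T(5) by simp_all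
    have "{\<psi> x} \<noteq> {\<psi> y}" using T(1,6,7) sub inj_onD[OF Q(3)] by blast
    then have "end_vertexes P (\<psi> ` T) = {{\<psi> x}, {\<psi> y}}"
      using T(6,7) by (intro edge_end_vertexes_eq e chart_vertexI(1)[OF chart(1)] T(2,3)) auto
    then have "joined_by (end_vertexes P) {e \<in> P 1. e \<subseteq> \<sigma>} {\<psi> x} {\<psi> y}"
      using e by (intro joined_by_edge[of "\<psi> ` T"]) auto
    then show ?case using step.IH by (blast intro: joined_by_trans)
  qed simp
  then show ?thesis using ab by simp
qed

lemma finite_edges_of_vertexed_cell:
  assumes "i \<le> m" "1 \<le> i" "\<sigma> \<in> P i" "v \<in> P 0" "v \<subseteq> \<sigma>" shows "finite {e \<in> P 1. e \<subseteq> \<sigma>}"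
proof -
  obtain Q \<psi> where chart: "chart_of i \<sigma> Q \<psi>" "polytope Q" using vertexed_cell[OF assms(1,3-5)] by (elim exE conjE)
  note Q = chart(2) chart_ofD(2,3)[OF chart(1)]
  have "{e \<in> P 1. e \<subseteq> \<sigma>} \<subseteq> (\<lambda>T. \<psi> ` T) ` {T. T face_of Q}"
    using chart_faceE[OF chart(1) _ _ assms(2)] by blast
  moreover have "finite {T. T face_of Q}" by (rule finite_polytope_faces[OF Q(1)])
  ultimately show ?thesis using finite_subset finite_imageI by blast
qed

text \<open>For \<open>i\<close> at least 1 the chart polytope has a second extreme point, being the
  convex hull of its extreme points; the first edge of a path to it is the one sought.\<close>

lemma vertexed_cell_edge_at:
  assumes "i \<le> m" "1 \<le> i" "\<sigma> \<in> P i" "v \<in> P 0" "v \<subseteq> \<sigma>"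
  obtains e where "e \<in> P 1" "e \<subseteq> \<sigma>" "v \<in> end_vertexes P e"
proof -
  obtain Q \<psi> where chart: "chart_of i \<sigma> Q \<psi>" "polytope Q" using vertexed_cell[OF assms(1,3-5)] by (elim exE conjE)
  note Q = chart(2) chart_ofD(2,3)[OF chart(1)]
  obtain a where a: "a extreme_point_of Q" "v = {\<psi> a}" by (rule chart_vertexE[OF chart(1) assms(4,5)])
  have "\<exists>b. b extreme_point_of Q \<and> b \<noteq> a"
  proof (rule ccontr)
    assume "\<not> ?thesis"
    then have "{x. x extreme_point_of Q} = {a}" using a(1) by blast
    then have "Q = {a}"
      using Krein_Milman_Minkowski[OF polytope_imp_compact[OF Q(1)] polytope_imp_convex[OF Q(1)]] by simp
    then show False using Q(2) assms(2) by simp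
  qed
  then obtain b where b: "b extreme_point_of Q" "b \<noteq> a" by blast
  have ab: "a \<in> Q" "b \<in> Q" using a b by (auto simp: extreme_point_of_def)
  have w: "{\<psi> b} \<in> P 0" "{\<psi> b} \<subseteq> \<sigma>" by (rule chart_vertexI[OF chart(1) b(1)])+
  have ne: "v \<noteq> {\<psi> b}" using a(2) b(2) ab inj_onD[OF Q(3)] by blast
  have "joined_by (end_vertexes P) {e \<in> P 1. e \<subseteq> \<sigma>} v {\<psi> b}"
    by (rule vertexed_cell_joined[OF assms(1,3-5) w])
  then have "\<exists>y. \<exists>f\<in>{e \<in> P 1. e \<subseteq> \<sigma>}. end_vertexes P f = {v, y}"
    unfolding joined_by_def by (rule converse_rtranclpE) (use ne in blast)+
  then obtain y f where "f \<in> P 1" "f \<subseteq> \<sigma>" "end_vertexes P f = {v, y}" by blast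
  then show ?thesis by (intro that[of f]) auto
qed

text \<open>Meeting cells share a face, and faces of a cell with a vertex have vertexes. Only
  \<sigma> has to be known to contain one, so this property spreads along chains of cells.\<close>

lemma cells_common_vertex:
  assumes "i \<le> m" "j \<le> m" "\<sigma> \<in> P i" "\<tau> \<in> P j" "v \<in> P 0" "v \<subseteq> \<sigma>" "\<sigma> \<inter> \<tau> \<noteq> {}"
  obtains w where "w \<in> P 0" "w \<subseteq> \<sigma>" "w \<subseteq> \<tau>"
proof -
  obtain x where x: "x \<in> \<sigma>" "x \<in> \<tau>" using assms(7) by blast
  obtain \<rho> k where \<rho>: "\<rho> \<subseteq> \<sigma>" "\<rho> \<subseteq> \<tau>" "k \<le> i" "\<rho> \<in> P k" by (rule cell_Int[OF assms(1-4) x])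
  obtain w where "w \<in> P 0" "w \<subseteq> \<rho>" by (rule vertexed_cell_face_vertex[OF assms(1,3,5,6) \<rho>(3,4,1)])
  then show ?thesis using \<rho> by (intro that[of w]) auto
qed

lemma m_pos: "1 \<le> m"
  using top_cells(1) d_pos by linarith

text \<open>A point of \<open>e\<close> other than its ends lies in some cell of full dimension. The
  common face through that point cannot be a vertex, so it is \<open>e\<close> itself.\<close>

lemma edge_in_top_cell:
  assumes e: "e \<in> P 1" obtains \<sigma> where "\<sigma> \<in> P CARD('d)" "e \<subseteq> \<sigma>"
proof -
  obtain u v where uv: "u \<noteq> v" "u \<in> P 0" "v \<in> P 0" "u \<subseteq> e" "v \<subseteq> e" "end_vertexes P e = {u, v}"
    by (rule edge_two_vertexes[OF e])
  have conn: "connected e" by (rule is_cell_properties(2)[OF cell[OF m_pos e]])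
  obtain a b where ab: "u = {a}" "v = {b}" using vertex_singleton uv by metis
  have "infinite e"
  proof
    assume "finite e"
    then have "\<exists>x. e = {x}" using conn connected_finite_iff_sing[of e] uv(4) ab by auto
    then show False using uv ab by auto
  qed
  then obtain x where x: "x \<in> e" "x \<notin> {a, b}" by (meson finite.emptyI finite_insert finite_subset subsetI)
  obtain \<sigma> where \<sigma>: "\<sigma> \<in> P CARD('d)" "x \<in> \<sigma>" using top_cells(2) by blast
  obtain \<rho> k where \<rho>: "x \<in> \<rho>" "\<rho> \<subseteq> e" "\<rho> \<subseteq> \<sigma>" "k \<le> 1" "\<rho> \<in> P k"
    by (rule cell_Int[OF m_pos top_cells(1) e \<sigma>(1) x(1) \<sigma>(2)])
  have "k \<noteq> 0"
  proof
    assume "k = 0"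
    then have "\<rho> \<in> end_vertexes P e" using \<rho> by (auto simp: end_vertexes_def)
    then show False using uv(6) ab x(2) \<rho>(1) by auto
  qed
  then have \<rho>1: "\<rho> \<in> P 1" using \<rho> by (metis le_neq_implies_less less_one)
  obtain Q \<psi> where chart: "chart_of 1 e Q \<psi>" using ex_chart_of[OF m_pos e] by (elim exE)
  note Q = chart_ofD(1,2,5)[OF chart]
  obtain T where T: "T face_of Q" "aff_dim T = int 1" "\<rho> = \<psi> ` T" by (rule chart_faceE[OF chart \<rho>1 \<rho>(2)]) simp
  have "T = Q" using face_of_aff_dim_lt[OF polyhedron_imp_convex[OF Q(1)] T(1)] T(2) Q(2) by auto
  then have "e \<subseteq> \<sigma>" using T Q \<rho> by simp
  then show ?thesis using \<sigma> by (intro that)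
qed

lemma top_cells_chain:
  assumes "\<sigma> \<in> P CARD('d)" "\<tau> \<in> P CARD('d)"
  shows "(meets_in (P CARD('d)))\<^sup>*\<^sup>* \<sigma> \<tau>"
  using closed_Union_cells[OF top_cells(1)] assms top_cells(2)
    is_cell_properties(3)[OF cell[OF top_cells(1)]]
  by (intro connected_Union_chain) auto

lemma bounded_edge: assumes "e \<in> P 1" shows "bounded e"
proof -
  obtain u where "u \<in> P 0" "u \<subseteq> e" by (rule edge_two_vertexes[OF assms])
  then show ?thesis using vertexed_cell_compact[OF m_pos assms] compact_imp_bounded by blast
qed

lemma finite_top_cells_of_edge: assumes "e \<in> P 1" shows "finite {\<sigma> \<in> P CARD('d). e \<subseteq> \<sigma>}"
proof (rule finite_subset[OF _ finite_meeting[OF top_cells(1) bounded_edge[OF assms]]])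
  have "e \<noteq> {}" by (rule is_cell_properties(3)[OF cell[OF m_pos assms]])
  then show "{\<sigma> \<in> P CARD('d). e \<subseteq> \<sigma>} \<subseteq> {\<sigma> \<in> P CARD('d). \<sigma> \<inter> e \<noteq> {}}" by blast
qed

lemma cell_with_edge_vertexed:
  assumes "e \<in> P 1" "e \<subseteq> \<sigma>" obtains v where "v \<in> P 0" "v \<subseteq> \<sigma>"
proof -
  obtain u where "u \<in> P 0" "u \<subseteq> e" by (rule edge_two_vertexes[OF assms(1)])
  then show ?thesis using assms(2) by (intro that[of u]) auto
qed

lemma finite_edge_neighbours: assumes e: "e \<in> P 1" shows "finite (edge_neighbours P {e})"
proof (rule finite_subset)
  show "edge_neighbours P {e} \<subseteq> (\<Union>\<sigma>\<in>{\<sigma> \<in> P CARD('d). e \<subseteq> \<sigma>}. {f \<in> P 1. f \<subseteq> \<sigma>})"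
    unfolding edge_neighbours_def by blast
  show "finite (\<Union>\<sigma>\<in>{\<sigma> \<in> P CARD('d). e \<subseteq> \<sigma>}. {f \<in> P 1. f \<subseteq> \<sigma>})"
  proof (intro finite_UN_I finite_top_cells_of_edge e)
    fix \<sigma> assume "\<sigma> \<in> {\<sigma> \<in> P CARD('d). e \<subseteq> \<sigma>}"
    then have \<sigma>: "\<sigma> \<in> P CARD('d)" "e \<subseteq> \<sigma>" by auto
    obtain v where "v \<in> P 0" "v \<subseteq> \<sigma>" by (rule cell_with_edge_vertexed[OF e \<sigma>(2)])
    then show "finite {f \<in> P 1. f \<subseteq> \<sigma>}" by (rule finite_edges_of_vertexed_cell[OF top_cells(1) d_pos \<sigma>(1)])
  qed
qed

end

section \<open>Separation of vertexes by finite sets of edges\<close>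

lemma rtranclp_meets_in_mono:
  assumes "(meets_in \<A>)\<^sup>*\<^sup>* X Y" "\<A> \<subseteq> \<B>" shows "(meets_in \<B>)\<^sup>*\<^sup>* X Y"
  using assms(1) by (rule rtranclp_mono[THEN predicate2D, rotated]) (use assms(2) in blast)

context tessellation_graph begin

abbreviation ends :: "(real^'d) set \<Rightarrow> (real^'d) set set" where
  "ends \<equiv> end_vertexes P"

abbreviation edges_linked :: "(real^'d) set \<Rightarrow> (real^'d) set \<Rightarrow> bool" where
  "edges_linked e f \<equiv> f \<in> edge_neighbours P {e} \<or> ends e \<inter> ends f \<noteq> {}"

lemma edges_linked_if_same_cell:
  assumes "e \<in> P 1" "f \<in> P 1" "\<sigma> \<in> P CARD('d)" "e \<subseteq> \<sigma>" "f \<subseteq> \<sigma>" shows "edges_linked e f"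
proof (cases "e = f")
  case True
  then show ?thesis using edge_two_vertexes[OF assms(1)] by (metis inf.idem insert_not_empty)
qed (use assms in \<open>auto simp: edge_neighbours_def\<close>)

text \<open>Along a chain of meeting cells of full dimension consecutive cells share a vertex, at
  which an edge of each ends; edges of one cell are linked anyway. The induction also carries along
  that the cells contain vertexes.\<close>

lemma edges_chain:
  assumes e: "e \<in> P 1" "f \<in> P 1"
  shows "(\<lambda>x y. x \<in> P 1 \<and> y \<in> P 1 \<and> edges_linked x y)\<^sup>*\<^sup>* e f"
proof -
  let ?R = "\<lambda>x y. x \<in> P 1 \<and> y \<in> P 1 \<and> edges_linked x y"
  obtain \<sigma> where \<sigma>: "\<sigma> \<in> P CARD('d)" "e \<subseteq> \<sigma>" by (rule edge_in_top_cell[OF e(1)])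
  obtain \<tau> where \<tau>: "\<tau> \<in> P CARD('d)" "f \<subseteq> \<tau>" by (rule edge_in_top_cell[OF e(2)])
  have "(\<exists>v\<in>P 0. v \<subseteq> Y) \<and> (\<forall>g\<in>P 1. g \<subseteq> Y \<longrightarrow> ?R\<^sup>*\<^sup>* e g)"
    if "(meets_in (P CARD('d)))\<^sup>*\<^sup>* \<sigma> Y" for Y
    using that
  proof (induction rule: rtranclp_induct)
    case base
    have "?R\<^sup>*\<^sup>* e g" if g: "g \<in> P 1" "g \<subseteq> \<sigma>" for g
      using edges_linked_if_same_cell[OF e(1) g(1) \<sigma> g(2)] e g by (intro r_into_rtranclp) blast
    moreover have "\<exists>v\<in>P 0. v \<subseteq> \<sigma>" using cell_with_edge_vertexed[OF e(1) \<sigma>(2)] by blast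
    ultimately show ?case by blast
  next
    case (step X Y)
    then have X: "X \<in> P CARD('d)" and Y: "Y \<in> P CARD('d)" and XY: "X \<inter> Y \<noteq> {}" by auto
    obtain v where v: "v \<in> P 0" "v \<subseteq> X" using step.IH by blast
    obtain w where w: "w \<in> P 0" "w \<subseteq> X" "w \<subseteq> Y"
      by (rule cells_common_vertex[OF top_cells(1) top_cells(1) X Y v XY])
    obtain g where g: "g \<in> P 1" "g \<subseteq> X" "w \<in> ends g"
      by (rule vertexed_cell_edge_at[OF top_cells(1) d_pos X w(1,2)])
    obtain h where h: "h \<in> P 1" "h \<subseteq> Y" "w \<in> ends h"
      by (rule vertexed_cell_edge_at[OF top_cells(1) d_pos Y w(1,3)])
    have "?R\<^sup>*\<^sup>* e g" using step.IH g by blast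
    moreover have "?R g h" using g h by blast
    ultimately have eh: "?R\<^sup>*\<^sup>* e h" by (rule rtranclp.rtrancl_into_rtrancl)
    have "?R\<^sup>*\<^sup>* e k" if k: "k \<in> P 1" "k \<subseteq> Y" for k
    proof (rule rtranclp.rtrancl_into_rtrancl[OF eh])
      show "?R h k" using edges_linked_if_same_cell[OF h(1) k(1) Y h(2) k(2)] h k by blast
    qed
    then show ?case using w by blast
  qed
  then show ?thesis using top_cells_chain[OF \<sigma>(1) \<tau>(1)] \<tau>(2) e(2) by blast
qed

lemma edge_neighbours_eq: "edge_neighbours P H = (\<Union>h\<in>H. edge_neighbours P {h}) - H"
  unfolding edge_neighbours_def by blast

text \<open>
  The cells containing an edge of \<open>H\<close> cover a connected set. The remaining cells that can be
  reached from one of them form a connected set, as does the union of all other cells. By unicoherence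
  of Euclidean space these two sets meet in a connected set, which is a finite union of cells all of
  whose edges belong to \<open>edge_neighbours P H\<close>.
\<close>

lemma vertexes_joined_around:
  assumes H: "finite H" "H \<subseteq> P 1"
    and conn: "\<And>h h'. h \<in> H \<Longrightarrow> h' \<in> H \<Longrightarrow> (\<lambda>x y. x \<in> H \<and> y \<in> H \<and> edges_linked x y)\<^sup>*\<^sup>* h h'"
  defines "\<K> \<equiv> {\<sigma> \<in> P CARD('d). \<exists>h\<in>H. h \<subseteq> \<sigma>}"
  defines "\<M> \<equiv> P CARD('d) - \<K>"
  assumes uv: "u \<in> P 0" "v \<in> P 0" "u \<subseteq> \<Union>\<K>" "v \<subseteq> \<Union>\<K>"
    and \<tau>: "\<tau> \<in> \<M>" "\<tau>' \<in> \<M>" "(meets_in \<M>)\<^sup>*\<^sup>* \<tau> \<tau>'" "u \<subseteq> \<tau>" "v \<subseteq> \<tau>'"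
  shows "joined_by ends (edge_neighbours P H) u v"
proof -
  let ?d = "CARD('d)"
  note top = top_cells(1)
  have ne: "\<sigma> \<noteq> {}" and cn: "connected \<sigma>" if "\<sigma> \<in> P ?d" for \<sigma>
    using is_cell_properties(2,3)[OF cell[OF top that]] by simp_all
  have \<K>P: "\<K> \<subseteq> P ?d" and \<M>P: "\<M> \<subseteq> P ?d" unfolding \<K>_def \<M>_def by auto
  have finK: "finite \<K>"
  proof (rule finite_subset)
    show "\<K> \<subseteq> (\<Union>h\<in>H. {\<sigma> \<in> P ?d. h \<subseteq> \<sigma>})" unfolding \<K>_def by blast
    show "finite (\<Union>h\<in>H. {\<sigma> \<in> P ?d. h \<subseteq> \<sigma>})"
      using H by (intro finite_UN_I finite_top_cells_of_edge) auto
  qed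
  have Kv: "\<exists>w\<in>P 0. w \<subseteq> \<sigma>" if "\<sigma> \<in> \<K>" for \<sigma>
  proof -
    from that obtain h where "h \<in> H" and hs: "h \<subseteq> \<sigma>" unfolding \<K>_def by blast
    then have h: "h \<in> P 1" using H(2) by blast
    then show ?thesis using cell_with_edge_vertexed[OF h hs] by blast
  qed
  have "bounded \<sigma>" if "\<sigma> \<in> \<K>" for \<sigma>
    using Kv[OF that] that \<K>P vertexed_cell_compact[OF top] compact_imp_bounded by blast
  then have Kb: "bounded (\<Union>\<K>)" using finK by (intro bounded_Union) auto
  \<comment> \<open>A chain of linked edges of \<open>H\<close> yields a chain of cells:
    neighbouring edges share a cell, and edges with a common end lie in cells that meet
    there.\<close>
  have K_chain: "(meets_in \<K>)\<^sup>*\<^sup>* \<sigma> \<sigma>'" if \<sigma>: "\<sigma> \<in> \<K>" "\<sigma>' \<in> \<K>" for \<sigma> \<sigma>'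
  proof -
    from \<sigma> obtain h h' where h: "h \<in> H" "h \<subseteq> \<sigma>" "h' \<in> H" "h' \<subseteq> \<sigma>'" unfolding \<K>_def by blast
    have e_ne: "e \<noteq> {}" if "e \<in> H" for e
      using is_cell_properties(3)[OF cell[OF m_pos]] that H by blast
    have "\<forall>\<rho>\<in>\<K>. g \<subseteq> \<rho> \<longrightarrow> (meets_in \<K>)\<^sup>*\<^sup>* \<sigma> \<rho>"
      if "(\<lambda>x y. x \<in> H \<and> y \<in> H \<and> edges_linked x y)\<^sup>*\<^sup>* h g" for g
      using that
    proof (induction rule: rtranclp_induct)
      case base
      show ?case
      proof (intro ballI impI r_into_rtranclp conjI \<sigma>(1))
        fix \<rho> assume "\<rho> \<in> \<K>" "h \<subseteq> \<rho>"
        then show "\<rho> \<in> \<K>" "\<sigma> \<inter> \<rho> \<noteq> {}" using h(2) e_ne[OF h(1)] by blast+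
      qed
    next
      case (step x y)
      then have xy: "x \<in> H" "y \<in> H" "edges_linked x y" by auto
      show ?case
      proof (intro ballI impI)
        fix \<rho> assume \<rho>: "\<rho> \<in> \<K>" "y \<subseteq> \<rho>"
        from xy(3) show "(meets_in \<K>)\<^sup>*\<^sup>* \<sigma> \<rho>"
        proof
          assume "y \<in> edge_neighbours P {x}"
          then obtain \<kappa> where \<kappa>: "\<kappa> \<in> P ?d" "y \<subseteq> \<kappa>" "x \<subseteq> \<kappa>" unfolding edge_neighbours_def by blast
          then have "\<kappa> \<in> \<K>" unfolding \<K>_def using xy(1) by blast
          then have "(meets_in \<K>)\<^sup>*\<^sup>* \<sigma> \<kappa>" using step.IH \<kappa>(3) by blast
          moreover have "\<kappa> \<inter> \<rho> \<noteq> {}" using \<kappa>(2) \<rho>(2) e_ne[OF xy(2)] by blast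
          ultimately show ?thesis using \<open>\<kappa> \<in> \<K>\<close> \<rho>(1) by (auto intro: rtranclp.rtrancl_into_rtrancl)
        next
          assume "ends x \<inter> ends y \<noteq> {}"
          then obtain w where w: "w \<in> P 0" "w \<subseteq> x" "w \<subseteq> y" by (auto simp: end_vertexes_def)
          obtain \<kappa> where \<kappa>: "\<kappa> \<in> P ?d" "x \<subseteq> \<kappa>" using edge_in_top_cell[of x] xy(1) H by blast
          then have "\<kappa> \<in> \<K>" unfolding \<K>_def using xy(1) by blast
          then have "(meets_in \<K>)\<^sup>*\<^sup>* \<sigma> \<kappa>" using step.IH \<kappa>(2) by blast
          moreover have "\<kappa> \<inter> \<rho> \<noteq> {}" using \<kappa>(2) \<rho>(2) w vertex_singleton[OF w(1)] by blast
          ultimately show ?thesis using \<open>\<kappa> \<in> \<K>\<close> \<rho>(1) by (auto intro: rtranclp.rtrancl_into_rtrancl)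
        qed
      qed
    qed
    then show ?thesis using conn[OF h(1,3)] h(4) \<sigma>(2) by blast
  qed
  obtain a where a: "u = {a}" using vertex_singleton[OF uv(1)] by blast
  obtain b where b: "v = {b}" using vertex_singleton[OF uv(2)] by blast
  obtain \<sigma>0 where \<sigma>0: "\<sigma>0 \<in> \<K>" "a \<in> \<sigma>0" using uv(3) a by blast
  define \<U> where "\<U> = {\<rho> \<in> \<M>. (meets_in \<M>)\<^sup>*\<^sup>* \<tau> \<rho>}"
  define \<V> where "\<V> = \<K> \<union> (\<M> - \<U>)"
  have UV: "\<U> \<subseteq> P ?d" "\<V> \<subseteq> P ?d" "\<U> \<union> \<V> = P ?d" unfolding \<U>_def \<V>_def \<M>_def \<K>_def by auto
  have disj: "X \<inter> Y = {}" if "X \<in> \<U>" "Y \<in> \<M> - \<U>" for X Y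
  proof (rule ccontr)
    assume XY: "X \<inter> Y \<noteq> {}"
    have "(meets_in \<M>)\<^sup>*\<^sup>* \<tau> X" "X \<in> \<M>" using that(1) unfolding \<U>_def by auto
    moreover have "meets_in \<M> X Y" using that calculation(2) XY by blast
    ultimately have "(meets_in \<M>)\<^sup>*\<^sup>* \<tau> Y" by (auto intro: rtranclp.rtrancl_into_rtrancl)
    then show False using that(2) unfolding \<U>_def by blast
  qed
  have \<tau>U: "\<tau> \<in> \<U>" "\<tau>' \<in> \<U>" using \<tau> unfolding \<U>_def by auto
  have U_chain: "(meets_in \<U>)\<^sup>*\<^sup>* \<tau> X" if "(meets_in \<M>)\<^sup>*\<^sup>* \<tau> X" for X
    using that
  proof (induction rule: rtranclp_induct)
    case (step X Y)
    have "(meets_in \<M>)\<^sup>*\<^sup>* \<tau> Y" using step.hyps by (rule rtranclp.rtrancl_into_rtrancl)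
    then have "meets_in \<U> X Y" using step.hyps unfolding \<U>_def by blast
    with step.IH show ?case by (rule rtranclp.rtrancl_into_rtrancl)
  qed simp
  have connU: "connected (\<Union>\<U>)"
  proof (rule connected_Union_chainI[OF _ _ \<tau>U(1)])
    show "connected X" if "X \<in> \<U>" for X using that UV(1) cn by blast
    show "{} \<notin> \<U>" using UV(1) ne by blast
    show "(meets_in \<U>)\<^sup>*\<^sup>* \<tau> X" if "X \<in> \<U>" for X using that U_chain unfolding \<U>_def by blast
  qed
  \<comment> \<open>A cell outside \<open>\<K>\<close> and \<open>\<U>\<close> cannot be entered
    from \<open>\<U>\<close>, so its predecessor in the chain lies in \<open>\<V>\<close>; cells of
    \<open>\<K>\<close> are reached from \<open>\<sigma>0\<close> within
    \<open>\<K>\<close>.\<close>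
  have V_chain: "Y \<in> \<V> \<longrightarrow> (meets_in \<V>)\<^sup>*\<^sup>* \<sigma>0 Y" if "(meets_in (P ?d))\<^sup>*\<^sup>* \<sigma>0 Y" for Y
    using that
  proof (induction rule: rtranclp_induct)
    case (step X Y)
    show ?case
    proof
      assume Y: "Y \<in> \<V>"
      show "(meets_in \<V>)\<^sup>*\<^sup>* \<sigma>0 Y"
      proof (cases "Y \<in> \<K>")
        case True
        show ?thesis by (rule rtranclp_meets_in_mono[OF K_chain[OF \<sigma>0(1) True]]) (simp add: \<V>_def)
      next
        case False
        then have YM: "Y \<in> \<M> - \<U>" using Y unfolding \<V>_def by blast
        then have "X \<notin> \<U>" using disj[of X Y] step.hyps by blast
        then have X: "X \<in> \<V>" using step.hyps UV(3) by blast
        then have "meets_in \<V> X Y" using Y step.hyps by blast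
        then show ?thesis using step.IH X by (auto intro: rtranclp.rtrancl_into_rtrancl)
      qed
    qed
  qed simp
  have \<sigma>0V: "\<sigma>0 \<in> \<V>" using \<sigma>0 unfolding \<V>_def by blast
  have connV: "connected (\<Union>\<V>)"
  proof (rule connected_Union_chainI[OF _ _ \<sigma>0V])
    show "connected X" if "X \<in> \<V>" for X using that UV(2) cn by blast
    show "{} \<notin> \<V>" using UV(2) ne by blast
    show "(meets_in \<V>)\<^sup>*\<^sup>* \<sigma>0 X" if "X \<in> \<V>" for X
      using that V_chain[OF top_cells_chain] \<sigma>0V UV(2) by blast
  qed
  have "\<Union>\<V> \<union> \<Union>\<U> = UNIV" using UV(3) top_cells(2) by blast
  then have conn_int: "connected (\<Union>\<V> \<inter> \<Union>\<U>)"
    using unicoherent_UNIV[where 'a = "real^'d", unfolded unicoherent_def] connV connU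
      closed_Union_cells[OF top UV(1)] closed_Union_cells[OF top UV(2)] by auto
  \<comment> \<open>Common faces of cells of \<open>\<K>\<close> and of \<open>\<U>\<close>. The
    cells of \<open>\<M> - \<U>\<close> are disjoint from those of \<open>\<U>\<close>, so these
    faces fill the whole intersection.\<close>
  define \<A> where "\<A> = {\<rho>. \<rho> \<noteq> {} \<and> (\<exists>k\<le>?d. \<rho> \<in> P k) \<and> (\<exists>\<sigma>\<in>\<K>. \<rho> \<subseteq> \<sigma>) \<and> (\<exists>\<kappa>\<in>\<U>. \<rho> \<subseteq> \<kappa>)}"
  have cover_A: "\<exists>\<rho>\<in>\<A>. x \<in> \<rho>" if x: "x \<in> \<sigma>" "\<sigma> \<in> \<K>" "x \<in> \<kappa>" "\<kappa> \<in> \<U>" for x \<sigma> \<kappa>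
  proof -
    obtain \<rho> k where "x \<in> \<rho>" "\<rho> \<subseteq> \<sigma>" "\<rho> \<subseteq> \<kappa>" "k \<le> ?d" "\<rho> \<in> P k"
      by (rule cell_Int[OF top top _ _ x(1,3)]) (use x UV(1) \<K>P in blast)+
    then show ?thesis unfolding \<A>_def using x by blast
  qed
  have A_eq: "\<Union>\<A> = \<Union>\<V> \<inter> \<Union>\<U>"
  proof (intro equalityI subsetI)
    fix x assume "x \<in> \<Union>\<A>"
    then show "x \<in> \<Union>\<V> \<inter> \<Union>\<U>" unfolding \<A>_def \<V>_def by blast
  next
    fix x assume "x \<in> \<Union>\<V> \<inter> \<Union>\<U>"
    then obtain X \<kappa> where x: "x \<in> X" "X \<in> \<V>" "x \<in> \<kappa>" "\<kappa> \<in> \<U>" by blast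
    have "X \<in> \<K>" using x disj[of \<kappa> X] unfolding \<V>_def by blast
    then show "x \<in> \<Union>\<A>" using cover_A[OF x(1) _ x(3,4)] by blast
  qed
  have A_P: "\<exists>k\<le>m. \<rho> \<in> P k" if "\<rho> \<in> \<A>" for \<rho> using that top unfolding \<A>_def by (blast intro: le_trans)
  have finA: "finite \<A>"
  proof (rule finite_subset)
    show "\<A> \<subseteq> (\<Union>k\<in>{..?d}. {\<rho> \<in> P k. \<rho> \<inter> \<Union>\<K> \<noteq> {}})" unfolding \<A>_def by blast
    show "finite (\<Union>k\<in>{..?d}. {\<rho> \<in> P k. \<rho> \<inter> \<Union>\<K> \<noteq> {}})"
      using top Kb by (intro finite_UN_I finite_meeting) auto
  qed
  have closed_A: "closed \<rho>" if "\<rho> \<in> \<A>" for \<rho>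
  proof -
    from A_P[OF that] obtain k where k: "k \<le> m" "\<rho> \<in> P k" by blast
    show ?thesis by (rule is_cell_properties(1)[OF cell[OF k]])
  qed
  have A_vertex: "\<exists>w\<in>P 0. w \<subseteq> \<rho>" if "\<rho> \<in> \<A>" for \<rho>
  proof -
    from that obtain k \<sigma> where k: "k \<le> ?d" "\<rho> \<in> P k" "\<sigma> \<in> \<K>" "\<rho> \<subseteq> \<sigma>" unfolding \<A>_def by blast
    obtain w where w: "w \<in> P 0" "w \<subseteq> \<sigma>" using Kv[OF k(3)] by blast
    have "\<sigma> \<in> P ?d" using k(3) \<K>P by blast
    then show ?thesis using vertexed_cell_face_vertex[OF top _ w k(1,2,4)] by blast
  qed
  have A_joined: "joined_by ends (edge_neighbours P H) x y"
    if "\<rho> \<in> \<A>" "x \<in> P 0" "y \<in> P 0" "x \<subseteq> \<rho>" "y \<subseteq> \<rho>" for \<rho> x y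
  proof -
    from A_P[OF that(1)] obtain k where k: "k \<le> m" "\<rho> \<in> P k" by blast
    from that(1) obtain \<sigma> \<kappa> where \<sigma>: "\<sigma> \<in> \<K>" "\<rho> \<subseteq> \<sigma>" "\<kappa> \<in> \<U>" "\<rho> \<subseteq> \<kappa>" unfolding \<A>_def by blast
    \<comment> \<open>Such an edge shares a cell with an edge of \<open>H\<close>, but does not
      belong to \<open>H\<close>, because it also lies in a cell outside
      \<open>\<K>\<close>.\<close>
    have "{e \<in> P 1. e \<subseteq> \<rho>} \<subseteq> edge_neighbours P H"
    proof
      fix e assume "e \<in> {e \<in> P 1. e \<subseteq> \<rho>}"
      then have e: "e \<in> P 1" "e \<subseteq> \<sigma>" "e \<subseteq> \<kappa>" using \<sigma> by auto
      have "\<kappa> \<in> P ?d" "\<kappa> \<notin> \<K>" using \<sigma>(3) unfolding \<U>_def \<M>_def by auto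
      then have "e \<notin> H" using e(3) unfolding \<K>_def by blast
      then show "e \<in> edge_neighbours P H" using e \<sigma>(1) unfolding edge_neighbours_def \<K>_def by blast
    qed
    with vertexed_cell_joined[OF k that(2,4,3,5)] show ?thesis by (rule joined_by_mono)
  qed
  obtain A where A: "A \<in> \<A>" "a \<in> A" using cover_A[OF \<sigma>0(2,1) _ \<tau>U(1)] \<tau>(4) a by blast
  obtain \<sigma>1 where \<sigma>1: "\<sigma>1 \<in> \<K>" "b \<in> \<sigma>1" using uv(4) b by blast
  obtain B where B: "B \<in> \<A>" "b \<in> B" using cover_A[OF \<sigma>1(2,1) _ \<tau>U(2)] \<tau>(5) b by blast
  have "(meets_in \<A>)\<^sup>*\<^sup>* A B"
  proof (rule connected_Union_chain[OF _ _ _ A(1) B(1)])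
    show "closed (\<Union>\<D>)" if "\<D> \<subseteq> \<A>" for \<D>
      using finA that closed_A by (intro closed_Union) (auto intro: finite_subset)
    show "connected (\<Union>\<A>)" unfolding A_eq by (rule conn_int)
    show "{} \<notin> \<A>" unfolding \<A>_def by blast
  qed
  \<comment> \<open>Consecutive faces of the chain share a vertex, and inside one face vertexes are
    joined by its edges.\<close>
  then have "\<forall>y\<in>P 0. y \<subseteq> B \<longrightarrow> joined_by ends (edge_neighbours P H) u y"
  proof (induction rule: rtranclp_induct)
    case base
    have "u \<subseteq> A" using A a by simp
    then show ?case using A_joined[OF A(1) uv(1)] by blast
  next
    case (step X Y)
    then have XY: "X \<in> \<A>" "Y \<in> \<A>" "X \<inter> Y \<noteq> {}" by auto
    obtain i j where ij: "i \<le> m" "X \<in> P i" "j \<le> m" "Y \<in> P j" using A_P XY(1,2) by blast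
    obtain x where x: "x \<in> P 0" "x \<subseteq> X" using A_vertex[OF XY(1)] by blast
    obtain w where w: "w \<in> P 0" "w \<subseteq> X" "w \<subseteq> Y" by (rule cells_common_vertex[OF ij(1,3,2,4) x XY(3)])
    show ?case
    proof (intro ballI impI)
      fix y assume y: "y \<in> P 0" "y \<subseteq> Y"
      have "joined_by ends (edge_neighbours P H) u w" using step.IH w by blast
      moreover have "joined_by ends (edge_neighbours P H) w y" by (rule A_joined[OF XY(2) w(1) y(1) w(3) y(2)])
      ultimately show "joined_by ends (edge_neighbours P H) u y" by (rule joined_by_trans)
    qed
  qed
  then show ?thesis using uv(2) B b by blast
qed

text \<open>Edges of the path in cells of \<open>\<K>\<close> are themselves neighbours of
  \<open>H\<close>. A stretch through cells outside \<open>\<K>\<close> between vertexes covered by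
  \<open>\<K>\<close> is replaced by means of the preceding lemma.\<close>

lemma joined_around:
  assumes H: "finite H" "H \<subseteq> P 1"
    and conn: "\<And>h h'. h \<in> H \<Longrightarrow> h' \<in> H \<Longrightarrow> (\<lambda>x y. x \<in> H \<and> y \<in> H \<and> edges_linked x y)\<^sup>*\<^sup>* h h'"
    and u: "u \<in> (\<Union>e\<in>H. ends e)" and v: "v \<in> (\<Union>e\<in>H. ends e)"
    and uv: "joined_by ends (P 1 - H) u v"
  shows "joined_by ends (edge_neighbours P H) u v"
proof -
  let ?d = "CARD('d)"
  define \<K> where "\<K> = {\<sigma> \<in> P ?d. \<exists>h\<in>H. h \<subseteq> \<sigma>}"
  define \<M> where "\<M> = P ?d - \<K>"
  let ?J = "joined_by ends (edge_neighbours P H)"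
  note around = vertexes_joined_around[OF H conn, folded \<K>_def, folded \<M>_def]
  have inK: "w \<in> P 0 \<and> w \<subseteq> \<Union>\<K>" if w: "w \<in> (\<Union>e\<in>H. ends e)" for w
  proof -
    obtain h where h: "h \<in> H" "w \<in> P 0" "w \<subseteq> h" using w by (auto simp: end_vertexes_def)
    obtain \<sigma> where "\<sigma> \<in> P ?d" "h \<subseteq> \<sigma>" using edge_in_top_cell[of h] h H by blast
    then show ?thesis using h unfolding \<K>_def by blast
  qed
  \<comment> \<open>At a vertex not covered by \<open>\<K>\<close> the invariant remembers the
    covered vertex \<open>w'\<close> from which the path departed and a chain of cells of
    \<open>\<M>\<close> from there to the current vertex.\<close>
  define I where "I w \<longleftrightarrow> (if w \<subseteq> \<Union>\<K> then ?J u w else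
    (\<exists>w' \<tau> \<tau>'. w' \<in> P 0 \<and> w' \<subseteq> \<Union>\<K> \<and> ?J u w' \<and> \<tau> \<in> \<M> \<and> \<tau>' \<in> \<M> \<and> (meets_in \<M>)\<^sup>*\<^sup>* \<tau> \<tau>' \<and> w' \<subseteq> \<tau> \<and> w \<subseteq> \<tau>'))" for w
  from uv have "v \<in> P 0 \<and> I v"
  proof (induction rule: joined_by_induct)
    case refl
    show ?case using inK[OF u] by (simp add: I_def)
  next
    case (step w w2 e)
    have e: "e \<in> P 1" "e \<notin> H" using step.hyps by auto
    have we: "w \<in> P 0" "w2 \<in> P 0" "w \<subseteq> e" "w2 \<subseteq> e" using step.hyps by (auto simp: end_vertexes_def set_eq_iff)
    have wne: "w \<noteq> {}" using vertex_singleton[OF we(1)] by blast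
    show ?case
    proof (cases "\<exists>\<sigma>\<in>\<K>. e \<subseteq> \<sigma>")
      case True
      then have K: "w \<subseteq> \<Union>\<K>" "w2 \<subseteq> \<Union>\<K>" using we by blast+
      have "e \<in> edge_neighbours P H" using True e unfolding \<K>_def edge_neighbours_def by blast
      then have "?J w w2" using step.hyps by (intro joined_by_edge[of e])
      moreover have "?J u w" using step.IH K by (simp add: I_def)
      ultimately show ?thesis using K we by (auto simp: I_def intro: joined_by_trans)
    next
      case False
      obtain \<tau>e where \<tau>e: "\<tau>e \<in> P ?d" "e \<subseteq> \<tau>e" by (rule edge_in_top_cell[OF e(1)])
      then have \<tau>eM: "\<tau>e \<in> \<M>" using False unfolding \<M>_def by blast
      have sub: "w \<subseteq> \<tau>e" "w2 \<subseteq> \<tau>e" using we \<tau>e by auto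
      have "\<exists>w' \<tau>. w' \<in> P 0 \<and> w' \<subseteq> \<Union>\<K> \<and> ?J u w' \<and> \<tau> \<in> \<M> \<and> (meets_in \<M>)\<^sup>*\<^sup>* \<tau> \<tau>e \<and> w' \<subseteq> \<tau>"
      proof (cases "w \<subseteq> \<Union>\<K>")
        case True
        then show ?thesis using step.IH we(1) sub(1) \<tau>eM by (intro exI[of _ w] exI[of _ \<tau>e]) (simp add: I_def)
      next
        case False
        then obtain w' \<tau> \<tau>' where w': "w' \<in> P 0" "w' \<subseteq> \<Union>\<K>" "?J u w'" "\<tau> \<in> \<M>" "\<tau>' \<in> \<M>"
          "(meets_in \<M>)\<^sup>*\<^sup>* \<tau> \<tau>'" "w' \<subseteq> \<tau>" "w \<subseteq> \<tau>'" using step.IH unfolding I_def by auto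
        have "meets_in \<M> \<tau>' \<tau>e" using w'(5,8) \<tau>eM sub(1) wne by blast
        with w'(6) have "(meets_in \<M>)\<^sup>*\<^sup>* \<tau> \<tau>e" by (rule rtranclp.rtrancl_into_rtrancl)
        then show ?thesis using w' by blast
      qed
      then obtain w' \<tau> where w': "w' \<in> P 0" "w' \<subseteq> \<Union>\<K>" "?J u w'" "\<tau> \<in> \<M>" "(meets_in \<M>)\<^sup>*\<^sup>* \<tau> \<tau>e" "w' \<subseteq> \<tau>"
        by blast
      have "?J u w2" if K: "w2 \<subseteq> \<Union>\<K>"
      proof -
        have "?J w' w2" by (rule around[OF _ _ w'(1) we(2) w'(2) K w'(4) \<tau>eM w'(5,6) sub(2)])
        then show ?thesis using w'(3) by (blast intro: joined_by_trans)
      qed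
      then show ?thesis using w' we(2) sub(2) \<tau>eM unfolding I_def by auto
    qed
  qed
  then show ?thesis using inK[OF v] by (simp add: I_def)
qed

lemma countable_edges: "countable (P 1)"
proof -
  have "P 1 \<subseteq> (\<Union>n. {e \<in> P 1. e \<inter> ball 0 (real n) \<noteq> {}})"
  proof
    fix e assume e: "e \<in> P 1"
    then obtain x where x: "x \<in> e" using is_cell_properties(3)[OF cell[OF m_pos]] by blast
    obtain n where "norm x < real n" using reals_Archimedean2 by blast
    then show "e \<in> (\<Union>n. {e \<in> P 1. e \<inter> ball 0 (real n) \<noteq> {}})" using e x
      by (intro UN_I[of n] CollectI conjI) (auto simp: disjoint_iff)
  qed
  moreover have "countable (\<Union>n. {e \<in> P 1. e \<inter> ball 0 (real n) \<noteq> {}})"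
    by (intro countable_UN countableI_type countable_finite finite_meeting m_pos bounded_ball)
  ultimately show ?thesis by (rule countable_subset)
qed

end

theorem corollary9:
  fixes P :: "nat \<Rightarrow> (real^'d) set set"
    and p :: "(real^'d) set \<Rightarrow> real"
    and q :: real
  defines "V \<equiv> P 0" and "E \<equiv> P 1" and "ends \<equiv> end_vertexes P"
  assumes tessellation: "polyhedral_tessellation P"
    and two_ends: "\<forall>e\<in>E. card (ends e) = 2"
    and p_range: "\<forall>e\<in>E. 0 \<le> p e \<and> p e \<le> 1"
    and q_ge_1: "q \<ge> 1"
    and p_pos: "\<forall>e\<in>E. p e > 0"
    and small: "\<exists>L<1. ((\<lambda>\<Lambda>. SUP e\<in>E - \<Lambda>. ereal (g_hat P p q e)) \<longlongrightarrow> L) (finite_subsets_at_top E)"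
  shows "DLR_random_cluster E ends p q = limit_random_cluster V E ends p q \<and>
         (\<exists>!\<phi>. \<phi> \<in> DLR_random_cluster E ends p q)"
proof -
  obtain m where m: "is_cell_polytope m P" "(\<Union>i\<le>m. \<Union>(P i)) = UNIV"
    using tessellation unfolding polyhedral_tessellation_def by blast
  interpret T: tessellation_graph P m
    using m two_ends by unfold_locales (auto simp: E_def ends_def)
  let ?nb = "\<lambda>e. edge_neighbours P {e}"
  interpret G: rc_graph V E ends ?nb p q
  proof
    show "countable E" unfolding E_def by (rule T.countable_edges)
    show "ends e \<subseteq> V" for e unfolding ends_def V_def end_vertexes_def by blast
    show "?nb e \<subseteq> E - {e}" for e unfolding E_def edge_neighbours_def by blast
    show "finite (?nb e)" if "e \<in> E" for e using that unfolding E_def by (rule T.finite_edge_neighbours)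
    show "e \<in> ?nb f" if "e \<in> E" "f \<in> ?nb e" for e f using that unfolding E_def edge_neighbours_def by blast
  qed (use two_ends p_range p_pos q_ge_1 in auto)
  have outer: "G.outer_nb H = edge_neighbours P H" for H
    unfolding G.outer_nb_def T.edge_neighbours_eq[of H] ..
  interpret G: separating_rc_graph V E ends ?nb p q
  proof
    show "G.link_connected E"
      unfolding G.link_connected_def G.linked_def unfolding E_def ends_def by (intro ballI T.edges_chain)
    fix H u v
    assume H: "finite H" "H \<subseteq> E" "G.link_connected H"
      and uv: "u \<in> (\<Union>e\<in>H. ends e)" "v \<in> (\<Union>e\<in>H. ends e)" "joined_by ends (E - H) u v"
    show "joined_by ends (G.outer_nb H) u v"
      unfolding outer ends_def
    proof (rule T.joined_around)
      show "(\<lambda>x y. x \<in> H \<and> y \<in> H \<and> T.edges_linked x y)\<^sup>*\<^sup>* h h'" if "h \<in> H" "h' \<in> H" for h h'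
        using H(3) that unfolding G.link_connected_def G.linked_def unfolding ends_def by blast
    qed (use H uv in \<open>simp_all add: E_def ends_def\<close>)
  next
    obtain L :: ereal where L: "L < 1" "((\<lambda>\<Lambda>. SUP e\<in>E - \<Lambda>. ereal (g_hat P p q e)) \<longlongrightarrow> L) (finite_subsets_at_top E)"
      using small by blast
    have "\<forall>\<^sub>F \<Lambda> in finite_subsets_at_top E. (SUP e\<in>E - \<Lambda>. ereal (g_hat P p q e)) < 1"
      by (rule order_tendstoD(2)[OF L(2,1)])
    then obtain \<Lambda> where \<Lambda>: "finite \<Lambda>" "\<Lambda> \<subseteq> E" "(SUP e\<in>E - \<Lambda>. ereal (g_hat P p q e)) < 1"
      unfolding eventually_finite_subsets_at_top by blast
    \<comment> \<open>Outside \<Lambda> the value of \<open>g_hat\<close> is below 1. It contains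
      the neighbour sum with factor 3 next to a nonnegative term, whence 1/3.\<close>
    have "(\<Sum>f\<in>?nb e. G.closed_bound f) \<le> 1 / 3" if e: "e \<in> E - \<Lambda>" for e
    proof -
      have "ereal (g_hat P p q e) \<le> (SUP e\<in>E - \<Lambda>. ereal (g_hat P p q e))" using e by (rule SUP_upper)
      then have "ereal (g_hat P p q e) < 1" using \<Lambda>(3) by (rule order_le_less_trans)
      then have "g_hat P p q e < 1" by (simp add: one_ereal_def)
      moreover have "0 \<le> 1 - p_hat p q e" using G.closed_bound_bounds(1)[of e] e by (simp add: G.closed_bound_def)
      moreover have "b \<le> 1 / 3" if "2 * a + 3 * b < 1" "0 \<le> a" for a b :: real using that by linarith
      ultimately show ?thesis unfolding g_hat_def G.closed_bound_def by blast
    qed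
    then show "\<exists>\<Lambda>. finite \<Lambda> \<and> \<Lambda> \<subseteq> E \<and> (\<exists>\<theta><1. \<forall>e\<in>E - \<Lambda>. (\<Sum>f\<in>?nb e. G.closed_bound f) \<le> \<theta>)"
      using \<Lambda>(1,2) by (intro exI[of _ \<Lambda>] conjI exI[of _ "1/3"]) auto
  qed
  show ?thesis by (rule G.DLR_eq_limit_unique)
qed

end
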